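(* Let $p=p_1\otimes\cdots\otimes p_L\in B_{\lambda_1}\otimes\cdots\otimes B_{\lambda_L}$ be a state, let $l_1,\dots,l_t\ge1$, and assume $p_j=u_{\lambda_j}$ for all $j$ in a final segment $L'<j\le L$ whose length $L-L'$ is sufficiently large (depending on $p$ and $l_1,\dots,l_t$). Let $(\lambda,(\mu^{(1)},r^{(1)}),\dots,(\mu^{(n)},r^{(n)}))$ be the unrestricted rigged configuration of $p$, and let $\tau_{k,d}$ be the tau functions of the modified data $(\lambda,(\mu^{(1)},r'^{(1)}),(\mu^{(2)},r^{(2)}),\dots,(\mu^{(n)},r^{(n)}))$, where each rigging of color $1$ is changed to $r'^{(1)}_i=r^{(1)}_i+\sum_{j=1}^t\min(l_j,\mu^{(1)}_i)$. Then $T_{l_1}T_{l_2}\cdots T_{l_t}(p)=p'_1\otimes\cdots\otimes p'_L$ with $p'_k=(x_1,\dots,x_{n+1})$ given by $$x_d=\tau_{k,d}-\tau_{k-1,d}-\tau_{k,d-1}+\tau_{k-1,d-1}\qquad(1\le k\le L,\ 1\le d\le n+1).$$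
   Context: Fix $n\ge1$. For $l\ge1$ let $B_l=\{x=(x_1,\dots,x_{n+1})\in\mathbb Z_{\ge0}^{n+1}: \sum_i x_i=l\}$, $u_l=(l,0,\dots,0)$; a letter $a$ denotes the element of $B_1$ with $x_a=1$. Indices read mod $n+1$. $Q_i(x\otimes y)=\min_{1\le k\le n+1}\big(\sum_{j=1}^{k-1}x_{i+j}+\sum_{j=k+1}^{n+1}y_{i+j}\big)$. Combinatorial $R$: $x\otimes y\mapsto\tilde y\otimes\tilde x$, $\tilde x_i=x_i+Q_i-Q_{i-1}$, $\tilde y_i=y_i+Q_{i-1}-Q_i$, written $\simeq$. Time evolution: for $l\ge1$, $v_0=u_l$, $v_{j-1}\otimes p_j\simeq p'_j\otimes v_j$, $T_l(p)=p'_1\otimes\cdots\otimes p'_L$. Multisets: $|\lambda|=\sum\lambda_i$, $\lambda_{[N]}$ first $N$ entries, $\min(\lambda,\mu)=\sum_{i,j}\min(\lambda_i,\mu_j)$. Vacancy numbers of data $(\mu^{(0)},(\mu^{(a)},r^{(a)})_{a=1}^n)$: $p^{(a)}_j=E^{(a-1)}_j-2E^{(a)}_j+E^{(a+1)}_j$, $E^{(a)}_j=\sum_k\min(j,\mu^{(a)}_k)$, $E^{(n+1)}_j=0$. A rigged configuration is such data (multisets of pairs (row length $\ge1$, rigging)) with $0\le r^{(a)}_i\le p^{(a)}_{\mu^{(a)}_i}$. KKR map (rigged configuration $\to$ path): rows $\mu^{(0)}_L,\dots,\mu^{(0)}_1$ processed in this order, each until empty, by elementary steps each outputting a letter; the $k$-th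 tensor factor has $x_j$ = number of steps outputting $j$ while processing row $k$. Elementary step: $\ell_0$ = current length of processed row; for $i=1,\dots,n$, among rows of $\mu^{(i)}$ of length $\ge\ell_{i-1}$ that are singular (rigging = current vacancy number of its length) choose one of minimal length $\ell_i$, stop if none; if $j-1$ rows chosen output $j$. Remove last box of processed row and of chosen rows (discard empty rows), recompute vacancy numbers, give shortened rows of $\mu^{(1)},\dots,\mu^{(n)}$ the new vacancy number of their new length as rigging, keep other riggings. It is a bijection onto highest paths. Unrestricted rigged configuration of $p\in B_{\lambda_1}\otimes\cdots\otimes B_{\lambda_L}$: let $m_a$ be the number of letters $a$ in $p$, choose $M_a>m_{a+1}$ large, $p_{\rm vac}=(1\otimes\cdots\otimes n)^{\otimes M_n}\otimes\cdots\otimes(1\otimes2)^{\otimes M_2}\otimes1^{\otimes M_1}$, $L_a=\sum_{b=a+1}^n(b-a)M_b$. Then $p_{\rm vac}\otimes p$ is the KKR image of a unique rigged configuration $(\tilde\mu^{(0)},(\tilde\mu^{(a)},\tilde r^{(a)}))$ with $\tilde\mu^{(0)}=(1^{L_0},\lambda_1,\dots,\lambda_L)$, each $(\tilde\mu^{(a)},\tilde r^{(a)})$ contains $L_a$ pairs $(1,0)$, and removing them and subtracting $M_a$ from the remaining riggings gives $(\mu^{(a)},r^{(a)})$ (independent of large $M_a$). Tau functions of data $(\lambda,(\mu^{(a)},r^{(a)}))$: $\tau_d(\kappa)=\max\{\min(\kappa,\nu^{(1)})+\sum_{a=1}^{n-1}\min(\nu^{(a)},\nu^{(a+1)})-\sum_{a=1}^n\min(\nu^{(a)},\nu^{(a)})-\sum_{a=1}^n|s^{(a)}|-|\nu^{(d)}|\}$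 over independent sub-multisets of pairs $\{(\nu^{(a)}_i,s^{(a)}_i)\}\subseteq\{(\mu^{(a)}_i,r^{(a)}_i)\}$, $|\nu^{(n+1)}|=0$, $\tau_0(\kappa)=\tau_{n+1}(\kappa)-|\kappa|$, $\tau_{k,d}=\tau_d(\lambda_{[k]})$. *)

theory Defs
  imports Main "HOL-Library.Multiset"
begin

(* Elements of the crystal B_l: lists x of length n+1 (x ! (i-1) = x_i), entries summing to l.
   Rigged configurations: mu0 :: nat list (rows of mu^(0), in order 1..L) and
   cfg :: nat => (nat * int) multiset, cfg a = multiset of (row length, rigging)
   for colour a = 1..n (empty for other a). *)

type_synonym rcfg = "nat \<Rightarrow> (nat \<times> int) multiset"

definition u_elt :: "nat \<Rightarrow> nat \<Rightarrow> nat list" where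
  "u_elt n l = l # replicate n 0"

definition letter :: "nat \<Rightarrow> nat \<Rightarrow> nat list" where
  "letter n a = (replicate (n+1) 0)[a - 1 := 1]"

definition coord :: "nat \<Rightarrow> nat list \<Rightarrow> int \<Rightarrow> int" where
  "coord n x i = int (x ! nat ((i - 1) mod int (n+1)))"

definition Qf :: "nat \<Rightarrow> nat list \<Rightarrow> nat list \<Rightarrow> int \<Rightarrow> int" where
  "Qf n x y i = Min ((\<lambda>k. (\<Sum>j\<in>{1..k-1}. coord n x (i+j)) + (\<Sum>j\<in>{k+1..int n+1}. coord n y (i+j)))
                  ` {1..int n+1})"

definition combR :: "nat \<Rightarrow> nat list \<Rightarrow> nat list \<Rightarrow> nat list \<times> nat list" where
  "combR n x y =
    (map (\<lambda>i. nat (coord n y i + Qf n x y (i-1) - Qf n x y i)) [1..int n+1],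
     map (\<lambda>i. nat (coord n x i + Qf n x y i - Qf n x y (i-1))) [1..int n+1])"

(* carrier v passes through p_1 ... p_L : v_{j-1} \<otimes> p_j \<simeq> p'_j \<otimes> v_j *)
fun evol :: "nat \<Rightarrow> nat list \<Rightarrow> nat list list \<Rightarrow> nat list list" where
  "evol n v [] = []"
| "evol n v (p # ps) = (let (p', v') = combR n v p in p' # evol n v' ps)"

definition T_evol :: "nat \<Rightarrow> nat \<Rightarrow> nat list list \<Rightarrow> nat list list" where
  "T_evol n l ps = evol n (u_elt n l) ps"

definition lens_of :: "rcfg \<Rightarrow> nat \<Rightarrow> nat multiset" where
  "lens_of cfg a = image_mset fst (cfg a)"

definition Epart :: "nat \<Rightarrow> nat list \<Rightarrow> (nat \<Rightarrow> nat multiset) \<Rightarrow> nat \<Rightarrow> nat \<Rightarrow> int" where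
  "Epart n mu0 lens a j =
     (if a = 0 then int (\<Sum>x\<leftarrow>mu0. min j x)
      else if a \<le> n then int (\<Sum>x\<in>#lens a. min j x) else 0)"

definition vacn :: "nat \<Rightarrow> nat list \<Rightarrow> (nat \<Rightarrow> nat multiset) \<Rightarrow> nat \<Rightarrow> nat \<Rightarrow> int" where
  "vacn n mu0 lens a j = Epart n mu0 lens (a - 1) j - 2 * Epart n mu0 lens a j + Epart n mu0 lens (a + 1) j"

definition is_rc :: "nat \<Rightarrow> nat list \<Rightarrow> rcfg \<Rightarrow> bool" where
  "is_rc n mu0 cfg \<longleftrightarrow> (\<forall>x\<in>set mu0. 1 \<le> x) \<and> (\<forall>a. (a = 0 \<or> n < a) \<longrightarrow> cfg a = {#}) \<and>
     (\<forall>a\<in>{1..n}. \<forall>(m, r)\<in>set_mset (cfg a). 1 \<le> m \<and> 0 \<le> r \<and> r \<le> vacn n mu0 (lens_of cfg) a m)"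

(* selection of singular rows: returns the lengths l_1, l_2, ... of the chosen rows
   of colours i, i+1, ... ; v = current vacancy numbers *)
primrec select :: "(nat \<Rightarrow> nat \<Rightarrow> int) \<Rightarrow> rcfg \<Rightarrow> nat \<Rightarrow> nat \<Rightarrow> nat \<Rightarrow> nat list" where
  "select v cfg 0 i thr = []"
| "select v cfg (Suc c) i thr =
     (let S = {m. (m, v i m) \<in># cfg i \<and> thr \<le> m}
      in if S = {} then [] else Min S # select v cfg c (Suc i) (Min S))"

(* elementary step: mu0 = current mu^(0) (processed row last), mu0' = mu^(0) after removing
   the last box of the processed row. Returns (output letter, new configuration). *)
definition kkr_step :: "nat \<Rightarrow> nat list \<Rightarrow> nat list \<Rightarrow> rcfg \<Rightarrow> nat \<times> rcfg" where
  "kkr_step n mu0 mu0' cfg =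
    (let v = vacn n mu0 (lens_of cfg);
         cs = select v cfg n 1 (last mu0);
         chosen = (\<lambda>a. if 1 \<le> a \<and> a \<le> length cs then Some (cs ! (a - 1)) else None);
         lens' = (\<lambda>a. case chosen a of None \<Rightarrow> lens_of cfg a
                    | Some m \<Rightarrow> lens_of cfg a - {#m#} + (if 1 < m then {#m - 1#} else {#}));
         v' = vacn n mu0' lens';
         cfg' = (\<lambda>a. case chosen a of None \<Rightarrow> cfg a
                   | Some m \<Rightarrow> cfg a - {#(m, v a m)#} + (if 1 < m then {#(m - 1, v' a (m - 1))#} else {#}))
     in (length cs + 1, cfg'))"

fun kkr_steps :: "nat \<Rightarrow> nat list \<Rightarrow> nat \<Rightarrow> rcfg \<Rightarrow> nat list \<times> rcfg" where
  "kkr_steps n rest 0 cfg = ([], cfg)"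
| "kkr_steps n rest (Suc k) cfg =
     (let (c, cfg1) = kkr_step n (rest @ [Suc k]) (if k = 0 then rest else rest @ [k]) cfg;
          (cs, cfg2) = kkr_steps n rest k cfg1
      in (c # cs, cfg2))"

fun kkr_rev :: "nat \<Rightarrow> nat list \<Rightarrow> rcfg \<Rightarrow> nat list list" where
  "kkr_rev n [] cfg = []"
| "kkr_rev n (l # rr) cfg =
     (let (cs, cfg1) = kkr_steps n (rev rr) l cfg
      in kkr_rev n rr cfg1 @ [map (\<lambda>j. count_list cs j) [1..<n+2]])"

definition kkr :: "nat \<Rightarrow> nat list \<Rightarrow> rcfg \<Rightarrow> nat list list" where
  "kkr n mu0 cfg = kkr_rev n (rev mu0) cfg"

definition pvac :: "nat \<Rightarrow> (nat \<Rightarrow> nat) \<Rightarrow> nat list list" where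
  "pvac n M = concat (map (\<lambda>b. concat (replicate (M b) (map (letter n) [1..<b+1]))) (rev [1..<n+1]))"

definition Lsz :: "nat \<Rightarrow> (nat \<Rightarrow> nat) \<Rightarrow> nat \<Rightarrow> nat" where
  "Lsz n M a = (\<Sum>b\<in>{a+1..n}. (b - a) * M b)"

definition urc :: "nat \<Rightarrow> nat list list \<Rightarrow> rcfg \<Rightarrow> bool" where
  "urc n p rc \<longleftrightarrow> (\<forall>a. (a = 0 \<or> n < a) \<longrightarrow> rc a = {#}) \<and>
     (\<exists>B. \<forall>M. (\<forall>a\<in>{1..n}. B \<le> M a) \<longrightarrow>
        (let big = (\<lambda>a. if 1 \<le> a \<and> a \<le> n
                       then image_mset (\<lambda>(m, r). (m, r + int (M a))) (rc a) + replicate_mset (Lsz n M a) (1, 0)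
                       else {#});
             mu0 = replicate (Lsz n M 0) 1 @ map sum_list p
         in is_rc n mu0 big \<and> kkr n mu0 big = pvac n M @ p))"

definition mmin :: "nat multiset \<Rightarrow> nat multiset \<Rightarrow> int" where
  "mmin A B = int (\<Sum>x\<in>#A. \<Sum>y\<in>#B. min x y)"

definition tau_val :: "nat \<Rightarrow> nat list \<Rightarrow> rcfg \<Rightarrow> nat \<Rightarrow> int" where
  "tau_val n kappa nu d =
     mmin (mset kappa) (lens_of nu 1)
     + (\<Sum>a\<in>{1..<n}. mmin (lens_of nu a) (lens_of nu (a+1)))
     - (\<Sum>a\<in>{1..n}. mmin (lens_of nu a) (lens_of nu a))
     - (\<Sum>a\<in>{1..n}. \<Sum>x\<in>#nu a. snd x)
     - (if 1 \<le> d \<and> d \<le> n then int (\<Sum>x\<in>#nu d. fst x) else 0)"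

definition tau_pos :: "nat \<Rightarrow> rcfg \<Rightarrow> nat list \<Rightarrow> nat \<Rightarrow> int" where
  "tau_pos n rc kappa d =
     Max {tau_val n kappa nu d | nu. (\<forall>a\<in>{1..n}. nu a \<subseteq># rc a) \<and> (\<forall>a. a \<notin> {1..n} \<longrightarrow> nu a = {#})}"

definition tau :: "nat \<Rightarrow> rcfg \<Rightarrow> nat list \<Rightarrow> nat \<Rightarrow> int" where
  "tau n rc kappa d = (if d = 0 then tau_pos n rc kappa (n+1) - int (sum_list kappa) else tau_pos n rc kappa d)"

definition tauk :: "nat \<Rightarrow> nat list \<Rightarrow> rcfg \<Rightarrow> nat \<Rightarrow> nat \<Rightarrow> int" where
  "tauk n lam rc k d = tau n rc (take k lam) d"

definition modify_rc :: "nat list \<Rightarrow> rcfg \<Rightarrow> rcfg" where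
  "modify_rc ls rc = rc(1 := image_mset (\<lambda>(m, r). (m, r + int (\<Sum>l\<leftarrow>ls. min l m))) (rc 1))"

end

theory Submission
  imports Defs
begin

text \<open>
  Let \<open>x a i\<close> be the number of chosen rows of colour \<open>a\<close> of length at least \<open>i\<close>, with colour 0
  given by \<open>\<kappa>\<close> and \<open>x (n + 1) i = 0\<close>. Twice the quantity maximised in \<open>\<tau>\<^sub>d(\<kappa>)\<close> is, up to terms
  depending only on \<open>\<kappa>\<close> and \<open>d\<close>, minus the sum of all \<open>(x a i - x (a + 1) i + [a \<ge> d])\<^sup>2\<close> and of
  twice the riggings. So \<open>\<tau>\<^sub>d\<close> is the value of a planar minimum cost flow problem with stream
  function \<open>x\<close>. Exchanging parts of two optimal stream functions yields, for \<open>a > b\<close> and arbitrary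
  riggings, the ultradiscrete Hirota equation
  \<open>\<tau>\<^sub>c(\<kappa>,b) + \<tau>\<^sub>c\<^sub>+\<^sub>1(\<kappa>,a) = max (\<tau>\<^sub>c(\<kappa>) + \<tau>\<^sub>c\<^sub>+\<^sub>1(\<kappa>,a,b) - b) (\<tau>\<^sub>c\<^sub>+\<^sub>1(\<kappa>,b) + \<tau>\<^sub>c(\<kappa>,a))\<close>,
  and this is the combinatorial R written in terms of \<open>\<tau>\<close>. Putting a row \<open>l\<close> in front of \<open>\<lambda>\<close> and
  adding \<open>min l\<close> of the row length to the riggings of colour 1 leaves \<open>\<tau>\<close> unchanged. Moving that
  row to the far right by combinatorial Rs is the time evolution \<open>T\<^sub>l\<close>.

  It remains to express a KKR image by tau functions. Removing a box from the processed row changes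
  all \<open>\<tau>\<^sub>1(\<kappa>), \<dots>, \<tau>\<^sub>n\<^sub>+\<^sub>1(\<kappa>)\<close> by the same amount, if \<open>\<kappa>\<close> is contained in the other rows, while for
  \<open>\<kappa>\<close> equal to all rows the maximum is attained at the full configuration. Hence
  \<open>\<tau>\<^sub>d(\<lambda>\<^sub>[\<^sub>k\<^sub>]) - \<tau>\<^sub>n\<^sub>+\<^sub>1(\<lambda>\<^sub>[\<^sub>k\<^sub>])\<close> is minus the number of letters above \<open>d\<close> in the first \<open>k\<close> factors.
\<close>

section \<open>Column lengths and the quadratic form\<close>

text \<open>The raised riggings of colour 1 are not known in advance to belong to any path, so the
  Hirota equation must hold for arbitrary riggings and is derived from the maximisation alone. For
  the KKR side the decisive device is the passage to complements: the rigging of a row is traded for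
  its corigging, so singular rows become free of cost, and the selection rule says exactly that
  certain shorter competitors cost at least one. The Hirota equation compares three ways of pairing
  the same boundary data. Two of the inequalities come from truncating the difference of two stream
  functions pointwise. The third has boundary values of equal sign that must be separated from each
  other; no truncation does that, and planarity enters here. The vacuum part is removed by summation
  by parts: \<open>L_a\<close> has second difference \<open>M_a\<close>, so raising the riggings by
  \<open>M_a\<close> cancels against the unit rows. What remains is \<open>- L_d\<close>, which
  accounts for the letters of the vacuum path.\<close>

definition col :: "nat multiset \<Rightarrow> nat \<Rightarrow> int" where
  "col A i = int (size (filter_mset (\<lambda>x. i \<le> x) A))"

lemma col_empty [simp]: "col {#} i = 0"
  by (simp add: col_def)

lemma col_add_mset [simp]: "col (add_mset x A) i = col A i + (if i \<le> x then 1 else 0)"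
  by (simp add: col_def)

lemma col_union [simp]: "col (A + B) i = col A i + col B i"
  by (simp add: col_def)

lemma col_diff: "B \<subseteq># A \<Longrightarrow> col (A - B) i = col A i - col B i"
  by (metis add_diff_cancel_right' col_union subset_mset.diff_add)

lemma col_nonneg [simp]: "0 \<le> col A i"
  by (simp add: col_def)

lemma col_antimono: "i \<le> j \<Longrightarrow> col A j \<le> col A i"
  by (induction A) auto

lemma col_eq_0: "\<forall>x\<in>#A. x < i \<Longrightarrow> col A i = 0"
  by (induction A) auto

lemma col_pos: "0 < col A i \<longleftrightarrow> (\<exists>x\<in>#A. i \<le> x)"
  by (induction A) (auto simp: add_nonneg_pos add_pos_nonneg intro: add_nonneg_pos)

lemma sum_iverson:
  fixes H x :: nat
  shows "(\<Sum>i=1..H. if i \<le> x then f i else 0) = (\<Sum>i=1..min H x. (f i :: int))"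
proof -
  have "{1..min H x} = {i\<in>{1..H}. i \<le> x}" by auto
  then show ?thesis
    using sum.inter_filter[of "{1..H}" f "\<lambda>i. i \<le> x"] by simp
qed

lemma sum_col_min: "(\<Sum>i=1..k. col A i) = int (\<Sum>x\<in>#A. min k x)"
proof (induction A)
  case empty
  then show ?case by simp
next
  case (add x A)
  have "(\<Sum>i=1..k. if i \<le> x then 1 else 0::int) = int (min k x)"
    by (subst sum_iverson) simp
  with add show ?case by (simp add: sum.distrib)
qed

lemma sum_col: 
  assumes "\<forall>x\<in>#A. x \<le> H"
  shows "(\<Sum>i=1..H. col A i) = int (\<Sum>x\<in>#A. x)"
proof -
  have "(\<Sum>x\<in>#A. min H x) = (\<Sum>x\<in>#A. x)"
    using assms by (intro arg_cong[where f = sum_mset] image_mset_cong) simp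
  then show ?thesis by (simp only: sum_col_min)
qed

lemma mmin_empty [simp]: "mmin A {#} = 0" "mmin {#} A = 0"
  by (simp_all add: mmin_def)

lemma mmin_add_left: "mmin (add_mset x A) B = mmin A B + (\<Sum>i=1..x. col B i)"
  by (simp only: mmin_def sum_col_min) simp

lemma mmin_commute: "mmin A B = mmin B A"
  unfolding mmin_def by (subst sum_mset.swap) (simp add: min.commute)

text \<open>The minimum of x and y counts the levels below both, so the double sum factors level by
  level; it suffices that one of the two multisets stays below \<open>H\<close>.\<close>

lemma mmin_col_left:
  assumes "\<forall>x\<in>#A. x \<le> H"
  shows "mmin A B = (\<Sum>i=1..H. col A i * col B i)"
  using assms
proof (induction A)
  case empty
  then show ?case by simp
next
  case (add x A)
  have "(\<Sum>i=1..x. col B i) = (\<Sum>i=1..H. if i \<le> x then col B i else 0)"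
    using add.prems by (subst sum_iverson) (simp add: min_absorb2)
  also have "\<dots> = (\<Sum>i=1..H. (if i \<le> x then 1 else 0) * col B i)"
    by (intro sum.cong) auto
  finally show ?case
    using add by (simp add: mmin_add_left distrib_right sum.distrib)
qed

lemma mmin_col_right:
  assumes "\<forall>x\<in>#B. x \<le> H"
  shows "mmin A B = (\<Sum>i=1..H. col A i * col B i)"
  using mmin_col_left[OF assms, of A] by (simp add: mmin_commute mult.commute)

section \<open>Sub-configurations as arrays of column lengths\<close>

definition subconf :: "nat \<Rightarrow> rcfg \<Rightarrow> rcfg \<Rightarrow> bool" where
  "subconf n nu rc \<longleftrightarrow> (\<forall>a\<in>{1..n}. nu a \<subseteq># rc a) \<and> (\<forall>a. a \<notin> {1..n} \<longrightarrow> nu a = {#})"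

text \<open>Colour 0 is a free function so that it can be lowered at a single level, as in
  \<open>z1\<close> below.\<close>

definition arr :: "nat \<Rightarrow> (nat \<Rightarrow> int) \<Rightarrow> rcfg \<Rightarrow> nat \<Rightarrow> nat \<Rightarrow> int" where
  "arr n z nu a i = (if a = 0 then z i else if a \<le> n then col (lens_of nu a) i else 0)"

abbreviation parr :: "nat \<Rightarrow> nat list \<Rightarrow> rcfg \<Rightarrow> nat \<Rightarrow> nat \<Rightarrow> int" where
  "parr n k \<equiv> arr n (col (mset k))"

text \<open>The contribution of one level. The sign \<open>s\<close> is -1 for a sub-configuration
  and 1 for its complement, since negating \<open>v\<close> keeps the quadratic part and flips the
  linear one; \<open>s = 0\<close> gives the bare quadratic form.\<close>

definition obj1 :: "nat \<Rightarrow> int \<Rightarrow> nat \<Rightarrow> (nat \<Rightarrow> int) \<Rightarrow> int" where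
  "obj1 n s d v = (\<Sum>a=1..n. v (a - 1) * v a - v a * v a + (if a = d then s * v a else 0))"

definition Obj :: "nat \<Rightarrow> nat \<Rightarrow> int \<Rightarrow> nat \<Rightarrow> (nat \<Rightarrow> nat \<Rightarrow> int) \<Rightarrow> int" where
  "Obj n H s d y = (\<Sum>i=1..H. obj1 n s d (\<lambda>a. y a i))"

definition cost :: "nat \<Rightarrow> (nat \<Rightarrow> nat \<times> int \<Rightarrow> int) \<Rightarrow> rcfg \<Rightarrow> int" where
  "cost n c nu = (\<Sum>a=1..n. \<Sum>x\<in>#nu a. c a x)"

definition rows_le :: "nat \<Rightarrow> nat \<Rightarrow> rcfg \<Rightarrow> bool" where
  "rows_le n H rc \<longleftrightarrow> (\<forall>a\<in>{1..n}. \<forall>x\<in>#rc a. fst x \<le> H)"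

lemma rows_le_subconf: "subconf n nu rc \<Longrightarrow> rows_le n H rc \<Longrightarrow> rows_le n H nu"
  unfolding subconf_def rows_le_def by (meson mset_subset_eqD)

lemma rows_le_lens: "rows_le n H rc \<Longrightarrow> a \<in> {1..n} \<Longrightarrow> \<forall>x\<in>#lens_of rc a. x \<le> H"
  unfolding rows_le_def lens_of_def by auto

text \<open>Polarisation. Summation by parts moves the cross terms onto \<open>w\<close>, where they
  meet the second difference of \<open>v\<close> in the colour direction, the summand of a vacancy
  number. The term \<open>w 0 * v 1\<close> is left over at the boundary.\<close>

lemma obj1_add:
  assumes "1 \<le> n" and "v (n + 1) = 0"
  shows "obj1 n s d (\<lambda>a. v a + w a) = obj1 n s d v + obj1 n s d w
    + (\<Sum>a=1..n. w a * (v (a - 1) + v (a + 1) - 2 * v a)) + w 0 * v 1"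
proof -
  have shift: "(\<Sum>a=1..m. w (a - 1) * v a) = (\<Sum>a=1..m. w a * v (a + 1)) + w 0 * v 1 - w m * v (m + 1)" for m
    by (induction m) auto
  have "obj1 n s d (\<lambda>a. v a + w a) = obj1 n s d v + obj1 n s d w + (\<Sum>a=1..n. w (a - 1) * v a)
    + (\<Sum>a=1..n. w a * (v (a - 1) - 2 * v a))"
    unfolding obj1_def sum.distrib[symmetric] by (intro sum.cong) (auto simp: algebra_simps)
  also have "(\<Sum>a=1..n. w (a - 1) * v a) = (\<Sum>a=1..n. w a * v (a + 1)) + w 0 * v 1"
    by (subst shift) (simp add: assms(2)[simplified])
  finally have "obj1 n s d (\<lambda>a. v a + w a) = obj1 n s d v + obj1 n s d w + w 0 * v 1
    + ((\<Sum>a=1..n. w a * v (a + 1)) + (\<Sum>a=1..n. w a * (v (a - 1) - 2 * v a)))"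
    by simp
  also have "(\<Sum>a=1..n. w a * v (a + 1)) + (\<Sum>a=1..n. w a * (v (a - 1) - 2 * v a))
    = (\<Sum>a=1..n. w a * (v (a - 1) + v (a + 1) - 2 * v a))"
    unfolding sum.distrib[symmetric] by (intro sum.cong) (auto simp: algebra_simps)
  finally show ?thesis by simp
qed

lemma Obj_add:
  assumes "1 \<le> n" and "\<And>i. v (n + 1) i = 0"
  shows "Obj n H s d (\<lambda>a i. v a i + w a i) = Obj n H s d v + Obj n H s d w
    + (\<Sum>a=1..n. \<Sum>i=1..H. w a i * (v (a - 1) i + v (a + 1) i - 2 * v a i)) + (\<Sum>i=1..H. w 0 i * v 1 i)"
proof -
  have "obj1 n s d (\<lambda>a. v a i + w a i) = obj1 n s d (\<lambda>a. v a i) + obj1 n s d (\<lambda>a. w a i)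
    + (\<Sum>a=1..n. w a i * (v (a - 1) i + v (a + 1) i - 2 * v a i)) + w 0 i * v 1 i" for i
    using obj1_add[of n "\<lambda>a. v a i" s d "\<lambda>a. w a i"] assms by simp
  then show ?thesis
    unfolding Obj_def
    by (simp only: sum.distrib sum.swap[of _ "{1..H}" "{1..n}"])
qed

lemma Obj_cong:
  assumes "\<And>a i. a \<le> n \<Longrightarrow> i \<in> {1..H} \<Longrightarrow> v a i = w a i"
  shows "Obj n H s d v = Obj n H s d w"
  unfolding Obj_def obj1_def using assms by (intro sum.cong) auto

text \<open>\<open>kappa\<close> may have rows longer than \<open>H\<close>: colour 0 enters only
  multiplied by the columns of colour 1, which vanish above \<open>H\<close>.\<close>

lemma tau_val_Obj:
  assumes n: "1 \<le> n" and H: "rows_le n H nu"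
  shows "tau_val n kappa nu d = Obj n H (-1) d (parr n kappa nu) - cost n (\<lambda>_. snd) nu"
proof -
  define x where "x = parr n kappa nu"
  have x: "x a i = col (lens_of nu a) i" if "a \<in> {1..n}" for a i
    using that by (auto simp: x_def arr_def)
  have x0: "x 0 i = col (mset kappa) i" for i by (simp add: x_def arr_def)
  note le = rows_le_lens[OF H]
  have "Obj n H (-1) d x = (\<Sum>a=1..n. \<Sum>i=1..H. x (a - 1) i * x a i)
      - (\<Sum>a=1..n. \<Sum>i=1..H. x a i * x a i) - (\<Sum>a=1..n. \<Sum>i=1..H. if a = d then x a i else 0)"
    unfolding Obj_def obj1_def
    by (subst sum.swap, subst sum_subtractf[symmetric], subst sum_subtractf[symmetric],
        rule sum.cong, simp, subst sum_subtractf[symmetric], subst sum_subtractf[symmetric],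
        rule sum.cong, auto)
  moreover have "(\<Sum>a=1..n. \<Sum>i=1..H. x (a - 1) i * x a i) =
      mmin (mset kappa) (lens_of nu 1) + (\<Sum>a\<in>{1..<n}. mmin (lens_of nu a) (lens_of nu (a+1)))"
  proof -
    have "(\<Sum>a=1..n. \<Sum>i=1..H. x (a - 1) i * x a i) =
       (\<Sum>i=1..H. x 0 i * x 1 i) + (\<Sum>a=2..n. \<Sum>i=1..H. x (a - 1) i * x a i)"
      using n by (subst sum.atLeast_Suc_atMost) (auto simp: numeral_2_eq_2)
    also have "(\<Sum>a=2..n. \<Sum>i=1..H. x (a - 1) i * x a i) = (\<Sum>a\<in>{1..<n}. \<Sum>i=1..H. x a i * x (a + 1) i)"
      by (rule sum.reindex_bij_witness[of _ "\<lambda>a. a + 1" "\<lambda>a. a - 1"]) auto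
    also have "(\<Sum>a\<in>{1..<n}. \<Sum>i=1..H. x a i * x (a + 1) i) = (\<Sum>a\<in>{1..<n}. mmin (lens_of nu a) (lens_of nu (a+1)))"
    proof (rule sum.cong)
      fix a assume "a \<in> {1..<n}"
      then have "a \<in> {1..n}" "a + 1 \<in> {1..n}" by auto
      then show "(\<Sum>i=1..H. x a i * x (a + 1) i) = mmin (lens_of nu a) (lens_of nu (a+1))"
        by (simp only: x mmin_col_left[OF le])
    qed simp
    also have "(\<Sum>i=1..H. x 0 i * x 1 i) = mmin (mset kappa) (lens_of nu 1)"
      using le[of 1] n by (simp add: x x0 mmin_col_right[where H = H])
    finally show ?thesis .
  qed
  moreover have "(\<Sum>a=1..n. \<Sum>i=1..H. x a i * x a i) = (\<Sum>a\<in>{1..n}. mmin (lens_of nu a) (lens_of nu a))"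
    by (rule sum.cong) (use le in \<open>auto simp: x mmin_col_left[where H = H]\<close>)
  moreover have "(\<Sum>a=1..n. \<Sum>i=1..H. if a = d then x a i else 0) =
      (if 1 \<le> d \<and> d \<le> n then int (\<Sum>x\<in>#nu d. fst x) else 0)"
  proof -
    have "(\<Sum>a=1..n. \<Sum>i=1..H. if a = d then x a i else 0) = (\<Sum>a=1..n. if a = d then \<Sum>i=1..H. x a i else 0)"
      by (rule sum.cong) auto
    also have "\<dots> = (if 1 \<le> d \<and> d \<le> n then \<Sum>i=1..H. x d i else 0)"
      by auto
    also have "\<dots> = (if 1 \<le> d \<and> d \<le> n then int (\<Sum>x\<in>#nu d. fst x) else 0)"
      using le[of d] sum_col[of "lens_of nu d" H] by (auto simp: x lens_of_def simp flip: sum_mset.distrib)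
    finally show ?thesis .
  qed
  ultimately show ?thesis
    unfolding tau_val_def cost_def x_def[symmetric] by simp
qed

lemma finite_subconf: "finite {nu. subconf n nu rc}"
proof -
  have fin: "finite {A. A \<subseteq># (M :: (nat \<times> int) multiset)}" for M
  proof (induction M)
    case empty
    then show ?case by simp
  next
    case (add x M)
    have "{A. A \<subseteq># add_mset x M} \<subseteq> {A. A \<subseteq># M} \<union> add_mset x ` {A. A \<subseteq># M}"
    proof safe
      fix A assume A: "A \<subseteq># add_mset x M" "A \<notin> add_mset x ` {A. A \<subseteq># M}"
      have "x \<notin># A"
        using A by (metis image_eqI insert_DiffM mem_Collect_eq mset_subset_eq_add_mset_cancel)
      then show "A \<subseteq># M"
        using A(1) by (simp add: subset_mset.le_iff_sup insert_subset_eq_iff subseteq_mset_def)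
    qed
    then show ?case
      using add.IH finite_subset by blast
  qed
  let ?S = "(\<Union>a\<in>{1..n}. {A. A \<subseteq># rc a})"
  have "{nu. subconf n nu rc} \<subseteq> {f. \<forall>a. (a \<in> {1..n} \<longrightarrow> f a \<in> ?S) \<and> (a \<notin> {1..n} \<longrightarrow> f a = {#})}"
    by (fastforce simp: subconf_def)
  moreover have "finite \<dots>"
    using fin by (intro finite_set_of_finite_funs) auto
  ultimately show ?thesis by (rule finite_subset)
qed

lemma sum_col_weight:
  assumes "\<forall>x\<in>#R. fst x \<le> H"
  shows "(\<Sum>x\<in>#R. \<Sum>i=1..fst x. g i) = (\<Sum>i=1..H. col (image_mset fst R) i * (g i :: int))"
  using assms
proof (induction R)
  case empty
  then show ?case by simp
next
  case (add x R)
  have "(\<Sum>i=1..fst x. g i) = (\<Sum>i=1..H. if i \<le> fst x then g i else 0)"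
    using add.prems by (subst sum_iverson) (simp add: min_absorb2)
  also have "\<dots> = (\<Sum>i=1..H. (if i \<le> fst x then 1 else 0) * g i)"
    by (intro sum.cong) auto
  finally show ?case
    using add by (simp add: distrib_right sum.distrib)
qed

lemma sum_indicator:
  fixes f :: "nat \<Rightarrow> int"
  shows "(\<Sum>i=1..H. (if i = k then 1 else 0) * f i) = (if 1 \<le> k \<and> k \<le> H then f k else 0)"
proof -
  have "(\<Sum>i=1..H. (if i = k then 1 else 0) * f i) = (\<Sum>i=1..H. if i = k then f i else 0)"
    by (intro sum.cong) auto
  then show ?thesis by simp
qed

lemma Obj_change_colour:
  assumes n: "1 \<le> n" and v: "\<And>i. v (n + 1) i = 0" and b: "b \<in> {1..n}"
  shows "Obj n H s d (\<lambda>a i. v a i + (if a = b then \<delta> i else 0)) = Obj n H s d v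
    + (\<Sum>i=1..H. \<delta> i * (v (b - 1) i + v (b + 1) i - 2 * v b i + (if b = d then s else 0)) - \<delta> i * \<delta> i)"
proof -
  let ?w = "\<lambda>a i. if a = b then \<delta> i else 0"
  have 1: "Obj n H s d ?w = (\<Sum>i=1..H. \<delta> i * (if b = d then s else 0) - \<delta> i * \<delta> i)"
  proof -
    have "obj1 n s d (\<lambda>a. ?w a i) = \<delta> i * (if b = d then s else 0) - \<delta> i * \<delta> i" for i
    proof -
      have "obj1 n s d (\<lambda>a. ?w a i) = (\<Sum>a=1..n. if a = b then \<delta> i * (if b = d then s else 0) - \<delta> i * \<delta> i else 0)"
        unfolding obj1_def using b by (intro sum.cong) auto
      then show ?thesis using b by simp
    qed
    then show ?thesis by (simp add: Obj_def)
  qed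
  have 2: "(\<Sum>a=1..n. \<Sum>i=1..H. ?w a i * (v (a - 1) i + v (a + 1) i - 2 * v a i)) =
      (\<Sum>i=1..H. \<delta> i * (v (b - 1) i + v (b + 1) i - 2 * v b i))"
  proof -
    have "(\<Sum>a=1..n. \<Sum>i=1..H. ?w a i * (v (a - 1) i + v (a + 1) i - 2 * v a i)) =
      (\<Sum>a=1..n. if a = b then \<Sum>i=1..H. \<delta> i * (v (b - 1) i + v (b + 1) i - 2 * v b i) else 0)"
      by (intro sum.cong) auto
    then show ?thesis using b by simp
  qed
  have 3: "(\<Sum>i=1..H. ?w 0 i * v 1 i) = 0"
    using b by simp
  show ?thesis
    unfolding Obj_add[where v = v and w = ?w, OF n v] 1 2 3
    by (simp add: sum.distrib sum_subtractf distrib_left)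
qed

section \<open>Removing a box\<close>

lemma lens_of_subset: "nu a \<subseteq># rc a \<Longrightarrow> lens_of nu a \<subseteq># lens_of rc a"
  unfolding lens_of_def by (rule image_mset_subseteq_mono)

lemma sum_lens_swap:
  assumes "x \<in># A"
  shows "(\<Sum>z\<in>#A - {#x#} + {#y#}. c z) = (\<Sum>z\<in>#A. (c z :: int)) - c x + c y"
proof -
  obtain B where "A = add_mset x B" using assms by (meson multi_member_split)
  then show ?thesis by simp
qed

lemma cost_upd:
  assumes "b \<in> {1..n}"
  shows "cost n c (nu(b := R)) = cost n c nu - (\<Sum>x\<in>#nu b. c b x) + (\<Sum>x\<in>#R. c b x)"
proof -
  have "cost n c (nu(b := R)) = (\<Sum>a=1..n. (\<Sum>x\<in>#nu a. c a x) +
      (if a = b then (\<Sum>x\<in>#R. c b x) - (\<Sum>x\<in>#nu b. c b x) else 0))"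
    unfolding cost_def by (intro sum.cong) auto
  then show ?thesis
    using assms by (simp add: cost_def sum.distrib)
qed

lemma arr_antimono:
  assumes "\<And>i i'. i \<le> i' \<Longrightarrow> z i' \<le> z i" and "i \<le> i'"
  shows "arr n z nu a i' \<le> arr n z nu a i"
  using assms by (auto simp: arr_def intro: col_antimono)

lemma arr_nonneg:
  assumes "\<And>i. 0 \<le> z i"
  shows "0 \<le> arr n z nu a i"
  using assms by (auto simp: arr_def)

text \<open>
  Sub-configurations are replaced by their complements, so \<open>c\<close> stands for the corigging, \<open>z\<close> for the
  columns of the complement of \<open>\<kappa>\<close>, and \<open>al a\<close> is the singular row of colour \<open>a\<close> that becomes \<open>nw a\<close>.
  Both configurations are compared with \<open>P U\<close>: for \<open>a \<notin> U\<close> the row \<open>al a\<close> is used, and for \<open>a \<in> U\<close>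
  it is not used and the entry at length \<open>m a\<close> is raised by one, which is how the absence of
  \<open>nw a\<close> looks after the shift by \<open>e\<close>.
\<close>

locale kkr_move =
  fixes n H j d :: nat and m :: "nat \<Rightarrow> nat" and cfg cfg1 :: rcfg
    and c c1 :: "nat \<Rightarrow> nat \<times> int \<Rightarrow> int" and al nw :: "nat \<Rightarrow> nat \<times> int"
    and z :: "nat \<Rightarrow> int"
  assumes n: "1 \<le> n" and j: "1 \<le> j" "j \<le> n + 1"
    and m0: "1 \<le> m 0" and m0_le: "m 0 \<le> H"
    and m_mono: "\<And>a. 1 \<le> a \<Longrightarrow> a < j \<Longrightarrow> m (a - 1) \<le> m a"
    and al: "\<And>a. 1 \<le> a \<Longrightarrow> a < j \<Longrightarrow> al a \<in># cfg a"
            "\<And>a. 1 \<le> a \<Longrightarrow> a < j \<Longrightarrow> fst (al a) = m a"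
            "\<And>a. 1 \<le> a \<Longrightarrow> a < j \<Longrightarrow> c a (al a) = 0"
    and c_nonneg: "\<And>a x. 1 \<le> a \<Longrightarrow> a < j \<Longrightarrow> x \<in># cfg a \<Longrightarrow> 0 \<le> c a x"
    and c_pos: "\<And>a x. 1 \<le> a \<Longrightarrow> a < j \<Longrightarrow> x \<in># cfg a \<Longrightarrow> m (a - 1) \<le> fst x \<Longrightarrow> fst x < m a \<Longrightarrow> 1 \<le> c a x"
    and rows: "rows_le n H cfg"
    and cfg1: "cfg1 = (\<lambda>a. if 1 \<le> a \<and> a < j
      then cfg a - {#al a#} + (if 1 < m a then {#nw a#} else {#}) else cfg a)"
    and nw: "\<And>a. fst (nw a) = m a - 1" "\<And>a. 1 \<le> a \<Longrightarrow> a < j \<Longrightarrow> 1 < m a \<Longrightarrow> c1 a (nw a) = 0"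
    and c1: "\<And>a x. 1 \<le> a \<Longrightarrow> a \<le> n \<Longrightarrow> c1 a x = c a x + (\<Sum>i=1..fst x.
      2 * (if a < j \<and> i = m a then 1 else 0) - (if a - 1 < j \<and> i = m (a - 1) then 1 else 0)
      - (if a + 1 < j \<and> i = m (a + 1) then 1 else 0))"
    and z_nonneg: "\<And>i. 0 \<le> z i" and z_antimono: "\<And>i i'. i \<le> i' \<Longrightarrow> z i' \<le> z i"
    and z_strict: "\<And>i. m 0 < i \<Longrightarrow> z i < z (m 0)"
begin

definition e :: "nat \<Rightarrow> nat \<Rightarrow> int" where
  "e a i = (if a < j \<and> i = m a then 1 else 0)"

definition z1 :: "nat \<Rightarrow> int" where
  "z1 i = z i - e 0 i"

definition W :: "rcfg \<Rightarrow> int" where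
  "W nu = Obj n H 1 d (arr n z nu) - cost n c nu"

definition W1 :: "rcfg \<Rightarrow> int" where
  "W1 nu = Obj n H 1 d (arr n z1 nu) - cost n c1 nu"

text \<open>The difference of the two maxima. The first term is the boundary term of
  \<open>Obj_add\<close>, the second the part of \<open>Obj_e\<close> that depends on
  \<open>d\<close>; the latter will match the box that colour \<open>d\<close> loses.\<close>

definition gain :: int where
  "gain = (if 1 < j then z1 (m 1) else 0) + (if 1 \<le> d \<and> d < j then 1 else 0)"

text \<open>For a chosen colour, the amount by which \<open>c1\<close> falls below \<open>c\<close>
  at length \<open>m a - 1\<close>: among the chosen rows of colours \<open>a - 1\<close>,
  \<open>a\<close>, \<open>a + 1\<close> only the first can be shorter than
  \<open>m a\<close>.\<close>

definition eps :: "nat \<Rightarrow> int" where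
  "eps a = (if m (a - 1) < m a then 1 else 0)"

definition bump :: "nat set \<Rightarrow> nat \<Rightarrow> nat \<Rightarrow> int" where
  "bump U a i = (if a \<in> U \<and> i = m a then 1 else 0)"

text \<open>The value after the step, pulled back to \<open>cfg\<close> (see
  \<open>P_shorten\<close>). The \<open>eps\<close> terms of \<open>Obj_e\<close> are cancelled by
  those of \<open>shorten_cost\<close> except for the colours in \<open>U\<close>.\<close>

definition P :: "nat set \<Rightarrow> rcfg \<Rightarrow> int" where
  "P U nu = Obj n H 1 d (\<lambda>a i. arr n z nu a i + bump U a i) - cost n c nu + (\<Sum>a\<in>U. eps a)"

definition good :: "nat set \<Rightarrow> rcfg \<Rightarrow> bool" where
  "good U nu \<longleftrightarrow> U \<subseteq> {1..<j} \<and> subconf n nu cfg \<and> (\<forall>a\<in>{1..<j} - U. al a \<in># nu a)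
     \<and> (\<forall>a\<in>U. nu a \<subseteq># cfg a - {#al a#})"

definition shorten :: "nat set \<Rightarrow> rcfg \<Rightarrow> rcfg" where
  "shorten U nu = (\<lambda>a. if a \<in> {1..<j} - U then nu a - {#al a#} + (if 1 < m a then {#nw a#} else {#}) else nu a)"

lemma m_ge1: "a < j \<Longrightarrow> 1 \<le> m a"
proof (induction a)
  case 0
  show ?case by (rule m0)
next
  case (Suc a)
  then show ?case using m_mono[of "Suc a"] by simp
qed

lemma m_le: "a < j \<Longrightarrow> m a \<le> H"
proof (cases "a = 0")
  case True
  then show ?thesis using m0_le by simp
next
  case False
  assume "a < j"
  with False have "al a \<in># cfg a" "fst (al a) = m a" "a \<in> {1..n}" using al[of a] j by auto
  then show ?thesis using rows unfolding rows_le_def by (metis)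
qed

lemma in_range: "a \<in> {1..<j} \<Longrightarrow> a \<in> {1..n}"
  using j by auto

lemma arr_top [simp]: "arr n x nu (n + 1) i = 0" "arr n x nu (Suc n) i = 0"
  by (simp_all add: arr_def)

lemma e_top [simp]: "e (n + 1) i = 0" "e (Suc n) i = 0"
  using j by (simp_all add: e_def)

lemma sum_if_subset:
  assumes "U \<subseteq> {1..<j}"
  shows "(\<Sum>a=1..n. if a \<in> U then f a else 0) = (\<Sum>a\<in>U. f a :: int)"
proof -
  have "{a\<in>{1..n}. a \<in> U} = U" using assms in_range by auto
  then show ?thesis
    using sum.inter_filter[of "{1..n}" f "\<lambda>a. a \<in> U"] by (simp only: finite_atLeastAtMost)
qed

lemma sum_at_m:
  assumes "a < j"
  shows "(\<Sum>i=1..H. (if i = m a then 1 else 0) * f i) = (f (m a) :: int)"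
  by (subst sum_indicator) (use m_ge1[OF assms] m_le[OF assms] in simp)

lemma Obj_bump:
  assumes U: "U \<subseteq> {..<j}"
  shows "Obj n H 1 d (bump U) =
    (\<Sum>a\<in>U - {0}. (if a - 1 \<in> U \<and> m (a - 1) = m a then 1 else 0) - 1 + (if a = d then 1 else 0))"
proof -
  let ?t = "\<lambda>a. (if a - 1 \<in> U \<and> m (a - 1) = m a then 1 else 0) - 1 + (if a = d then 1 else 0 :: int)"
  have "Obj n H 1 d (bump U) = (\<Sum>a=1..n. \<Sum>i=1..H. bump U (a - 1) i * bump U a i
      - bump U a i * bump U a i + (if a = d then bump U a i else 0))"
    unfolding Obj_def obj1_def by (subst sum.swap) (intro sum.cong refl, simp)
  also have "\<dots> = (\<Sum>a=1..n. if a \<in> U - {0} then ?t a else 0)"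
  proof (intro sum.cong refl)
    fix a assume "a \<in> {1..n}"
    then have "a \<noteq> 0" by simp
    show "(\<Sum>i=1..H. bump U (a - 1) i * bump U a i
      - bump U a i * bump U a i + (if a = d then bump U a i else 0)) = (if a \<in> U - {0} then ?t a else 0)"
    proof (cases "a \<in> U")
      case True
      then have "a < j" using U by auto
      have "bump U (a - 1) i * bump U a i - bump U a i * bump U a i + (if a = d then bump U a i else 0)
        = (if i = m a then 1 else 0) * ?t a" for i
        using True by (cases "i = m a") (auto simp: bump_def eq_commute[of "m a"])
      then show ?thesis using True \<open>a \<noteq> 0\<close> by (simp only: sum_at_m[OF \<open>a < j\<close>]) simp
    next
      case False
      then have "bump U a i = 0" for i by (simp add: bump_def)
      then show ?thesis using False by (cases "a = d") simp_all
    qed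
  qed
  also have "\<dots> = (\<Sum>a\<in>U - {0}. ?t a)" by (rule sum_if_subset) (use U in auto)
  finally show ?thesis .
qed

lemma Obj_e: "Obj n H 1 d e = (if 1 \<le> d \<and> d < j then 1 else 0) - (\<Sum>a\<in>{1..<j}. eps a)"
proof -
  have "e = bump {..<j}" by (auto simp: e_def bump_def fun_eq_iff)
  moreover have "{..<j} - {0} = {1..<j}" by auto
  ultimately have "Obj n H 1 d e = (\<Sum>a\<in>{1..<j}. (if a - 1 \<in> {..<j} \<and> m (a - 1) = m a then 1 else 0) - 1 + (if a = d then 1 else 0))"
    using Obj_bump[of "{..<j}"] by (simp only: order_refl)
  also have "\<dots> = (\<Sum>a\<in>{1..<j}. (if a = d then 1 else 0) - eps a)"
  proof (intro sum.cong refl)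
    fix a assume "a \<in> {1..<j}"
    then show "(if a - 1 \<in> {..<j} \<and> m (a - 1) = m a then 1 else 0) - 1 + (if a = d then 1 else 0) = (if a = d then 1 else 0) - eps a"
      using m_mono[of a] by (auto simp: eps_def)
  qed
  finally show ?thesis by (simp add: sum_subtractf)
qed

lemma shorten_arr:
  assumes good: "good U nu" and i: "i \<in> {1..H}"
  shows "arr n z nu a i + bump U a i = e a i + arr n z1 (shorten U nu) a i"
proof -
  consider "a = 0" | "a \<in> {1..<j}" "a \<in> U" | "a \<in> {1..<j}" "a \<notin> U" | "j \<le> a" by fastforce
  then show ?thesis
  proof cases
    case 1
    then show ?thesis using good by (auto simp: arr_def bump_def z1_def good_def)
  next
    case 2
    then show ?thesis using in_range[of a] by (auto simp: arr_def bump_def e_def shorten_def lens_of_def)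
  next
    case 3
    then obtain R where R: "nu a = add_mset (al a) R"
      using good unfolding good_def by (meson DiffI multi_member_split)
    show ?thesis
      using 3 in_range[of a] al(2)[of a] nw(1)[of a] m_ge1[of a] i
      by (auto simp: arr_def bump_def e_def shorten_def lens_of_def R)
  next
    case 4
    then show ?thesis using j good
      by (auto simp: arr_def bump_def e_def shorten_def lens_of_def good_def)
  qed
qed

lemma sum_if_interval:
  fixes k l :: nat
  shows "(\<Sum>i=1..k. if b \<and> i = l then 1 else 0 :: int) = (if b \<and> 1 \<le> l \<and> l \<le> k then 1 else 0)"
  by (cases b) auto

text \<open>Summed over rows, \<open>c1 - c\<close> is the pairing of the columns with the second
  difference of \<open>e\<close>. Both \<open>al a\<close> and \<open>nw a\<close> cost nothing, but
  the columns of \<open>nw a\<close> contribute \<open>- eps a\<close> to the pairing, which has to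
  be added back.\<close>

lemma shorten_cost:
  assumes good: "good U nu" and a: "a \<in> {1..n}"
  shows "(\<Sum>x\<in>#shorten U nu a. c1 a x) = (\<Sum>x\<in>#nu a. c a x)
     + (\<Sum>i=1..H. arr n z1 (shorten U nu) a i * (2 * e a i - e (a - 1) i - e (a + 1) i))
     + (if a \<in> {1..<j} - U then eps a else 0)"
proof -
  define g where "g i = 2 * e a i - e (a - 1) i - e (a + 1) i" for i
  have c1': "c1 a x = c a x + (\<Sum>i=1..fst x. g i)" for x
    using c1[of a x] a by (simp add: g_def e_def)
  have gsum: "(\<Sum>i=1..k. g i) = 2 * (if a < j \<and> 1 \<le> m a \<and> m a \<le> k then 1 else 0)
     - (if a - 1 < j \<and> 1 \<le> m (a - 1) \<and> m (a - 1) \<le> k then 1 else 0)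
     - (if a + 1 < j \<and> 1 \<le> m (a + 1) \<and> m (a + 1) \<le> k then 1 else 0)" for k
    unfolding g_def e_def sum_subtractf sum_distrib_left[symmetric] sum_if_interval by simp
  have le: "\<forall>x\<in>#nu a. fst x \<le> H"
    using rows good a rows_le_subconf unfolding good_def rows_le_def by blast
  have main: "(\<Sum>x\<in>#R. c1 a x) = (\<Sum>x\<in>#R. c a x) + (\<Sum>i=1..H. col (image_mset fst R) i * g i)"
    if "\<forall>x\<in>#R. fst x \<le> H" for R
    using that by (simp only: c1' sum_mset.distrib sum_col_weight)
  show ?thesis
  proof (cases "a \<in> {1..<j} - U")
    case False
    then have eq: "shorten U nu a = nu a" by (simp only: shorten_def if_False)
    have "arr n z1 (shorten U nu) a i = col (image_mset fst (nu a)) i" for i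
      using a by (simp add: arr_def lens_of_def eq)
    then show ?thesis using main[OF le] by (simp only: eq g_def[symmetric] False if_False add_0_right)
  next
    case True
    then obtain R where R: "nu a = add_mset (al a) R"
      using good unfolding good_def by (meson multi_member_split)
    have eq: "shorten U nu a = R + (if 1 < m a then {#nw a#} else {#})"
      using True by (simp add: shorten_def R)
    have Rle: "\<forall>x\<in>#R. fst x \<le> H" using le R by simp
    have j': "1 \<le> a" "a < j" using True by auto
    have "(\<Sum>x\<in>#shorten U nu a. c1 a x) = (\<Sum>x\<in>#R. c a x) + (\<Sum>i=1..H. col (image_mset fst R) i * g i)"
      using main[OF Rle] nw(2)[OF j'] by (simp add: eq)
    also have "(\<Sum>x\<in>#R. c a x) = (\<Sum>x\<in>#nu a. c a x)"
      using al(3)[OF j'] by (simp add: R)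
    also have "(\<Sum>i=1..H. col (image_mset fst R) i * g i) =
       (\<Sum>i=1..H. arr n z1 (shorten U nu) a i * g i) - (if 1 < m a then \<Sum>i=1..m a - 1. g i else 0)"
    proof (cases "1 < m a")
      case True
      have "(\<Sum>i=1..m a - 1. g i) = (\<Sum>i=1..H. if i \<le> m a - 1 then g i else 0)"
        using m_le[OF j'(2)] by (subst sum_iverson) (simp add: min_absorb2)
      moreover have "arr n z1 (shorten U nu) a i * g i =
         col (image_mset fst R) i * g i + (if i \<le> m a - 1 then g i else 0)" for i
        using True a nw(1)[of a] by (simp add: arr_def lens_of_def eq algebra_simps)
      ultimately show ?thesis using True by (simp add: sum.distrib)
    next
      case False
      then show ?thesis using a by (simp add: arr_def lens_of_def eq)
    qed
    also have "(if 1 < m a then \<Sum>i=1..m a - 1. g i else 0) = - eps a"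
    proof -
      have 1: "1 \<le> m (a - 1)" "m (a - 1) \<le> m a" "1 \<le> m a" "a + 1 < j \<Longrightarrow> m a \<le> m (a + 1)"
        using m_ge1[of "a - 1"] m_ge1[of a] m_mono[of a] m_mono[of "a + 1"] j' by auto
      have 2: "a - 1 < j" using j' by simp
      show ?thesis
        unfolding gsum eps_def using 1 2 j' by (cases "1 < m a") auto
    qed
    finally show ?thesis using True by (simp add: g_def)
  qed
qed

lemma P_shorten:
  assumes good: "good U nu"
  shows "W1 (shorten U nu) + gain = P U nu"
proof -
  let ?x = "arr n z1 (shorten U nu)"
  have U: "U \<subseteq> {1..<j}" using good by (simp add: good_def)
  have "Obj n H 1 d (\<lambda>a i. arr n z nu a i + bump U a i) = Obj n H 1 d (\<lambda>a i. e a i + ?x a i)"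
    by (rule Obj_cong) (use shorten_arr[OF good] in simp)
  also have "\<dots> = Obj n H 1 d e + Obj n H 1 d ?x
    + (\<Sum>a=1..n. \<Sum>i=1..H. ?x a i * (e (a - 1) i + e (a + 1) i - 2 * e a i)) + (\<Sum>i=1..H. ?x 0 i * e 1 i)"
    by (rule Obj_add[where v = e, OF n e_top(1)])
  also have "(\<Sum>i=1..H. ?x 0 i * e 1 i) = (if 1 < j then z1 (m 1) else 0)"
  proof (cases "1 < j")
    case True
    have "(\<Sum>i=1..H. ?x 0 i * e 1 i) = (\<Sum>i=1..H. (if i = m 1 then 1 else 0) * z1 i)"
      using True by (intro sum.cong) (auto simp: arr_def e_def)
    then show ?thesis using True m_ge1[of 1] m_le[of 1] by (subst (asm) sum_indicator) simp
  next
    case False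
    then show ?thesis by (simp add: e_def)
  qed
  also note Obj_e
  also have "(\<Sum>a=1..n. \<Sum>i=1..H. ?x a i * (e (a - 1) i + e (a + 1) i - 2 * e a i)) =
     - (\<Sum>a=1..n. \<Sum>i=1..H. ?x a i * (2 * e a i - e (a - 1) i - e (a + 1) i))"
    unfolding sum_negf[symmetric] by (intro sum.cong) (auto simp: algebra_simps)
  finally have O: "Obj n H 1 d (\<lambda>a i. arr n z nu a i + bump U a i) = gain - (\<Sum>a\<in>{1..<j}. eps a)
     + Obj n H 1 d ?x - (\<Sum>a=1..n. \<Sum>i=1..H. ?x a i * (2 * e a i - e (a - 1) i - e (a + 1) i))"
    by (simp add: gain_def)
  have "cost n c1 (shorten U nu) = cost n c nu
     + (\<Sum>a=1..n. \<Sum>i=1..H. ?x a i * (2 * e a i - e (a - 1) i - e (a + 1) i))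
     + (\<Sum>a=1..n. if a \<in> {1..<j} - U then eps a else 0)"
    unfolding cost_def sum.distrib[symmetric] by (intro sum.cong refl shorten_cost[OF good])
  moreover have "(\<Sum>a=1..n. if a \<in> {1..<j} - U then eps a else 0) = (\<Sum>a\<in>{1..<j}. eps a) - (\<Sum>a\<in>U. eps a)"
  proof -
    have "{a\<in>{1..n}. a \<in> {1..<j} - U} = {1..<j} - U" using j by auto
    then have "(\<Sum>a=1..n. if a \<in> {1..<j} - U then eps a else 0) = (\<Sum>a\<in>{1..<j} - U. eps a)"
      using sum.inter_filter[of "{1..n}" eps "\<lambda>a. a \<in> {1..<j} - U"]
      by (simp only: finite_atLeastAtMost)
    then show ?thesis using U by (simp add: sum_diff)
  qed
  ultimately show ?thesis
    unfolding P_def W1_def O by simp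
qed

lemma shorten_subconf:
  assumes good: "good U nu"
  shows "subconf n (shorten U nu) cfg1"
  unfolding subconf_def
proof (intro conjI ballI allI impI)
  fix a assume a: "a \<in> {1..n}"
  have s: "nu a \<subseteq># cfg a" using good a by (simp add: good_def subconf_def)
  consider "a \<in> U" | "a \<in> {1..<j} - U" | "j \<le> a" using a by fastforce
  then show "shorten U nu a \<subseteq># cfg1 a"
  proof cases
    case 1
    then have "nu a \<subseteq># cfg a - {#al a#}" "a \<in> {1..<j}" using good by (auto simp: good_def)
    then show ?thesis using 1 by (auto simp: shorten_def cfg1 intro: subset_mset.order_trans)
  next
    case 2
    have "nu a - {#al a#} \<subseteq># cfg a - {#al a#}" using s by (simp add: subseteq_mset_def diff_le_mono)
    then show ?thesis using 2 by (auto simp: shorten_def cfg1)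
  next
    case 3
    then show ?thesis using s by (auto simp: shorten_def cfg1)
  qed
next
  fix a assume a: "a \<notin> {1..n}"
  then show "shorten U nu a = {#}" using good in_range[of a] by (auto simp: shorten_def good_def subconf_def)
qed

lemma shorten_surj:
  assumes s: "subconf n w cfg1"
  obtains U nu where "good U nu" and "shorten U nu = w"
proof -
  \<comment> \<open>\<open>U\<close> collects the colours in which \<open>w\<close> fits into the
    old rows other than \<open>al a\<close>. In the remaining ones \<open>w\<close> must contain
    \<open>nw a\<close>, which is turned back into \<open>al a\<close>.\<close>
  define U where "U = {a\<in>{1..<j}. w a \<subseteq># cfg a - {#al a#}}"
  define nu where "nu a = (if a \<in> {1..<j} - U then w a - {#nw a#} + {#al a#} else w a)" for a
  have key: "1 < m a \<and> nw a \<in># w a \<and> w a - {#nw a#} \<subseteq># cfg a - {#al a#}" if a: "a \<in> {1..<j} - U" for a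
  proof -
    have w: "w a \<subseteq># cfg a - {#al a#} + (if 1 < m a then {#nw a#} else {#})"
    proof -
      have "w a \<subseteq># cfg1 a" using s in_range[of a] a unfolding subconf_def by blast
      then show ?thesis using a by (simp add: cfg1)
    qed
    have nU: "\<not> w a \<subseteq># cfg a - {#al a#}" using a by (simp add: U_def)
    with w have 1: "1 < m a" by (auto split: if_splits)
    with w have w': "w a \<subseteq># add_mset (nw a) (cfg a - {#al a#})" by simp
    then have 3: "w a - {#nw a#} \<subseteq># cfg a - {#al a#}" by (simp add: subset_eq_diff_conv)
    have 2: "nw a \<in># w a"
    proof (rule ccontr)
      assume "nw a \<notin># w a"
      then have "w a - {#nw a#} = w a" by simp
      with nU 3 show False by simp
    qed
    show ?thesis
      using 1 2 3 by simp
  qed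
  have "good U nu"
    unfolding good_def
  proof (intro conjI ballI)
    show "U \<subseteq> {1..<j}" by (auto simp: U_def)
    show "subconf n nu cfg"
      unfolding subconf_def
    proof (intro conjI ballI allI impI)
      fix a assume a: "a \<in> {1..n}"
      consider "a \<in> U" | "a \<in> {1..<j} - U" | "j \<le> a" using a by fastforce
      then show "nu a \<subseteq># cfg a"
      proof cases
        case 1
        then have "w a \<subseteq># cfg a - {#al a#}" by (simp add: U_def)
        then show ?thesis using 1 by (simp add: nu_def) (meson diff_subset_eq_self subset_mset.order_trans)
      next
        case 2
        have "al a \<in># cfg a" using al(1)[of a] 2 by auto
        then show ?thesis using key[OF 2] 2
          by (simp add: nu_def) (metis insert_subset_eq_iff)
      next
        case 3
        have "w a \<subseteq># cfg1 a" using s a unfolding subconf_def by blast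
        then show ?thesis using 3 by (simp add: nu_def cfg1)
      qed
    next
      fix a assume a: "a \<notin> {1..n}"
      then show "nu a = {#}" using s in_range[of a] by (auto simp: nu_def subconf_def)
    qed
  next
    fix a assume "a \<in> {1..<j} - U"
    then show "al a \<in># nu a" by (simp add: nu_def)
  next
    fix a assume "a \<in> U"
    then show "nu a \<subseteq># cfg a - {#al a#}" by (simp add: nu_def U_def)
  qed
  moreover have "shorten U nu = w"
    using key by (auto simp: shorten_def nu_def fun_eq_iff U_def)
  ultimately show thesis by (rule that)
qed

end

lemma col_const:
  assumes "\<And>x. x \<in># A \<Longrightarrow> lo \<le> x \<Longrightarrow> hi \<le> x" and "lo \<le> i" and "i \<le> hi"
  shows "col A i = col A lo"
proof -
  have "filter_mset (\<lambda>x. i \<le> x) A = filter_mset (\<lambda>x. lo \<le> x) A"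
    using assms by (intro filter_mset_cong) (auto intro: order_trans)
  then show ?thesis by (simp add: col_def)
qed

context kkr_move
begin

text \<open>The marginal gain from one more unit of colour \<open>a\<close> at level
  \<open>m a\<close>, before the self-interaction -1 is subtracted.\<close>

definition h :: "rcfg \<Rightarrow> nat \<Rightarrow> int" where
  "h nu a = arr n z nu (a - 1) (m a) + arr n z nu (a + 1) (m a) - 2 * arr n z nu a (m a)
     + (if a = d then 1 else 0)"

lemma P_eq_W:
  assumes U: "U \<subseteq> {1..<j}"
  shows "P U nu = W nu
    + (\<Sum>a\<in>U. h nu a + (if a - 1 \<in> U \<and> m (a - 1) = m a then 1 else 0) - 1 + eps a)"
proof -
  let ?y = "arr n z nu"
  have "U \<subseteq> {..<j}" "U - {0} = U" using U by auto
  then have 1: "Obj n H 1 d (bump U) =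
    (\<Sum>a\<in>U. (if a - 1 \<in> U \<and> m (a - 1) = m a then 1 else 0) - 1 + (if a = d then 1 else 0))"
    using Obj_bump[of U] by simp
  have 2: "(\<Sum>a=1..n. \<Sum>i=1..H. bump U a i * (?y (a - 1) i + ?y (a + 1) i - 2 * ?y a i)) =
     (\<Sum>a\<in>U. ?y (a - 1) (m a) + ?y (a + 1) (m a) - 2 * ?y a (m a))"
  proof -
    have "(\<Sum>a=1..n. \<Sum>i=1..H. bump U a i * (?y (a - 1) i + ?y (a + 1) i - 2 * ?y a i)) =
      (\<Sum>a=1..n. if a \<in> U then ?y (a - 1) (m a) + ?y (a + 1) (m a) - 2 * ?y a (m a) else 0)"
    proof (intro sum.cong refl)
      fix a
      show "(\<Sum>i=1..H. bump U a i * (?y (a - 1) i + ?y (a + 1) i - 2 * ?y a i)) =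
        (if a \<in> U then ?y (a - 1) (m a) + ?y (a + 1) (m a) - 2 * ?y a (m a) else 0)"
      proof (cases "a \<in> U")
        case True
        then have "a < j" using U by auto
        have "bump U a i = (if i = m a then 1 else 0)" for i
          using True by (simp add: bump_def)
        then show ?thesis using True by (simp only: sum_at_m[OF \<open>a < j\<close>]) simp
      qed (simp add: bump_def)
    qed
    then show ?thesis by (simp only: sum_if_subset[OF U])
  qed
  have 3: "(\<Sum>i=1..H. bump U 0 i * ?y 1 i) = 0"
  proof -
    have "0 \<notin> U" using U by auto
    then show ?thesis by (simp add: bump_def)
  qed
  have "Obj n H 1 d (\<lambda>a i. ?y a i + bump U a i) = Obj n H 1 d ?y
    + (\<Sum>a\<in>U. (if a - 1 \<in> U \<and> m (a - 1) = m a then 1 else 0) - 1 + (if a = d then 1 else 0))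
    + (\<Sum>a\<in>U. ?y (a - 1) (m a) + ?y (a + 1) (m a) - 2 * ?y a (m a))"
    using Obj_add[of n ?y H 1 d "bump U"] n 1 2 3 by simp
  also have "\<dots> = Obj n H 1 d ?y
     + (\<Sum>a\<in>U. h nu a + (if a - 1 \<in> U \<and> m (a - 1) = m a then 1 else 0) - 1)"
    unfolding add.assoc sum.distrib[symmetric] by (simp add: h_def algebra_simps)
  finally show ?thesis
    by (simp add: P_def W_def sum.distrib)
qed

lemma Obj_upd:
  assumes b: "b \<in> {1..n}" and nu: "\<And>a. a \<noteq> b \<Longrightarrow> nu' a = nu a" and U: "\<And>a. a \<noteq> b \<Longrightarrow> a \<in> U' \<longleftrightarrow> a \<in> U"
    and Un: "U \<subseteq> {1..n}"
    and \<delta>: "\<And>i. i \<in> {1..H} \<Longrightarrow> arr n z nu' b i + bump U' b i = arr n z nu b i + bump U b i + \<delta> i"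
  shows "Obj n H 1 d (\<lambda>a i. arr n z nu' a i + bump U' a i) = Obj n H 1 d (\<lambda>a i. arr n z nu a i + bump U a i)
   + (\<Sum>i=1..H. \<delta> i * (arr n z nu (b - 1) i + bump U (b - 1) i + (arr n z nu (b + 1) i + bump U (b + 1) i)
        - 2 * (arr n z nu b i + bump U b i) + (if b = d then 1 else 0)) - \<delta> i * \<delta> i)"
proof -
  let ?v = "\<lambda>a i. arr n z nu a i + bump U a i"
  have "Obj n H 1 d (\<lambda>a i. arr n z nu' a i + bump U' a i) = Obj n H 1 d (\<lambda>a i. ?v a i + (if a = b then \<delta> i else 0))"
  proof (rule Obj_cong)
    fix a i assume "i \<in> {1..H}"
    then show "arr n z nu' a i + bump U' a i = ?v a i + (if a = b then \<delta> i else 0)"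
      using nu[of a] U[of a] \<delta>[of i] by (cases "a = b") (auto simp: arr_def lens_of_def bump_def)
  qed
  also have "\<dots> = Obj n H 1 d ?v + (\<Sum>i=1..H. \<delta> i * (?v (b - 1) i + ?v (b + 1) i - 2 * ?v b i + (if b = d then 1 else 0)) - \<delta> i * \<delta> i)"
    by (rule Obj_change_colour[where v = ?v]) (use n b Un in \<open>auto simp: bump_def\<close>)
  finally show ?thesis .
qed

lemma arr_antimono': "i \<le> i' \<Longrightarrow> arr n z nu a i' \<le> arr n z nu a i"
  by (rule arr_antimono) (use z_antimono in auto)

lemma arr_nonneg': "0 \<le> arr n z nu a i"
  by (rule arr_nonneg) (rule z_nonneg)

lemma arr_strict:
  assumes "a < j" and "a = 0 \<or> al a \<in># nu a" and "m a < i"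
  shows "arr n z nu a i < arr n z nu a (m a)"
proof (cases "a = 0")
  case True
  then show ?thesis using z_strict[of i] assms by (simp add: arr_def)
next
  case False
  with assms obtain R where R: "nu a = add_mset (al a) R" by (meson multi_member_split)
  have "col (image_mset fst R) i \<le> col (image_mset fst R) (m a)"
    using assms by (intro col_antimono) simp
  then show ?thesis using False assms al(2)[of a] j by (auto simp: arr_def lens_of_def R)
qed

definition unused :: "rcfg \<Rightarrow> nat set" where
  "unused nu = {a\<in>{1..<j}. al a \<notin># nu a}"

lemma good_unused:
  assumes "subconf n nu cfg"
  shows "good (unused nu) nu"
  unfolding good_def
proof (intro conjI ballI)
  fix a assume "a \<in> unused nu"
  then have a: "a \<in> {1..<j}" "al a \<notin># nu a" by (auto simp: unused_def)
  then have "nu a \<subseteq># cfg a" using assms in_range unfolding subconf_def by blast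
  moreover have "nu a - {#al a#} = nu a" using a by simp
  ultimately show "nu a \<subseteq># cfg a - {#al a#}"
    by (metis subseteq_mset_def diff_le_mono count_diff)
qed (use assms in \<open>auto simp: unused_def\<close>)

text \<open>The shortest used row that is not shorter than \<open>al a\<close> is replaced by \<open>al a\<close>.\<close>

lemma exchange_up:
  assumes s: "subconf n nu cfg" and a: "a \<in> unused nu" and pos: "0 < arr n z nu a (m a)"
    and neg: "\<And>i. m a < i \<Longrightarrow> arr n z nu (a - 1) i + arr n z nu (a + 1) i - 2 * arr n z nu a (m a)
       + (if a = d then 1 else 0) \<le> -1"
  shows "\<exists>nu'. subconf n nu' cfg \<and> unused nu' = unused nu - {a} \<and> W nu \<le> W nu'"
proof -
  have aj: "1 \<le> a" "a < j" "a \<in> {1..n}" and al_nu: "al a \<notin># nu a"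
    using a in_range[of a] by (auto simp: unused_def)
  have "0 < col (lens_of nu a) (m a)" using pos aj by (simp add: arr_def)
  then have "\<exists>x. x \<in># nu a \<and> m a \<le> fst x" by (auto simp: col_pos lens_of_def)
  then have "\<exists>x. (x \<in># nu a \<and> m a \<le> fst x) \<and> (\<forall>y. y \<in># nu a \<and> m a \<le> fst y \<longrightarrow> fst x \<le> fst y)"
    using ex_has_least_nat[of "\<lambda>x. x \<in># nu a \<and> m a \<le> fst x" _ fst] by blast
  then obtain x where x: "x \<in># nu a" "m a \<le> fst x" and xmin: "\<And>y. y \<in># nu a \<Longrightarrow> m a \<le> fst y \<Longrightarrow> fst x \<le> fst y"
    by blast
  define nu' where "nu' = nu(a := nu a - {#x#} + {#al a#})"
  have sub_a: "nu a \<subseteq># cfg a" using s aj unfolding subconf_def by blast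
  have "nu a \<subseteq># cfg a - {#al a#}" using good_unused[OF s] a by (simp add: good_def)
  then have "nu a - {#x#} \<subseteq># cfg a - {#al a#}"
    by (meson diff_subset_eq_self subset_mset.order_trans)
  then have "nu' a \<subseteq># cfg a"
    using al(1)[of a] aj by (simp add: nu'_def) (metis insert_subset_eq_iff)
  then have "subconf n nu' cfg" using s aj by (auto simp: subconf_def nu'_def)
  moreover have "unused nu' = unused nu - {a}" by (auto simp: unused_def nu'_def)
  moreover have "W nu \<le> W nu'"
  proof -
    define \<delta> where "\<delta> i = (if m a < i \<and> i \<le> fst x then - 1 else 0 :: int)" for i
    have \<delta>: "arr n z nu' a i = arr n z nu a i + \<delta> i" for i
    proof -
      obtain R where "nu a = add_mset x R" using x(1) by (meson multi_member_split)
      then show ?thesis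
        using aj x(2) by (auto simp: arr_def lens_of_def nu'_def al(2) \<delta>_def)
    qed
    have "Obj n H 1 d (\<lambda>b i. arr n z nu' b i + bump {} b i) = Obj n H 1 d (\<lambda>b i. arr n z nu b i + bump {} b i)
     + (\<Sum>i=1..H. \<delta> i * (arr n z nu (a - 1) i + bump {} (a - 1) i + (arr n z nu (a + 1) i + bump {} (a + 1) i)
        - 2 * (arr n z nu a i + bump {} a i) + (if a = d then 1 else 0)) - \<delta> i * \<delta> i)"
      by (rule Obj_upd) (use aj \<delta> in \<open>auto simp: nu'_def bump_def\<close>)
    then have O: "Obj n H 1 d (arr n z nu') = Obj n H 1 d (arr n z nu)
     + (\<Sum>i=1..H. \<delta> i * (arr n z nu (a - 1) i + arr n z nu (a + 1) i
        - 2 * arr n z nu a i + (if a = d then 1 else 0)) - \<delta> i * \<delta> i)"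
      by (simp add: bump_def)
    have "0 \<le> \<delta> i * (arr n z nu (a - 1) i + arr n z nu (a + 1) i
        - 2 * arr n z nu a i + (if a = d then 1 else 0)) - \<delta> i * \<delta> i" for i
    proof (cases "m a < i \<and> i \<le> fst x")
      case True
      \<comment> \<open>\<open>x\<close> is the shortest used row of length at least
        \<open>m a\<close>, so the column is constant up to the length of \<open>x\<close>.\<close>
      have "arr n z nu a i = arr n z nu a (m a)"
        using True xmin aj unfolding arr_def lens_of_def by (auto intro!: col_const[where hi = "fst x"])
      then show ?thesis using neg[of i] True by (simp add: \<delta>_def)
    qed (auto simp: \<delta>_def)
    then have "Obj n H 1 d (arr n z nu) \<le> Obj n H 1 d (arr n z nu')"
      unfolding O by (simp add: sum_nonneg)
    moreover have "cost n c nu' \<le> cost n c nu"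
    proof -
      have "0 \<le> c a x" using c_nonneg[of a x] aj x sub_a by (meson mset_subset_eqD)
      moreover have "c a (al a) = 0" using al(3) aj by simp
      ultimately show ?thesis
        unfolding nu'_def cost_upd[OF aj(3)] by (simp only: sum_lens_swap[OF x(1)])
    qed
    ultimately show ?thesis by (simp add: W_def)
  qed
  ultimately show ?thesis by blast
qed

lemma W_le_P:
  assumes "subconf n nu cfg"
  shows "\<exists>U nu'. good U nu' \<and> W nu \<le> P U nu'"
  using assms
proof (induction "card (unused nu)" arbitrary: nu rule: less_induct)
  case less
  let ?y = "arr n z nu"
  show ?case
  proof (cases "\<exists>a\<in>unused nu. 0 < ?y a (m a) \<and> (\<forall>i. m a < i \<longrightarrow> ?y (a - 1) i + ?y (a + 1) i - 2 * ?y a (m a)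
       + (if a = d then 1 else 0) \<le> -1)")
    case True
    then obtain a nu' where a: "a \<in> unused nu" and nu': "subconf n nu' cfg" "unused nu' = unused nu - {a}" "W nu \<le> W nu'"
      using exchange_up[OF less.prems] by meson
    have "finite (unused nu)" by (simp add: unused_def)
    then have "card (unused nu') < card (unused nu)" using a nu'(2) by (metis card_Diff1_less)
    from less.hyps[OF this nu'(1)] nu'(3) show ?thesis by (meson order_trans)
  next
    case False
    let ?U = "unused nu"
    have U: "?U \<subseteq> {1..<j}" by (auto simp: unused_def)
    have "0 \<le> h nu a + (if a - 1 \<in> ?U \<and> m (a - 1) = m a then 1 else 0) - 1 + eps a" if a: "a \<in> ?U" for a
    proof -
      have aj: "1 \<le> a" "a < j" using a U by auto
      have ge: "\<And>b i. 0 \<le> ?y b i" by (rule arr_nonneg')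
      have mono: "m a < i \<Longrightarrow> ?y b i \<le> ?y b (m a)" for b i by (rule arr_antimono') simp
      have h0: "0 \<le> h nu a"
      proof (rule ccontr)
        assume "\<not> 0 \<le> h nu a"
        then have *: "h nu a \<le> -1" by simp
        have "0 < ?y a (m a)" using * ge[of "a - 1" "m a"] ge[of "a + 1" "m a"] unfolding h_def by (auto split: if_splits)
        moreover have "?y (a - 1) i + ?y (a + 1) i - 2 * ?y a (m a) + (if a = d then 1 else 0) \<le> -1" if "m a < i" for i
          using mono[OF that, of "a - 1"] mono[OF that, of "a + 1"] * unfolding h_def by linarith
        ultimately show False using False a by blast
      qed
      \<comment> \<open>For equal lengths \<open>eps a\<close> is 0, so without \<open>a - 1\<close>
        in \<open>U\<close> a gain of 1 is required. The strict drop of colour \<open>a - 1\<close>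
        above level \<open>m a\<close> supplies the missing unit.\<close>
      have h1: "1 \<le> h nu a" if e: "m (a - 1) = m a" and nU: "a - 1 \<notin> ?U"
      proof (rule ccontr)
        assume "\<not> 1 \<le> h nu a"
        then have *: "h nu a \<le> 0" by simp
        have "a - 1 = 0 \<or> al (a - 1) \<in># nu (a - 1)" using nU aj by (auto simp: unused_def)
        then have str: "?y (a - 1) i < ?y (a - 1) (m a)" if "m a < i" for i
          using arr_strict[of "a - 1" nu i] that e aj by simp
        have "1 \<le> ?y (a - 1) (m a)" using str[of "Suc (m a)"] ge[of "a - 1" "Suc (m a)"] by simp
        then have "0 < ?y a (m a)" using * ge[of "a + 1" "m a"] unfolding h_def by (auto split: if_splits)
        moreover have "?y (a - 1) i + ?y (a + 1) i - 2 * ?y a (m a) + (if a = d then 1 else 0) \<le> -1" if "m a < i" for i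
          using str[OF that] mono[OF that, of "a + 1"] * unfolding h_def by linarith
        ultimately show False using False a by blast
      qed
      show ?thesis
        using h0 h1 m_mono[of a] aj by (auto simp: eps_def)
    qed
    then have "W nu \<le> P ?U nu"
      unfolding P_eq_W[OF U] by (simp add: sum_nonneg)
    then show ?thesis using good_unused[OF less.prems] by blast
  qed
qed

text \<open>
  The longest used row that is shorter than \<open>al a\<close> is replaced by \<open>al a\<close>. If there is none, \<open>al a\<close>
  is simply added, which is the case \<open>k = 0\<close> in the proof.
\<close>

lemma exchange_down:
  assumes g: "good U nu" and a: "a \<in> U" and pos: "1 \<le> h nu a"
  shows "\<exists>nu'. good (U - {a}) nu' \<and> P U nu \<le> P (U - {a}) nu'"
proof -
  have U: "U \<subseteq> {1..<j}" and s: "subconf n nu cfg" using g by (auto simp: good_def)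
  then have aj: "1 \<le> a" "a < j" "a \<in> {1..n}" using a in_range[of a] by auto
  have sub: "nu a \<subseteq># cfg a - {#al a#}" using g a by (simp add: good_def)
  have "\<exists>k R cx. k < m a \<and> R \<subseteq># nu a \<and> (\<forall>i\<ge>1. col (image_mset fst R) i = col (lens_of nu a) i - (if i \<le> k then 1 else 0))
     \<and> (\<Sum>x\<in>#R. c a x) = (\<Sum>x\<in>#nu a. c a x) - cx \<and> 0 \<le> cx \<and> (m (a - 1) \<le> k \<longrightarrow> 1 \<le> cx)
     \<and> (\<forall>x. x \<in># lens_of nu a \<longrightarrow> k + 1 \<le> x \<longrightarrow> m a \<le> x)"
  proof (cases "\<exists>x. x \<in># nu a \<and> fst x < m a")
    case True
    let ?S = "{k. \<exists>x. x \<in># nu a \<and> fst x = k \<and> k < m a}"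
    have fin: "finite ?S" by (rule finite_subset[of _ "{..<m a}"]) auto
    have "Max ?S \<in> ?S" using fin True by (intro Max_in) auto
    then obtain x where x: "x \<in># nu a" "fst x = Max ?S" "Max ?S < m a" by auto
    have max: "m a \<le> fst y" if "y \<in># nu a" "fst x < fst y" for y
    proof (rule ccontr)
      assume "\<not> m a \<le> fst y"
      then have "fst y \<in> ?S" using that by (metis (mono_tags, lifting) mem_Collect_eq not_le_imp_less)
      then have "fst y \<le> Max ?S" by (rule Max_ge[OF fin])
      then show False using that x(2) by simp
    qed
    have xm: "fst x < m a" using x by simp
    obtain R where R: "nu a = add_mset x R" using x(1) by (meson multi_member_split)
    have max': "\<forall>k. k \<in># lens_of nu a \<longrightarrow> fst x + 1 \<le> k \<longrightarrow> m a \<le> k"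
    proof (intro allI impI)
      fix k assume "k \<in># lens_of nu a" "fst x + 1 \<le> k"
      moreover from this obtain y where "y \<in># nu a" "k = fst y" by (auto simp: lens_of_def)
      ultimately show "m a \<le> k" using max[of y] by simp
    qed
    have xc: "x \<in># cfg a" using x(1) sub by (meson in_diffD mset_subset_eqD)
    have 1: "R \<subseteq># nu a" by (simp add: R)
    have 2: "\<forall>i\<ge>1. col (image_mset fst R) i = col (lens_of nu a) i - (if i \<le> fst x then 1 else 0)"
      by (simp add: R lens_of_def)
    have 3: "(\<Sum>x\<in>#R. c a x) = (\<Sum>x\<in>#nu a. c a x) - c a x" by (simp add: R)
    have 4: "0 \<le> c a x" by (rule c_nonneg[OF aj(1,2) xc])
    have 5: "m (a - 1) \<le> fst x \<longrightarrow> 1 \<le> c a x" using c_pos[OF aj(1,2) xc _ xm] by blast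
    show ?thesis
      by (rule exI[of _ "fst x"], rule exI[of _ R], rule exI[of _ "c a x"]) (intro conjI xm 1 2 3 4 5 max')
  next
    case False
    have "m (a - 1) \<ge> 1" using m_ge1[of "a - 1"] aj by simp
    then show ?thesis
      using False m_ge1[of a] aj
      by (intro exI[of _ 0] exI[of _ "nu a"]) (auto simp: lens_of_def not_less)
  qed
  then obtain k R cx where k: "k < m a" and R: "R \<subseteq># nu a"
    and colR: "\<And>i. 1 \<le> i \<Longrightarrow> col (image_mset fst R) i = col (lens_of nu a) i - (if i \<le> k then 1 else 0)"
    and costR: "(\<Sum>x\<in>#R. c a x) = (\<Sum>x\<in>#nu a. c a x) - cx" and cx: "0 \<le> cx" "m (a - 1) \<le> k \<Longrightarrow> 1 \<le> cx"
    and gap: "\<And>x. x \<in># lens_of nu a \<Longrightarrow> k + 1 \<le> x \<Longrightarrow> m a \<le> x"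
    by blast
  define nu' where "nu' = nu(a := add_mset (al a) R)"
  have "R \<subseteq># cfg a - {#al a#}" using R sub by (rule subset_mset.order_trans)
  then have nu'a: "nu' a \<subseteq># cfg a"
    using al(1)[of a] aj by (simp add: nu'_def) (metis insert_subset_eq_iff)
  have "good (U - {a}) nu'"
    using g nu'a aj by (auto simp: good_def subconf_def nu'_def)
  moreover have "P U nu \<le> P (U - {a}) nu'"
  proof -
    define \<delta> where "\<delta> i = (if k < i \<and> i < m a then 1 else 0 :: int)" for i
    define y where "y b i = arr n z nu b i + bump U b i" for b i
    have y_ge: "arr n z nu b i \<le> y b i" for b i by (simp add: y_def bump_def)
    have O: "Obj n H 1 d (\<lambda>b i. arr n z nu' b i + bump (U - {a}) b i) = Obj n H 1 d (\<lambda>b i. arr n z nu b i + bump U b i)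
     + (\<Sum>i=1..H. \<delta> i * (arr n z nu (a - 1) i + bump U (a - 1) i + (arr n z nu (a + 1) i + bump U (a + 1) i)
        - 2 * (arr n z nu a i + bump U a i) + (if a = d then 1 else 0)) - \<delta> i * \<delta> i)"
    proof (rule Obj_upd)
      fix i assume "i \<in> {1..H}"
      then show "arr n z nu' a i + bump (U - {a}) a i = arr n z nu a i + bump U a i + \<delta> i"
        using aj a k colR[of i] al(2)[of a] by (auto simp: arr_def lens_of_def nu'_def bump_def \<delta>_def)
    qed (use aj U in_range in \<open>auto simp: nu'_def\<close>)
    define T where "T i = \<delta> i * (y (a - 1) i + y (a + 1) i - 2 * y a i + (if a = d then 1 else 0)) - \<delta> i * \<delta> i" for i
    have const: "y a i = arr n z nu a (m a)" if i: "k < i" "i < m a" for i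
    proof -
      have "col (lens_of nu a) i = col (lens_of nu a) (k + 1)" "col (lens_of nu a) (m a) = col (lens_of nu a) (k + 1)"
        by (rule col_const[OF gap]; use i in auto)+
      then show ?thesis using i aj by (simp add: y_def bump_def arr_def)
    qed
    have T0: "0 \<le> T i" for i
    proof (cases "k < i \<and> i < m a")
      case True
      have "arr n z nu b (m a) \<le> y b i" for b
        using arr_antimono'[of i "m a" nu b] y_ge[of b i] True by simp
      from this[of "a - 1"] this[of "a + 1"] show ?thesis
        using True const[of i] pos by (simp add: T_def \<delta>_def h_def)
    qed (auto simp: T_def \<delta>_def)
    \<comment> \<open>Colour \<open>a - 1\<close> is strictly larger at level
      \<open>m (a - 1)\<close> than at \<open>m a\<close>: it either carries a bump there, or its
      row \<open>al (a - 1)\<close> ends there, or it is colour 0 and \<open>z_strict\<close>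
      applies.\<close>
    have T1: "1 \<le> T (m (a - 1))" if km: "k < m (a - 1)" "m (a - 1) < m a"
    proof -
      have "arr n z nu (a - 1) (m a) < y (a - 1) (m (a - 1))"
      proof (cases "a - 1 \<in> U")
        case True
        then show ?thesis
          using arr_antimono'[of "m (a - 1)" "m a" nu "a - 1"] km by (simp add: y_def bump_def)
      next
        case False
        have "a - 1 = 0 \<or> al (a - 1) \<in># nu (a - 1)"
        proof (cases "a - 1 = 0")
          case nz: False
          then have "a - 1 \<in> {1..<j} - U" using False aj by auto
          then show ?thesis using g unfolding good_def by blast
        qed simp
        moreover have "a - 1 < j" using aj by simp
        ultimately have "arr n z nu (a - 1) (m a) < arr n z nu (a - 1) (m (a - 1))"
          using km(2) by (intro arr_strict)
        then show ?thesis
          using y_ge[of "a - 1" "m (a - 1)"] by (rule less_le_trans)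
      qed
      moreover have "arr n z nu (a + 1) (m a) \<le> y (a + 1) (m (a - 1))"
        using arr_antimono'[of "m (a - 1)" "m a" nu "a + 1"] y_ge[of "a + 1" "m (a - 1)"] km by simp
      ultimately show ?thesis
        using km const[of "m (a - 1)"] pos by (simp add: T_def \<delta>_def h_def)
    qed
    \<comment> \<open>Taking \<open>a\<close> out of \<open>U\<close> forfeits \<open>eps a\<close>.
      It is paid by the corigging of the removed row if that row has length at least
      \<open>m (a - 1)\<close>, and by the level \<open>m (a - 1)\<close> otherwise.\<close>
    have "eps a \<le> cx + (\<Sum>i=1..H. T i)"
    proof (cases "m (a - 1) < m a \<and> k < m (a - 1)")
      case True
      have "m (a - 1) \<in> {1..H}" using m_ge1[of "a - 1"] m_le[of "a - 1"] aj by simp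
      then have "T (m (a - 1)) \<le> (\<Sum>i=1..H. T i)"
        by (rule member_le_sum) (use T0 in auto)
      then show ?thesis using T1 True cx by (simp add: eps_def)
    next
      case False
      have "0 \<le> (\<Sum>i=1..H. T i)" by (simp add: sum_nonneg T0)
      then show ?thesis using False cx by (auto simp: eps_def)
    qed
    moreover have "cost n c nu' = cost n c nu - cx"
      unfolding nu'_def cost_upd[OF aj(3)] using costR al(3)[of a] aj by simp
    moreover have "(\<Sum>b\<in>U. eps b) = eps a + (\<Sum>b\<in>U - {a}. eps b)"
      using a U by (meson finite_atLeastLessThan finite_subset sum.remove)
    ultimately show ?thesis
      unfolding P_def O by (simp add: T_def y_def)
  qed
  ultimately show ?thesis by blast
qed

text \<open>Once no colour of \<open>U\<close> has marginal gain at least 1, every summand in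
  \<open>P_eq_W\<close> is at most 0, because the adjacency term and \<open>eps a\<close> are never
  1 together.\<close>

lemma P_le_W:
  assumes "good U nu"
  shows "\<exists>nu'. subconf n nu' cfg \<and> P U nu \<le> W nu'"
  using assms
proof (induction "card U" arbitrary: U nu rule: less_induct)
  case less
  have U: "U \<subseteq> {1..<j}" and s: "subconf n nu cfg" using less.prems by (auto simp: good_def)
  then have fin: "finite U" using finite_subset by blast
  show ?case
  proof (cases "\<exists>a\<in>U. 1 \<le> h nu a")
    case True
    then obtain a nu' where a: "a \<in> U" and nu': "good (U - {a}) nu'" "P U nu \<le> P (U - {a}) nu'"
      using exchange_down[OF less.prems] by meson
    have "card (U - {a}) < card U" using a fin by (metis card_Diff1_less)
    from less.hyps[OF this nu'(1)] nu'(2) show ?thesis by (meson order_trans)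
  next
    case False
    have "h nu a + (if a - 1 \<in> U \<and> m (a - 1) = m a then 1 else 0) - 1 + eps a \<le> 0" if "a \<in> U" for a
      using False that by (auto simp: eps_def not_le)
    then have "P U nu \<le> W nu"
      unfolding P_eq_W[OF U] by (simp add: sum_nonpos)
    then show ?thesis using s by blast
  qed
qed

text \<open>Together with its converse below: the maxima of \<open>W\<close> and \<open>W1\<close>
  differ exactly by \<open>gain\<close>.\<close>

theorem W_le_W1:
  assumes "subconf n nu cfg"
  shows "\<exists>nu'. subconf n nu' cfg1 \<and> W nu \<le> W1 nu' + gain"
  using W_le_P[OF assms] P_shorten shorten_subconf by metis

theorem W1_le_W:
  assumes "subconf n nu cfg1"
  shows "\<exists>nu'. subconf n nu' cfg \<and> W1 nu + gain \<le> W nu'"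
  using shorten_surj[OF assms] P_shorten P_le_W by metis

end

section \<open>Tau functions and the KKR map\<close>

lemma tau_pos_ge:
  assumes "subconf n nu rc"
  shows "tau_val n kappa nu d \<le> tau_pos n rc kappa d"
proof -
  have "tau_pos n rc kappa d = Max ((\<lambda>nu. tau_val n kappa nu d) ` {nu. subconf n nu rc})"
    unfolding tau_pos_def subconf_def by (rule arg_cong[where f = Max]) auto
  then show ?thesis
    using assms finite_subconf by (simp add: Max_ge)
qed

lemma tau_pos_attained: "\<exists>nu. subconf n nu rc \<and> tau_val n kappa nu d = tau_pos n rc kappa d"
proof -
  let ?S = "(\<lambda>nu. tau_val n kappa nu d) ` {nu. subconf n nu rc}"
  have "tau_pos n rc kappa d = Max ?S"
    unfolding tau_pos_def subconf_def by (rule arg_cong[where f = Max]) auto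
  moreover have "subconf n (\<lambda>_. {#}) rc" by (simp add: subconf_def)
  then have "Max ?S \<in> ?S" by (intro Max_in) (auto simp: finite_subconf)
  ultimately show ?thesis by auto
qed

lemma ex_rows_le: "\<exists>H\<ge>B. rows_le n H rc"
proof -
  let ?H = "B + (\<Sum>a=1..n. \<Sum>x\<in>#rc a. fst x)"
  have "fst x \<le> ?H" if "a \<in> {1..n}" "x \<in># rc a" for a x
  proof -
    have "fst x \<le> (\<Sum>x\<in>#rc a. fst x)" using that(2) by (auto dest!: multi_member_split)
    also have "\<dots> \<le> (\<Sum>a=1..n. \<Sum>x\<in>#rc a. fst x)" using that(1) by (intro member_le_sum) auto
    finally show ?thesis by simp
  qed
  then show ?thesis unfolding rows_le_def by (intro exI[of _ ?H]) auto
qed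

definition boxes :: "rcfg \<Rightarrow> nat \<Rightarrow> int" where
  "boxes cfg d = int (\<Sum>x\<in>#cfg d. fst x)"

lemma tau_val_boxes: "tau_val n kappa nu d = tau_val n kappa nu (n + 1) - (if 1 \<le> d \<and> d \<le> n then boxes nu d else 0)"
  by (simp add: tau_val_def boxes_def)

lemma two_obj1:
  fixes n :: nat
  assumes "v (n + 1) = 0"
  shows "2 * (\<Sum>a=1..n. v (a - 1) * v a - v a * v a) = v 0 * v 0 - (\<Sum>a\<le>n. (v a - v (a + 1)) * (v a - v (a + 1) :: int))"
proof -
  have *: "2 * (\<Sum>a=1..k. v (a - 1) * v a - v a * v a) = v 0 * v 0 - v k * v k - (\<Sum>a<k. (v a - v (a + 1)) * (v a - v (a + 1)))" for k
    by (induction k) (auto simp: algebra_simps)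
  show ?thesis unfolding * using assms by (simp add: lessThan_Suc_atMost[symmetric])
qed

text \<open>The differences of \<open>v\<close> lead from 0 to \<open>v d\<close> and back to 0, so
  their absolute values add up to at least twice that of \<open>v d\<close>; and the absolute value
  of an integer is at most its square.\<close>

lemma obj1_le_0:
  assumes "v 0 = 0" and "v (n + 1) = 0" and s: "s = 1 \<or> s = - 1"
  shows "obj1 n s d v \<le> 0"
proof -
  let ?D = "\<lambda>a. v a - v (a + 1)"
  have eq: "2 * (\<Sum>a=1..n. v (a - 1) * v a - v a * v a) = - (\<Sum>a<n+1. ?D a * ?D a)"
    using two_obj1[of v n] assms by (simp add: lessThan_Suc_atMost)
  have d: "(\<Sum>a=1..n. if a = d then s * v a else 0) = (if 1 \<le> d \<and> d \<le> n then s * v d else 0)"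
    by auto
  have ge: "2 * \<bar>v d\<bar> \<le> (\<Sum>a<n+1. ?D a * ?D a)" if "d \<le> n"
  proof -
    have "(\<Sum>a<k. ?D a) = v 0 - v k" for k by (induction k) auto
    then have "\<bar>v d\<bar> = \<bar>\<Sum>a<d. ?D a\<bar>" using assms(1) by simp
    also have "\<dots> \<le> (\<Sum>a<d. \<bar>?D a\<bar>)" by (rule sum_abs)
    finally have 1: "\<bar>v d\<bar> \<le> (\<Sum>a<d. \<bar>?D a\<bar>)" .
    have "(\<Sum>a=d..<d + k. ?D a) = v d - v (d + k)" for k by (induction k) auto
    from this[of "n + 1 - d"] have "\<bar>v d\<bar> = \<bar>\<Sum>a=d..<n+1. ?D a\<bar>" using assms(2) that by simp
    also have "\<dots> \<le> (\<Sum>a=d..<n+1. \<bar>?D a\<bar>)" by (rule sum_abs)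
    finally have "2 * \<bar>v d\<bar> \<le> (\<Sum>a<d. \<bar>?D a\<bar>) + (\<Sum>a=d..<n+1. \<bar>?D a\<bar>)" using 1 by simp
    also have "\<dots> = (\<Sum>a<n+1. \<bar>?D a\<bar>)"
      using that by (simp add: lessThan_atLeast0 sum.atLeastLessThan_concat)
    also have "\<dots> \<le> (\<Sum>a<n+1. ?D a * ?D a)"
    proof (rule sum_mono)
      fix a
      show "\<bar>?D a\<bar> \<le> ?D a * ?D a"
      proof (cases "?D a = 0")
        case False
        then have "\<bar>?D a\<bar> * 1 \<le> \<bar>?D a\<bar> * \<bar>?D a\<bar>" by (intro mult_left_mono) auto
        then show ?thesis by (simp add: abs_mult_self_eq)
      qed simp
    qed
    finally show ?thesis .
  qed
  have "0 \<le> (\<Sum>a<n+1. ?D a * ?D a)" by (intro sum_nonneg) simp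
  moreover have "s * v d \<le> \<bar>v d\<bar>" using s by auto
  moreover have "obj1 n s d v = (\<Sum>a=1..n. v (a - 1) * v a - v a * v a) + (if 1 \<le> d \<and> d \<le> n then s * v d else 0)"
    unfolding obj1_def sum.distrib d ..
  ultimately show ?thesis
    using eq ge by (cases "1 \<le> d \<and> d \<le> n") auto
qed

lemma Obj_le_0:
  assumes "\<And>i. v 0 i = 0" and "\<And>i. v (n + 1) i = 0" and "s = 1 \<or> s = - 1"
  shows "Obj n H s d v \<le> 0"
  unfolding Obj_def by (intro sum_nonpos obj1_le_0) (use assms in auto)

section \<open>Coriggings and complements\<close>

definition corig :: "nat \<Rightarrow> nat list \<Rightarrow> rcfg \<Rightarrow> nat \<Rightarrow> nat \<times> int \<Rightarrow> int" where
  "corig n mu0 cfg a x = vacn n mu0 (lens_of cfg) a (fst x) - snd x"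

lemma Epart_arr: "Epart n mu0 (lens_of cfg) a k = (\<Sum>i=1..k. parr n mu0 cfg a i)"
proof -
  have "(\<Sum>x\<leftarrow>mu0. min k x) = (\<Sum>x\<in>#mset mu0. min k x)"
    by (simp add: sum_mset_sum_list flip: mset_map)
  then have "int (\<Sum>x\<leftarrow>mu0. min k x) = (\<Sum>i=1..k. col (mset mu0) i)"
    by (simp only: sum_col_min)
  moreover have "int (\<Sum>x\<in>#lens_of cfg a. min k x) = (\<Sum>i=1..k. col (lens_of cfg a) i)"
    by (simp only: sum_col_min)
  ultimately show ?thesis
    unfolding Epart_def arr_def by (cases "a = 0"; cases "a \<le> n") simp_all
qed

lemma vacn_arr: "vacn n mu0 (lens_of cfg) a k = (\<Sum>i=1..k. parr n mu0 cfg (a - 1) i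
   - 2 * parr n mu0 cfg a i + parr n mu0 cfg (a + 1) i)"
  unfolding vacn_def Epart_arr by (simp add: sum.distrib sum_subtractf sum_distrib_left)

text \<open>The invariant carried through the KKR steps. Nonnegativity of the riggings enters
  separately, through \<open>tau_pos_vacuum\<close>.\<close>

definition upper_rc :: "nat \<Rightarrow> nat list \<Rightarrow> rcfg \<Rightarrow> bool" where
  "upper_rc n mu0 cfg \<longleftrightarrow> (\<forall>a. a \<notin> {1..n} \<longrightarrow> cfg a = {#}) \<and>
     (\<forall>a\<in>{1..n}. \<forall>x\<in>#cfg a. 1 \<le> fst x \<and> 0 \<le> corig n mu0 cfg a x)"

lemma sum_mset_ge_0:
  fixes f :: "'a \<Rightarrow> int"
  assumes "\<And>x. x \<in># A \<Longrightarrow> 0 \<le> f x"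
  shows "0 \<le> (\<Sum>x\<in>#A. f x)"
  using assms by (induction A) auto

lemma sum_diff_mset:
  fixes f g :: "'a \<Rightarrow> int"
  shows "(\<Sum>x\<in>#A. f x - g x) = (\<Sum>x\<in>#A. f x) - (\<Sum>x\<in>#A. g x)"
  by (induction A) auto

lemma subconf_mem: "subconf n nu cfg \<Longrightarrow> a \<in> {1..n} \<Longrightarrow> x \<in># nu a \<Longrightarrow> x \<in># cfg a"
  unfolding subconf_def by (meson mset_subset_eqD)

text \<open>Expanding around the full configuration turns the cross terms of \<open>w\<close> into
  vacancy numbers. Combined with the riggings that are no longer counted they become coriggings. The
  last sum does not depend on \<open>w\<close>.\<close>

lemma complement:
  assumes n: "1 \<le> n" and H: "rows_le n H cfg" and w: "subconf n w cfg"
    and cfg: "\<And>a. a \<notin> {1..n} \<Longrightarrow> cfg a = {#}"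
    and mu: "mset mu0 = mset kappa + mset eta"
  shows "subconf n (\<lambda>a. cfg a - w a) cfg"
    and "tau_val n kappa (\<lambda>a. cfg a - w a) d = tau_val n mu0 cfg d
      + (Obj n H 1 d (parr n eta w) - cost n (corig n mu0 cfg) w)
      - (\<Sum>i=1..H. col (mset eta) i * parr n mu0 cfg 1 i)"
proof -
  show s: "subconf n (\<lambda>a. cfg a - w a) cfg" using cfg by (auto simp: subconf_def)
  have sub: "w a \<subseteq># cfg a" if "a \<in> {1..n}" for a using w that unfolding subconf_def by blast
  define A where "A = parr n mu0 cfg"
  define y where "y = parr n eta w"
  have "parr n kappa (\<lambda>a. cfg a - w a) a i = A a i + - y a i" for a i
  proof -
    have "lens_of (\<lambda>a. cfg a - w a) a = lens_of cfg a - lens_of w a" if "a \<in> {1..n}"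
      using sub[OF that] by (simp add: lens_of_def image_mset_Diff)
    then show ?thesis
      using lens_of_subset[of w a cfg] sub[of a] by (auto simp: arr_def A_def y_def mu col_diff)
  qed
  then have "Obj n H (-1) d (parr n kappa (\<lambda>a. cfg a - w a)) = Obj n H (-1) d (\<lambda>a i. A a i + - y a i)"
    by (intro Obj_cong)
  also have "\<dots> = Obj n H (-1) d A + Obj n H (-1) d (\<lambda>a i. - y a i)
    + (\<Sum>a=1..n. \<Sum>i=1..H. - y a i * (A (a - 1) i + A (a + 1) i - 2 * A a i)) + (\<Sum>i=1..H. - y 0 i * A 1 i)"
    by (rule Obj_add) (use n in \<open>auto simp: A_def arr_def\<close>)
  also have "Obj n H (-1) d (\<lambda>a i. - y a i) = Obj n H 1 d y"
    unfolding Obj_def obj1_def by (intro sum.cong) auto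
  also have "(\<Sum>a=1..n. \<Sum>i=1..H. - y a i * (A (a - 1) i + A (a + 1) i - 2 * A a i)) =
     - (\<Sum>a=1..n. \<Sum>x\<in>#w a. vacn n mu0 (lens_of cfg) a (fst x))"
    unfolding sum_negf[symmetric]
  proof (intro sum.cong refl)
    fix a assume a: "a \<in> {1..n}"
    have "\<forall>x\<in>#w a. fst x \<le> H" using rows_le_subconf[OF w H] a unfolding rows_le_def by blast
    then have "(\<Sum>x\<in>#w a. vacn n mu0 (lens_of cfg) a (fst x)) =
      (\<Sum>i=1..H. col (image_mset fst (w a)) i * (A (a - 1) i - 2 * A a i + A (a + 1) i))"
      unfolding vacn_arr A_def by (rule sum_col_weight)
    then show "(\<Sum>i=1..H. - y a i * (A (a - 1) i + A (a + 1) i - 2 * A a i)) =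
      - (\<Sum>x\<in>#w a. vacn n mu0 (lens_of cfg) a (fst x))"
      using a by (simp add: y_def arr_def lens_of_def algebra_simps flip: sum_negf)
  qed
  finally have O: "Obj n H (-1) d (parr n kappa (\<lambda>a. cfg a - w a)) =
     Obj n H (-1) d A + Obj n H 1 d y - (\<Sum>a=1..n. \<Sum>x\<in>#w a. vacn n mu0 (lens_of cfg) a (fst x))
     - (\<Sum>i=1..H. y 0 i * A 1 i)"
    by (simp add: sum_negf)
  have c1: "cost n (\<lambda>_. snd) (\<lambda>a. cfg a - w a) = cost n (\<lambda>_. snd) cfg - cost n (\<lambda>_. snd) w"
    unfolding cost_def sum_subtractf[symmetric]
  proof (intro sum.cong refl)
    fix a assume "a \<in> {1..n}"
    then have "cfg a = w a + (cfg a - w a)" using sub by simp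
    then have "(\<Sum>x\<in>#cfg a. snd x) = (\<Sum>x\<in>#w a. snd x) + (\<Sum>x\<in>#cfg a - w a. snd x)"
      by (metis image_mset_union sum_mset.union)
    then show "(\<Sum>x\<in>#cfg a - w a. snd x) = (\<Sum>x\<in>#cfg a. snd x) - (\<Sum>x\<in>#w a. snd x)" by simp
  qed
  have c2: "cost n (corig n mu0 cfg) w = (\<Sum>a=1..n. \<Sum>x\<in>#w a. vacn n mu0 (lens_of cfg) a (fst x)) - cost n (\<lambda>_. snd) w"
    unfolding cost_def corig_def sum_subtractf[symmetric]
  proof (intro sum.cong refl)
    fix a
    show "(\<Sum>x\<in>#w a. vacn n mu0 (lens_of cfg) a (fst x) - snd x) =
      (\<Sum>x\<in>#w a. vacn n mu0 (lens_of cfg) a (fst x)) - (\<Sum>x\<in>#w a. snd x)"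
      by (rule sum_diff_mset)
  qed
  show "tau_val n kappa (\<lambda>a. cfg a - w a) d = tau_val n mu0 cfg d
      + (Obj n H 1 d (parr n eta w) - cost n (corig n mu0 cfg) w)
      - (\<Sum>i=1..H. col (mset eta) i * parr n mu0 cfg 1 i)"
    unfolding tau_val_Obj[OF n rows_le_subconf[OF s H]] tau_val_Obj[OF n H] c1 c2 O A_def[symmetric] y_def[symmetric]
    by (simp add: y_def[symmetric]) (simp add: y_def arr_def)
qed

lemma complement_ex:
  assumes "subconf n nu cfg" and "\<And>a. a \<notin> {1..n} \<Longrightarrow> cfg a = {#}"
  obtains w where "subconf n w cfg" and "nu = (\<lambda>a. cfg a - w a)"
proof
  show "subconf n (\<lambda>a. cfg a - nu a) cfg" using assms by (auto simp: subconf_def)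
  show "nu = (\<lambda>a. cfg a - (cfg a - nu a))"
  proof
    fix a
    show "nu a = cfg a - (cfg a - nu a)"
      using assms by (cases "a \<in> {1..n}") (auto simp: subconf_def subset_mset.diff_diff_right)
  qed
qed

text \<open>With no row of colour 0 left out, the complementary problem has zero boundary values, so
  removing rows can only lose: \<open>Obj_le_0\<close> and nonnegative coriggings.\<close>

lemma tau_pos_full:
  assumes n: "1 \<le> n" and u: "upper_rc n mu0 cfg"
  shows "tau_pos n cfg mu0 d = tau_val n mu0 cfg d"
proof -
  obtain H where H: "rows_le n H cfg" using ex_rows_le by blast
  have out: "\<And>a. a \<notin> {1..n} \<Longrightarrow> cfg a = {#}" using u by (auto simp: upper_rc_def)
  obtain nu where nu: "subconf n nu cfg" "tau_val n mu0 nu d = tau_pos n cfg mu0 d"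
    using tau_pos_attained by blast
  obtain w where w: "subconf n w cfg" "nu = (\<lambda>a. cfg a - w a)" using complement_ex[OF nu(1) out] by blast
  have "Obj n H 1 d (parr n [] w) \<le> 0"
    by (rule Obj_le_0) (auto simp: arr_def)
  moreover have "0 \<le> cost n (corig n mu0 cfg) w"
    unfolding cost_def
  proof (intro sum_nonneg sum_mset_ge_0)
    fix a x assume "a \<in> {1..n}" "x \<in># w a"
    then show "0 \<le> corig n mu0 cfg a x" using u subconf_mem[OF w(1)] unfolding upper_rc_def by blast
  qed
  ultimately have "tau_val n mu0 nu d \<le> tau_val n mu0 cfg d"
    using complement(2)[OF n H w(1) out, of mu0 mu0 "[]" d] w(2) by simp
  moreover have "tau_val n mu0 cfg d \<le> tau_pos n cfg mu0 d"
    by (rule tau_pos_ge) (use out in \<open>auto simp: subconf_def\<close>)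
  ultimately show ?thesis using nu(2) by simp
qed

lemma tau_pos_vacuum:
  assumes n: "1 \<le> n" and r: "\<And>a x. a \<in> {1..n} \<Longrightarrow> x \<in># cfg a \<Longrightarrow> 0 \<le> snd x"
  shows "tau_pos n cfg [] d = 0"
proof -
  obtain H where H: "rows_le n H cfg" using ex_rows_le by blast
  obtain nu where nu: "subconf n nu cfg" "tau_val n [] nu d = tau_pos n cfg [] d"
    using tau_pos_attained by blast
  have "0 \<le> cost n (\<lambda>_. snd) nu"
    unfolding cost_def
  proof (intro sum_nonneg sum_mset_ge_0)
    fix a x assume "a \<in> {1..n}" "x \<in># nu a"
    then show "0 \<le> snd x" using r subconf_mem[OF nu(1)] by blast
  qed
  moreover have "Obj n H (-1) d (parr n [] nu) \<le> 0"
    by (rule Obj_le_0) (auto simp: arr_def)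
  ultimately have "tau_val n [] nu d \<le> 0"
    unfolding tau_val_Obj[OF n rows_le_subconf[OF nu(1) H]] by simp
  moreover have "tau_val n [] (\<lambda>_. {#}) d \<le> tau_pos n cfg [] d"
    by (rule tau_pos_ge) (simp add: subconf_def)
  moreover have "tau_val n [] (\<lambda>_. {#}) d = 0" by (simp add: tau_val_def lens_of_def)
  ultimately show ?thesis using nu(2) by linarith
qed

section \<open>One box of the KKR algorithm\<close>

lemma select_nth:
  assumes "t < length (select v cfg c i thr)"
  shows "(select v cfg c i thr ! t, v (i + t) (select v cfg c i thr ! t)) \<in># cfg (i + t)
    \<and> (thr # select v cfg c i thr) ! t \<le> select v cfg c i thr ! t
    \<and> (\<forall>m. (m, v (i + t) m) \<in># cfg (i + t) \<longrightarrow> (thr # select v cfg c i thr) ! t \<le> m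
          \<longrightarrow> select v cfg c i thr ! t \<le> m)"
  using assms
proof (induction c arbitrary: i thr t)
  case 0
  then show ?case by simp
next
  case (Suc c)
  let ?S = "{m. (m, v i m) \<in># cfg i \<and> thr \<le> m}"
  have fin: "finite ?S"
    by (rule finite_subset[of _ "fst ` set_mset (cfg i)"]) (force, simp)
  have ne: "?S \<noteq> {}" using Suc.prems by (auto simp: Let_def split: if_splits)
  then have eq: "select v cfg (Suc c) i thr = Min ?S # select v cfg c (Suc i) (Min ?S)"
    by (simp add: Let_def)
  show ?case
  proof (cases t)
    case 0
    have "Min ?S \<in> ?S" using fin ne by (rule Min_in)
    then show ?thesis using fin unfolding eq 0 by (auto intro: Min_le)
  next
    case (Suc t')
    then have "t' < length (select v cfg c (Suc i) (Min ?S))" using Suc.prems unfolding eq by simp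
    from Suc.IH[OF this] show ?thesis unfolding eq Suc by simp
  qed
qed

lemma length_select: "length (select v cfg c i thr) \<le> c"
  by (induction c arbitrary: i thr) (auto simp: Let_def)

lemma select_stop:
  assumes "length (select v cfg c i thr) = t" and "t < c"
    and "(m, v (i + t) m) \<in># cfg (i + t)" and "(thr # select v cfg c i thr) ! t \<le> m"
  shows False
  using assms
proof (induction c arbitrary: i thr t)
  case 0
  then show ?case by simp
next
  case (Suc c)
  let ?S = "{m. (m, v i m) \<in># cfg i \<and> thr \<le> m}"
  show ?case
  proof (cases "?S = {}")
    case True
    then have "select v cfg (Suc c) i thr = []" by (simp add: Let_def)
    then show ?thesis using True Suc.prems by auto
  next
    case False
    then have eq: "select v cfg (Suc c) i thr = Min ?S # select v cfg c (Suc i) (Min ?S)"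
      by (simp add: Let_def)
    obtain t' where t': "t = Suc t'" using Suc.prems(1) unfolding eq by auto
    show ?thesis
      by (rule Suc.IH[of "Suc i" "Min ?S" t']) (use Suc.prems in \<open>unfold eq t', auto\<close>)
  qed
qed

lemma kkr_step_tau:
  fixes rest :: "nat list" and k :: nat
  defines "mu0 \<equiv> rest @ [Suc k]" and "mu0' \<equiv> if k = 0 then rest else rest @ [k]"
  assumes n: "1 \<le> n" and u: "upper_rc n mu0 cfg" and step: "kkr_step n mu0 mu0' cfg = (l, cfg1)"
  shows "upper_rc n mu0' cfg1" and "1 \<le> l" and "l \<le> n + 1"
    and "\<And>d. d \<in> {1..n} \<Longrightarrow> boxes cfg d = boxes cfg1 d + (if d < l then 1 else 0)"
    and "mset kappa \<subseteq># mset rest \<Longrightarrow>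
      \<exists>K. \<forall>d\<in>{1..n+1}. tau_pos n cfg kappa d = tau_pos n cfg1 kappa d + K"
proof -
  define v where "v = vacn n mu0 (lens_of cfg)"
  define cs where "cs = select v cfg n 1 (Suc k)"
  define m where "m a = (Suc k # cs) ! a" for a
  define j where "j = length cs + 1"
  define lens' where "lens' = (\<lambda>a. if 1 \<le> a \<and> a < j
    then lens_of cfg a - {#m a#} + (if 1 < m a then {#m a - 1#} else {#}) else lens_of cfg a)"
  define v' where "v' = vacn n mu0' lens'"
  define al where "al a = (m a, v a (m a))" for a
  define nw where "nw a = (m a - 1, v' a (m a - 1))" for a
  have out: "\<And>a. a \<notin> {1..n} \<Longrightarrow> cfg a = {#}" using u by (auto simp: upper_rc_def)
  have chosen: "(if 1 \<le> a \<and> a \<le> length cs then Some (cs ! (a - 1)) else None) =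
      (if 1 \<le> a \<and> a < j then Some (m a) else None)" for a
    by (cases a) (auto simp: m_def j_def)
  have l: "l = j" and cfg1: "cfg1 = (\<lambda>a. if 1 \<le> a \<and> a < j
      then cfg a - {#al a#} + (if 1 < m a then {#nw a#} else {#}) else cfg a)"
  proof -
    have lens: "(\<lambda>a. case (if 1 \<le> a \<and> a < j then Some (m a) else None) of None \<Rightarrow> lens_of cfg a
       | Some m \<Rightarrow> lens_of cfg a - {#m#} + (if 1 < m then {#m - 1#} else {#})) = lens'"
      by (auto simp: lens'_def fun_eq_iff)
    have "kkr_step n mu0 mu0' cfg = (j, \<lambda>a. case (if 1 \<le> a \<and> a < j then Some (m a) else None) of None \<Rightarrow> cfg a
       | Some m \<Rightarrow> cfg a - {#(m, v a m)#} + (if 1 < m then {#(m - 1, v' a (m - 1))#} else {#}))"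
      unfolding kkr_step_def Let_def v_def[symmetric]
      by (simp only: mu0_def last_snoc cs_def[symmetric] chosen lens v'_def[symmetric] flip: j_def)
    then show "l = j" "cfg1 = (\<lambda>a. if 1 \<le> a \<and> a < j
      then cfg a - {#al a#} + (if 1 < m a then {#nw a#} else {#}) else cfg a)"
      using step by (auto simp: fun_eq_iff al_def nw_def)
  qed
  have j: "1 \<le> j" "j \<le> n + 1" using length_select[of v cfg n 1 "Suc k"] by (auto simp: j_def cs_def)
  show "1 \<le> l" "l \<le> n + 1" using j l by auto
  have m0: "m 0 = Suc k" by (simp add: m_def)
  have sel: "al a \<in># cfg a" "m (a - 1) \<le> m a" "\<And>q. (q, v a q) \<in># cfg a \<Longrightarrow> m (a - 1) \<le> q \<Longrightarrow> m a \<le> q"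
    if "1 \<le> a" "a < j" for a
  proof -
    have "a - 1 < length (select v cfg n 1 (Suc k))" using that by (simp add: j_def cs_def)
    note f = select_nth[OF this]
    have a: "1 + (a - 1) = a" using that by simp
    have ma: "cs ! (a - 1) = m a" using that by (simp add: m_def nth_Cons')
    have f': "(m a, v a (m a)) \<in># cfg a \<and> m (a - 1) \<le> m a \<and> (\<forall>q. (q, v a q) \<in># cfg a \<longrightarrow> m (a - 1) \<le> q \<longrightarrow> m a \<le> q)"
      using f unfolding cs_def[symmetric] a ma m_def[symmetric] .
    show "al a \<in># cfg a" "m (a - 1) \<le> m a" "\<And>q. (q, v a q) \<in># cfg a \<Longrightarrow> m (a - 1) \<le> q \<Longrightarrow> m a \<le> q"
      using f' by (simp_all add: al_def)
  qed
  have stop: False if "j \<le> n" "(q, v j q) \<in># cfg j" "m (j - 1) \<le> q" for q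
    by (rule select_stop[of v cfg n 1 "Suc k" "j - 1" q]) (use that in \<open>auto simp: j_def m_def cs_def\<close>)
  have m_ge1: "1 \<le> m a" if "a < j" for a
    using that
  proof (induction a)
    case (Suc a)
    then show ?case using sel(2)[of "Suc a"] by simp
  qed (simp add: m0)
  have lens1: "lens_of cfg1 = lens'"
  proof
    fix a
    show "lens_of cfg1 a = lens' a"
    proof (cases "1 \<le> a \<and> a < j")
      case True
      then obtain R where "cfg a = add_mset (al a) R" using sel(1)[of a] by (meson multi_member_split)
      then show ?thesis using True by (simp add: lens_of_def cfg1 lens'_def al_def nw_def)
    qed (auto simp: lens_of_def cfg1 lens'_def)
  qed
  define e where e_loc: "e a i = (if a < j \<and> i = m a then 1 else 0 :: int)" for a i
  have arr1: "parr n mu0' cfg1 a i = parr n mu0 cfg a i - e a i" if i: "1 \<le> i" for a i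
  proof -
    consider "a = 0" | "1 \<le> a" "a < j" | "j \<le> a" "1 \<le> a" by linarith
    then show ?thesis
    proof cases
      case 1
      then show ?thesis using i j by (auto simp: arr_def e_loc mu0_def mu0'_def m0)
    next
      case 2
      then obtain R where R: "cfg a = add_mset (al a) R" using sel(1)[of a] by (meson multi_member_split)
      show ?thesis
        using 2 j i m_ge1[of a] by (auto simp: arr_def e_loc lens_of_def cfg1 R) (auto simp: al_def nw_def)
    next
      case 3
      then show ?thesis by (auto simp: arr_def e_loc lens_of_def cfg1)
    qed
  qed
  have v': "v' a q = v a q + (\<Sum>i=1..q. 2 * e a i - e (a - 1) i - e (a + 1) i)" for a q
  proof -
    have "v' a q = (\<Sum>i=1..q. parr n mu0 cfg (a - 1) i - 2 * parr n mu0 cfg a i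
        + parr n mu0 cfg (a + 1) i + (2 * e a i - e (a - 1) i - e (a + 1) i))"
      unfolding v'_def lens1[symmetric] vacn_arr
      by (intro sum.cong refl) (simp only: arr1 atLeastAtMost_iff, simp)
    then show ?thesis by (simp only: sum.distrib v_def vacn_arr)
  qed
  define c where "c = corig n mu0 cfg"
  define c1 where "c1 = corig n mu0' cfg1"
  have c: "c a x = v a (fst x) - snd x" for a x by (simp add: c_def corig_def v_def)
  have c1: "c1 a x = v' a (fst x) - snd x" for a x by (simp add: c1_def corig_def v'_def lens1)
  have c_nonneg: "0 \<le> c a x" if "x \<in># cfg a" for a x
    using u out[of a] that unfolding upper_rc_def c_def by fastforce
  have c_zero: "(fst x, v a (fst x)) \<in># cfg a" if "x \<in># cfg a" "c a x = 0" for a x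
    using that by (cases x) (auto simp: c)
  have c_pos: "1 \<le> c a x" if "1 \<le> a" "a < j" "x \<in># cfg a" "m (a - 1) \<le> fst x" "fst x < m a" for a x
  proof (rule ccontr)
    assume "\<not> 1 \<le> c a x"
    then have "c a x = 0" using c_nonneg[OF that(3)] by simp
    from sel(3)[OF that(1,2) c_zero[OF that(3) this] that(4)] that(5) show False by simp
  qed
  have c_pos_j: "1 \<le> c j x" if "j \<le> n" "x \<in># cfg j" "m (j - 1) \<le> fst x" for x
  proof (rule ccontr)
    assume "\<not> 1 \<le> c j x"
    then have "c j x = 0" using c_nonneg[OF that(2)] by simp
    from stop[OF that(1) c_zero[OF that(2) this] that(3)] show False .
  qed
  have c1_c: "c1 a x = c a x + (\<Sum>i=1..fst x. 2 * e a i - e (a - 1) i - e (a + 1) i)" for a x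
    by (simp add: c c1 v')
  have e_sum: "(\<Sum>i=1..q. e a i) = (if a < j \<and> m a \<le> q then 1 else 0)" for a q
    using m_ge1[of a] by (cases "a < j") (auto simp: e_loc)
  show "upper_rc n mu0' cfg1"
    unfolding upper_rc_def
  proof (intro conjI allI impI ballI)
    fix a assume "a \<notin> {1..n}"
    then show "cfg1 a = {#}" using out[of a] j by (auto simp: cfg1)
  next
    fix a x assume a: "a \<in> {1..n}" and x: "x \<in># cfg1 a"
    have "1 \<le> fst x \<and> 0 \<le> c1 a x"
    proof (cases "x \<in># cfg a")
      case True
      have "0 \<le> c1 a x"
      proof -
        have 0: "c1 a x = c a x + 2 * (if a < j \<and> m a \<le> fst x then 1 else 0)
          - (if a - 1 < j \<and> m (a - 1) \<le> fst x then 1 else 0) - (if a + 1 < j \<and> m (a + 1) \<le> fst x then 1 else 0)"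
          unfolding c1_c sum_subtractf sum_distrib_left[symmetric] e_sum by simp
        \<comment> \<open>Losses occur only at lengths from \<open>m (a - 1)\<close> on. For
          \<open>a < j\<close> the rows there below \<open>m a\<close> were not singular, and from
          \<open>m a\<close> on the term 2 outweighs both losses. For \<open>a = j\<close> no
          singular row of length at least \<open>m (j - 1)\<close> exists.\<close>
        consider "a < j" | "a = j" | "j < a" by linarith
        then show ?thesis
        proof cases
          case 1
          then show ?thesis
            unfolding 0 using c_nonneg[OF True] c_pos[of a x] True a sel(2)[of a] sel(2)[of "a + 1"] by auto
        next
          case 2
          then show ?thesis
            unfolding 0 using c_nonneg[OF True] c_pos_j[of x] True a by auto
        next
          case 3
          then show ?thesis
            unfolding 0 using c_nonneg[OF True] by auto
        qed
      qed
      moreover have "1 \<le> fst x" using u True a unfolding upper_rc_def by blast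
      ultimately show ?thesis by simp
    next
      case False
      then have "x = nw a \<and> 1 < m a" using x by (auto simp: cfg1 split: if_splits dest: in_diffD)
      then show ?thesis by (auto simp: nw_def c1)
    qed
    then show "1 \<le> fst x" "0 \<le> corig n mu0' cfg1 a x" by (auto simp: c1_def)
  qed
  show boxes: "boxes cfg d = boxes cfg1 d + (if d < l then 1 else 0)" if d: "d \<in> {1..n}" for d
  proof (cases "d < j")
    case True
    then obtain R where R: "cfg d = add_mset (al d) R" using sel(1)[of d] d by (metis atLeastAtMost_iff multi_member_split)
    then show ?thesis using True d m_ge1[of d] by (auto simp: boxes_def cfg1 l) (auto simp: al_def nw_def of_nat_diff)
  next
    case False
    then show ?thesis by (simp add: boxes_def cfg1 l)
  qed
  assume kappa: "mset kappa \<subseteq># mset rest"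
  \<comment> \<open>\<open>eta\<close>, the complement of \<open>kappa\<close> among all rows,
    consists of \<open>theta\<close> and the processed row.\<close>
  obtain theta where theta: "mset theta = mset rest - mset kappa" using ex_mset by blast
  define eta where "eta = theta @ [Suc k]"
  define eta1 where "eta1 = (if k = 0 then theta else theta @ [k])"
  have eta: "mset mu0 = mset kappa + mset eta" using kappa theta by (simp add: eta_def mu0_def)
  have eta1: "mset mu0' = mset kappa + mset eta1" using kappa theta by (simp add: eta1_def mu0'_def)
  obtain H where H: "Suc k \<le> H" "rows_le n H cfg" using ex_rows_le by blast
  have H1: "rows_le n H cfg1"
    using H(2) sel(1) unfolding rows_le_def
  proof (intro ballI)
    fix a x assume *: "\<forall>a\<in>{1..n}. \<forall>x\<in>#cfg a. fst x \<le> H" "a \<in> {1..n}" "x \<in># cfg1 a"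
    show "fst x \<le> H"
    proof (cases "x \<in># cfg a")
      case False
      then have "x = nw a" "a < j" using *(3) by (auto simp: cfg1 split: if_splits dest: in_diffD)
      moreover have "fst (al a) \<le> H" using * sel(1)[of a] \<open>a < j\<close> by auto
      ultimately show ?thesis by (simp add: nw_def al_def)
    qed (use * in blast)
  qed
  have out1: "\<And>a. a \<notin> {1..n} \<Longrightarrow> cfg1 a = {#}" using \<open>upper_rc n mu0' cfg1\<close> by (auto simp: upper_rc_def)
  have move: "kkr_move n H j m cfg cfg1 c c1 al nw (col (mset eta))"
  proof
    show "1 \<le> n" "1 \<le> j" "j \<le> n + 1" "1 \<le> m 0" "m 0 \<le> H" "rows_le n H cfg"
      using n j m0 H by auto
    show "m (a - 1) \<le> m a" if "1 \<le> a" "a < j" for a using sel(2)[OF that] .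
    show "al a \<in># cfg a" "fst (al a) = m a" "c a (al a) = 0" if "1 \<le> a" "a < j" for a
      using sel(1)[OF that] by (auto simp: al_def c)
    show "0 \<le> c a x" if "x \<in># cfg a" for a x using c_nonneg[OF that] .
    show "1 \<le> c a x" if "1 \<le> a" "a < j" "x \<in># cfg a" "m (a - 1) \<le> fst x" "fst x < m a" for a x
      using c_pos[OF that] .
    show "cfg1 = (\<lambda>a. if 1 \<le> a \<and> a < j then cfg a - {#al a#} + (if 1 < m a then {#nw a#} else {#}) else cfg a)"
      by (rule cfg1)
    show "fst (nw a) = m a - 1" for a by (simp add: nw_def)
    show "c1 a (nw a) = 0" for a by (simp add: nw_def c1)
    show "c1 a x = c a x + (\<Sum>i=1..fst x. 2 * (if a < j \<and> i = m a then 1 else 0)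
       - (if a - 1 < j \<and> i = m (a - 1) then 1 else 0) - (if a + 1 < j \<and> i = m (a + 1) then 1 else 0))" for a x
      using c1_c[of a x] by (simp add: e_loc)
    show "0 \<le> col (mset eta) i" for i by simp
    show "col (mset eta) i' \<le> col (mset eta) i" if "i \<le> i'" for i i' using that by (rule col_antimono)
    \<comment> \<open>This is where \<open>kappa\<close> has to avoid the processed row:
      \<open>eta\<close> contains that row, so its columns drop strictly above the length
      \<open>m 0\<close>.\<close>
    show "col (mset eta) i < col (mset eta) (m 0)" if "m 0 < i" for i
      using that col_antimono[of "Suc k" i "mset theta"] by (simp add: eta_def m0)
  qed
  define C where "C = (\<Sum>i=1..H. col (mset eta) i * parr n mu0 cfg 1 i)"
  define C1 where "C1 = (\<Sum>i=1..H. col (mset eta1) i * parr n mu0' cfg1 1 i)"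
  define g where "g = (if 1 < j then col (mset eta) (m 1) - e 0 (m 1) else 0)"
  have boxes_tau: "tau_val n mu0 cfg d = tau_val n mu0 cfg (n + 1) - (if d \<le> n then boxes cfg d else 0)"
      "tau_val n mu0' cfg1 d = tau_val n mu0' cfg1 (n + 1) - (if d \<le> n then boxes cfg1 d else 0)" if "1 \<le> d" for d
    using tau_val_boxes[of n _ _ d] that by simp_all
  define K where "K = tau_val n mu0 cfg (n + 1) - tau_val n mu0' cfg1 (n + 1) - C + C1 + g"
  have "tau_pos n cfg kappa d = tau_pos n cfg1 kappa d + K" if d: "d \<in> {1..n+1}" for d
  proof -
    \<comment> \<open>The interpretation brings its own facts named \<open>m0\<close> and
      \<open>j\<close>; the outer ones are kept under other names.\<close>
    note m0_eq = m0 and j_pos = j(1)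
    interpret kkr_move n H j d m cfg cfg1 c c1 al nw "col (mset eta)" by (rule move)
    have gain: "gain = g + (if d < j then 1 else 0)"
      using d by (simp add: gain_def z1_def e_def g_def e_loc)
    have z1: "z1 i = col (mset eta1) i" if "1 \<le> i" for i
      unfolding z1_def e_def using that j_pos m0_eq by (auto simp: eta_def eta1_def)
    have t: "tau_val n kappa (\<lambda>a. cfg a - w a) d = tau_val n mu0 cfg d + W w - C" if "subconf n w cfg" for w
      unfolding W_def unfolding C_def c_def by (rule complement(2)[OF n H(2) that _ eta]) (rule out)
    have W1: "W1 w = Obj n H 1 d (parr n eta1 w) - cost n c1 w" for w
      unfolding W1_def by (intro arg_cong2[where f = minus] Obj_cong refl) (use z1 in \<open>auto simp: arr_def\<close>)
    have t1: "tau_val n kappa (\<lambda>a. cfg1 a - w a) d = tau_val n mu0' cfg1 d + W1 w - C1" if "subconf n w cfg1" for w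
      unfolding W1 unfolding C1_def c1_def by (rule complement(2)[OF n H1 that _ eta1]) (rule out1)
    \<comment> \<open>The indicator of \<open>d < j\<close> in \<open>gain\<close> cancels the box
      lost by colour \<open>d\<close>; hence \<open>K\<close> is independent of
      \<open>d\<close>.\<close>
    have base: "tau_val n mu0 cfg d - C + gain = tau_val n mu0' cfg1 d - C1 + K"
    proof (cases "d \<le> n")
      case True
      then show ?thesis using boxes_tau[of d] boxes[of d] d l gain by (simp add: K_def)
    next
      case False
      then have "d = n + 1" using d by simp
      then show ?thesis using j gain by (simp add: K_def)
    qed
    show ?thesis
    proof (rule antisym)
      obtain nu where nu: "subconf n nu cfg" "tau_val n kappa nu d = tau_pos n cfg kappa d"
        using tau_pos_attained by blast
      obtain w where w: "subconf n w cfg" "nu = (\<lambda>a. cfg a - w a)" using complement_ex[OF nu(1) out] by blast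
      obtain w1 where w1: "subconf n w1 cfg1" "W w \<le> W1 w1 + gain" using W_le_W1[OF w(1)] by blast
      have "tau_val n kappa (\<lambda>a. cfg1 a - w1 a) d \<le> tau_pos n cfg1 kappa d"
        by (rule tau_pos_ge[OF complement(1)[OF n H1 w1(1) out1 eta1]])
      then show "tau_pos n cfg kappa d \<le> tau_pos n cfg1 kappa d + K"
        using nu(2) w1(2) base t[OF w(1)] t1[OF w1(1)] w(2) by simp
    next
      obtain nu where nu: "subconf n nu cfg1" "tau_val n kappa nu d = tau_pos n cfg1 kappa d"
        using tau_pos_attained by blast
      obtain w where w: "subconf n w cfg1" "nu = (\<lambda>a. cfg1 a - w a)" using complement_ex[OF nu(1) out1] by blast
      obtain w1 where w1: "subconf n w1 cfg" "W1 w + gain \<le> W w1" using W1_le_W[OF w(1)] by blast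
      have "tau_val n kappa (\<lambda>a. cfg a - w1 a) d \<le> tau_pos n cfg kappa d"
        by (rule tau_pos_ge[OF complement(1)[OF n H(2) w1(1) out eta]])
      then show "tau_pos n cfg1 kappa d + K \<le> tau_pos n cfg kappa d"
        using nu(2) w1(2) base t1[OF w(1)] t[OF w1(1)] w(2) by simp
    qed
  qed
  then show "\<exists>K. \<forall>d\<in>{1..n+1}. tau_pos n cfg kappa d = tau_pos n cfg1 kappa d + K" by blast
qed

section \<open>Processing a row, and all rows\<close>

definition above :: "nat \<Rightarrow> nat list \<Rightarrow> int" where
  "above d x = int (sum_list (drop d x))"

definition add_row :: "nat list \<Rightarrow> nat \<Rightarrow> nat list" where
  "add_row rest k = (if k = 0 then rest else rest @ [k])"

lemma kkr_steps_tau: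
  assumes n: "1 \<le> n" and "upper_rc n (add_row rest k) cfg" and "kkr_steps n rest k cfg = (cs, cfg2)"
  shows "upper_rc n rest cfg2 \<and> set cs \<subseteq> {1..n+1}
    \<and> (\<forall>d\<in>{1..n}. boxes cfg d = boxes cfg2 d + int (length (filter (\<lambda>c. d < c) cs)))
    \<and> (\<forall>kappa. mset kappa \<subseteq># mset rest \<longrightarrow>
        (\<exists>K. \<forall>d\<in>{1..n+1}. tau_pos n cfg kappa d = tau_pos n cfg2 kappa d + K))"
  using assms(2,3)
proof (induction k arbitrary: cfg cs)
  case 0
  then show ?case by (auto simp: add_row_def)
next
  case (Suc k)
  obtain l cfg1 where step: "kkr_step n (rest @ [Suc k]) (add_row rest k) cfg = (l, cfg1)" by force
  obtain cs' where steps: "kkr_steps n rest k cfg1 = (cs', cfg2)" and cs: "cs = l # cs'"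
    using Suc.prems(2) step by (auto simp: add_row_def split: prod.splits)
  have u: "upper_rc n (rest @ [Suc k]) cfg" using Suc.prems(1) by (simp add: add_row_def)
  note 1 = kkr_step_tau[OF n u step[unfolded add_row_def]]
  note 2 = Suc.IH[OF 1(1)[folded add_row_def] steps]
  show ?case
  proof (intro conjI ballI allI impI)
    show "upper_rc n rest cfg2" "set cs \<subseteq> {1..n+1}" using 1 2 by (auto simp: cs)
    show "boxes cfg d = boxes cfg2 d + int (length (filter (\<lambda>c. d < c) cs))" if "d \<in> {1..n}" for d
      using 1(4)[OF that] 2 that by (simp add: cs)
    fix kappa assume k: "mset kappa \<subseteq># mset rest"
    obtain K1 K2 where "\<forall>d\<in>{1..n+1}. tau_pos n cfg kappa d = tau_pos n cfg1 kappa d + K1"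
      "\<forall>d\<in>{1..n+1}. tau_pos n cfg1 kappa d = tau_pos n cfg2 kappa d + K2"
      using 1(5)[OF k] 2 k by blast
    then have "\<forall>d\<in>{1..n+1}. tau_pos n cfg kappa d = tau_pos n cfg2 kappa d + (K1 + K2)" by simp
    then show "\<exists>K. \<forall>d\<in>{1..n+1}. tau_pos n cfg kappa d = tau_pos n cfg2 kappa d + K" by blast
  qed
qed

lemma above_count:
  assumes "set cs \<subseteq> {1..n+1}"
  shows "above d (map (count_list cs) [1..<n+2]) = int (length (filter (\<lambda>c. d < c) cs))"
proof -
  have "drop d (map (count_list cs) [1..<n+2]) = map (count_list cs) [d+1..<n+2]"
    by (simp only: drop_map drop_upt add.commute[of d])
  moreover have "sum_list (map (count_list cs) [d+1..<n+2]) = length (filter (\<lambda>c. d < c) cs)"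
    using assms
  proof (induction cs)
    case Nil
    then show ?case by (simp add: sum_list_0)
  next
    case (Cons c cs)
    have "sum_list (map (count_list (c # cs)) [d+1..<n+2]) =
        sum_list (map (count_list cs) [d+1..<n+2]) + sum_list (map (\<lambda>j. if j = c then 1 else 0) [d+1..<n+2])"
      unfolding sum_list_addf[symmetric] by (intro arg_cong[where f = sum_list] map_cong) auto
    also have "sum_list (map (\<lambda>j. if j = c then 1 else 0) [d+1..<n+2]) = (if d < c then 1 else 0 :: nat)"
      unfolding interv_sum_list_conv_sum_set_nat using Cons.prems by auto
    finally show ?case using Cons by simp
  qed
  ultimately show ?thesis by (simp add: above_def)
qed

lemma tau_pos_full_boxes:
  assumes "1 \<le> n" and "upper_rc n mu0 cfg" and "1 \<le> d"
  shows "tau_pos n cfg mu0 d = tau_val n mu0 cfg (n + 1) - (if d \<le> n then boxes cfg d else 0)"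
  unfolding tau_pos_full[OF assms(1,2)] using assms(3) by (subst tau_val_boxes) simp

lemma length_kkr_rev: "x \<in> set (kkr_rev n rr cfg) \<Longrightarrow> length x = n + 1"
  by (induction rr arbitrary: cfg) (auto split: prod.splits)

text \<open>Each prefix is settled at the moment when its last row is about to be processed:
  \<open>kappa\<close> then consists of all remaining rows and \<open>tau_pos_full\<close> applies,
  while the boxes removed before that only shift all \<open>d\<close> equally. The function
  \<open>w\<close> stands for the boxes left over at the end.\<close>

lemma kkr_rev_tau:
  assumes n: "1 \<le> n" and "upper_rc n (rev rr) cfg" and "\<forall>l\<in>set rr. 1 \<le> l"
  shows "length (kkr_rev n rr cfg) = length rr \<and> (\<exists>w.
    (\<forall>d\<in>{1..n}. boxes cfg d = w d + (\<Sum>x\<leftarrow>kkr_rev n rr cfg. above d x)) \<and>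
    (\<forall>k\<le>length rr. \<exists>K. \<forall>d\<in>{1..n+1}. tau_pos n cfg (take k (rev rr)) d =
       K - (if d \<le> n then w d else 0) - (\<Sum>x\<leftarrow>take k (kkr_rev n rr cfg). above d x)))"
  using assms(2,3)
proof (induction rr arbitrary: cfg)
  case Nil
  have "\<forall>d\<in>{1..n+1}. tau_pos n cfg [] d = tau_val n [] cfg (n + 1) - (if d \<le> n then boxes cfg d else 0) - 0"
    using tau_pos_full_boxes[OF n, of "[]" cfg] Nil by simp
  then show ?case by (auto intro!: exI[of _ "boxes cfg"])
next
  case (Cons l rr)
  obtain cs cfg1 where st: "kkr_steps n (rev rr) l cfg = (cs, cfg1)" by force
  have u: "upper_rc n (add_row (rev rr) l) cfg" using Cons.prems by (simp add: add_row_def)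
  note s = kkr_steps_tau[OF n u st]
  define p where "p = kkr_rev n rr cfg1"
  define x where "x = map (count_list cs) [1..<n+2]"
  have eq: "kkr_rev n (l # rr) cfg = p @ [x]" by (simp add: st p_def x_def)
  obtain w where len: "length p = length rr" and w: "\<And>d. d \<in> {1..n} \<Longrightarrow> boxes cfg1 d = w d + (\<Sum>x\<leftarrow>p. above d x)"
    and IH: "\<And>k. k \<le> length rr \<Longrightarrow> \<exists>K. \<forall>d\<in>{1..n+1}. tau_pos n cfg1 (take k (rev rr)) d =
       K - (if d \<le> n then w d else 0) - (\<Sum>x\<leftarrow>take k p. above d x)"
    using Cons.IH[of cfg1] s Cons.prems unfolding p_def by auto
  have x: "above d x = int (length (filter (\<lambda>c. d < c) cs))" for d
    using s above_count[of cs n d] by (simp add: x_def)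
  have boxes: "boxes cfg d = w d + (\<Sum>x\<leftarrow>p @ [x]. above d x)" if "d \<in> {1..n}" for d
    using s w[OF that] that x[of d] by simp
  show ?case
    unfolding eq
  proof (intro conjI exI[of _ w] ballI allI impI boxes)
    show "length (p @ [x]) = length (l # rr)" by (simp add: len)
    fix k assume k: "k \<le> length (l # rr)"
    show "\<exists>K. \<forall>d\<in>{1..n+1}. tau_pos n cfg (take k (rev (l # rr))) d =
      K - (if d \<le> n then w d else 0) - (\<Sum>x\<leftarrow>take k (p @ [x]). above d x)"
    proof (cases "k \<le> length rr")
      case True
      have "mset (take k (rev rr)) \<subseteq># mset (rev rr)"
        by (metis append_take_drop_id mset_append mset_subset_eq_add_left)
      then obtain K1 where K1: "\<forall>d\<in>{1..n+1}. tau_pos n cfg (take k (rev rr)) d = tau_pos n cfg1 (take k (rev rr)) d + K1"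
        using s by blast
      obtain K2 where K2: "\<forall>d\<in>{1..n+1}. tau_pos n cfg1 (take k (rev rr)) d =
         K2 - (if d \<le> n then w d else 0) - (\<Sum>x\<leftarrow>take k p. above d x)"
        using IH[OF True] by blast
      show ?thesis
        by (rule exI[of _ "K1 + K2"]) (use K1 K2 True len in simp)
    next
      case False
      then have k: "k = Suc (length rr)" using k by simp
      have top: "above (n + 1) y = 0" if "y \<in> set (p @ [x])" for y
      proof -
        have "length y = n + 1" using that unfolding eq[symmetric] by (rule length_kkr_rev)
        then show ?thesis by (simp add: above_def)
      qed
      have "tau_pos n cfg (rev (l # rr)) d = tau_val n (rev (l # rr)) cfg (n + 1)
         - (if d \<le> n then w d else 0) - (\<Sum>x\<leftarrow>p @ [x]. above d x)" if "d \<in> {1..n+1}" for d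
      proof (cases "d \<le> n")
        case True
        then show ?thesis
          using tau_pos_full_boxes[OF n Cons.prems(1), of d] boxes[of d] that by simp
      next
        case False
        then have d: "d = n + 1" using that by simp
        have "(\<Sum>x\<leftarrow>p @ [x]. above d x) = (\<Sum>x\<leftarrow>p @ [x]. 0)"
          unfolding d using top by (intro arg_cong[where f = sum_list] map_cong) auto
        then show ?thesis using tau_pos_full_boxes[OF n Cons.prems(1), of d] d by simp
      qed
      then show ?thesis using k len by (intro exI[of _ "tau_val n (rev (l # rr)) cfg (n + 1)"]) simp
    qed
  qed
qed

lemma kkr_tau:
  assumes n: "1 \<le> n" and rc: "is_rc n mu0 cfg"
  shows "length (kkr n mu0 cfg) = length mu0"
    and "k \<le> length mu0 \<Longrightarrow> \<exists>K. \<forall>d\<in>{1..n+1}. tau_pos n cfg (take k mu0) d =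
      K - (\<Sum>x\<leftarrow>take k (kkr n mu0 cfg). above d x)"
proof -
  have u: "upper_rc n (rev (rev mu0)) cfg"
    unfolding upper_rc_def corig_def
  proof (intro conjI allI impI ballI)
    fix a assume "a \<notin> {1..n}"
    then have "a = 0 \<or> n < a" by auto
    then show "cfg a = {#}" using rc unfolding is_rc_def by blast
  qed (use rc in \<open>auto simp: is_rc_def case_prod_beta\<close>)
  have pos: "\<forall>l\<in>set (rev mu0). 1 \<le> l" using rc by (simp add: is_rc_def)
  have rig: "0 \<le> snd x" if "a \<in> {1..n}" "x \<in># cfg a" for a x
    using rc that unfolding is_rc_def by (auto simp: case_prod_beta dest: bspec)
  note main = kkr_rev_tau[OF n u pos]
  show "length (kkr n mu0 cfg) = length mu0" using main by (simp add: kkr_def)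
  obtain w where w: "\<And>k. k \<le> length mu0 \<Longrightarrow> \<exists>K. \<forall>d\<in>{1..n+1}. tau_pos n cfg (take k mu0) d =
       K - (if d \<le> n then w d else 0) - (\<Sum>x\<leftarrow>take k (kkr n mu0 cfg). above d x)"
    using main by (auto simp: kkr_def)
  obtain K0 where K0: "\<forall>d\<in>{1..n+1}. tau_pos n cfg (take 0 mu0) d = K0 - (if d \<le> n then w d else 0)"
    using w[of 0] by auto
  \<comment> \<open>Comparison with the empty prefix: index \<open>n + 1\<close> gives
    \<open>K0 = 0\<close>, and then the other indices give \<open>w d = 0\<close>, so no boxes are
    left over.\<close>
  have vac: "tau_pos n cfg [] d = 0" for d by (rule tau_pos_vacuum[OF n rig])
  have "K0 = 0" using K0 vac by (auto dest: bspec[of _ _ "n + 1"])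
  then have w0: "w d = 0" if "d \<in> {1..n}" for d
    using K0 vac that by (auto dest: bspec[of _ _ d])
  show "\<exists>K. \<forall>d\<in>{1..n+1}. tau_pos n cfg (take k mu0) d =
      K - (\<Sum>x\<leftarrow>take k (kkr n mu0 cfg). above d x)" if k: "k \<le> length mu0"
  proof -
    obtain K where K: "\<forall>d\<in>{1..n+1}. tau_pos n cfg (take k mu0) d =
       K - (if d \<le> n then w d else 0) - (\<Sum>x\<leftarrow>take k (kkr n mu0 cfg). above d x)"
      using w[OF k] by blast
    have "\<forall>d\<in>{1..n+1}. tau_pos n cfg (take k mu0) d = K - (\<Sum>x\<leftarrow>take k (kkr n mu0 cfg). above d x)"
      using K w0 by auto
    then show ?thesis by blast
  qed
qed

section \<open>Unrestricted rigged configurations\<close>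

lemma subset_union_split:
  assumes "X \<subseteq># P + Q"
  obtains P' Q' where "X = P' + Q'" and "P' \<subseteq># P" and "Q' \<subseteq># Q"
proof
  show "X = (X \<inter># P) + (X - P)" by (metis diff_intersect_left_idem subset_mset.add_diff_inverse subset_mset.inf_le1)
  show "X \<inter># P \<subseteq># P" by simp
  show "X - P \<subseteq># Q" using assms by (simp add: subset_eq_diff_conv add.commute)
qed

lemma subset_image_inv:
  assumes "P \<subseteq># image_mset f A" and "\<And>x. g (f x) = x"
  obtains B where "B \<subseteq># A" and "P = image_mset f B"
proof
  have "image_mset g P \<subseteq># image_mset g (image_mset f A)" using assms(1) by (rule image_mset_subseteq_mono)
  then show "image_mset g P \<subseteq># A" using assms(2) by (simp add: multiset.map_comp comp_def)
  have "x \<in> range f" if "x \<in># P" for x using mset_subset_eqD[OF assms(1) that] by auto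
  then have "f (g x) = x" if "x \<in># P" for x using that assms(2) by fastforce
  then have "image_mset f (image_mset g P) = image_mset (\<lambda>x. x) P"
    unfolding multiset.map_comp by (intro image_mset_cong) simp
  then show "P = image_mset f (image_mset g P)" by simp
qed

text \<open>The number \<open>s a\<close> of unit rows is a parameter because a sub-configuration
  may use only some of the \<open>Lsz n M a\<close> available ones.\<close>

definition add_vac :: "nat \<Rightarrow> (nat \<Rightarrow> nat) \<Rightarrow> (nat \<Rightarrow> nat) \<Rightarrow> rcfg \<Rightarrow> rcfg" where
  "add_vac n M s rc = (\<lambda>a. if 1 \<le> a \<and> a \<le> n
     then image_mset (\<lambda>(m, r). (m, r + int (M a))) (rc a) + replicate_mset (s a) (1, 0) else {#})"

lemma Lsz_sum: "a \<le> n \<Longrightarrow> int (Lsz n M a) = (\<Sum>b=1..n. (if a < b then int (b - a) else 0) * int (M b))"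
proof -
  have "{a+1..n} = {b\<in>{1..n}. a < b}" by auto
  then have "Lsz n M a = (\<Sum>b=1..n. if a < b then (b - a) * M b else 0)"
    unfolding Lsz_def by (simp only: sum.inter_filter finite_atLeastAtMost)
  also have "int \<dots> = (\<Sum>b=1..n. (if a < b then int (b - a) else 0) * int (M b))"
    unfolding of_nat_sum by (intro sum.cong) auto
  finally show ?thesis .
qed

lemma Lsz_top: "n \<le> a \<Longrightarrow> Lsz n M a = 0"
  by (simp add: Lsz_def)

text \<open>As a function of \<open>a\<close>, the positive part of \<open>b - a\<close> has second
  difference 1 at \<open>a = b\<close> and 0 elsewhere, so \<open>Lsz\<close> inverts the second
  difference.\<close>

lemma Lsz_second_difference:
  assumes "1 \<le> a" "a \<le> n"
  shows "int (Lsz n M (a - 1)) + int (Lsz n M (a + 1)) - 2 * int (Lsz n M a) = int (M a)"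
proof -
  have top: "int (Lsz n M (a + 1)) = (\<Sum>b=1..n. (if a + 1 < b then int (b - (a + 1)) else 0) * int (M b))"
  proof (cases "a + 1 \<le> n")
    case False
    then have "(\<Sum>b=1..n. (if a + 1 < b then int (b - (a + 1)) else 0) * int (M b)) = (\<Sum>b=1..n. 0)"
      by (intro sum.cong) auto
    then show ?thesis using False by (simp add: Lsz_top)
  qed (rule Lsz_sum)
  have "int (Lsz n M (a - 1)) + int (Lsz n M (a + 1)) - 2 * int (Lsz n M a) =
    (\<Sum>b=1..n. (if a - 1 < b then int (b - (a - 1)) else 0) * int (M b)
      + (if a + 1 < b then int (b - (a + 1)) else 0) * int (M b)
      - 2 * ((if a < b then int (b - a) else 0) * int (M b)))"
    unfolding top sum_subtractf sum.distrib sum_distrib_left[symmetric]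
    using assms Lsz_sum[of "a - 1" n M] Lsz_sum[of a n M] by simp
  also have "\<dots> = (\<Sum>b=1..n. if b = a then int (M b) else 0)"
  proof (intro sum.cong refl)
    fix b
    consider "b < a" | "b = a" | "a < b" by linarith
    then show "(if a - 1 < b then int (b - (a - 1)) else 0) * int (M b)
      + (if a + 1 < b then int (b - (a + 1)) else 0) * int (M b)
      - 2 * ((if a < b then int (b - a) else 0) * int (M b)) = (if b = a then int (M b) else 0)"
    proof cases
      case 3
      then have "(if a - 1 < b then int (b - (a - 1)) else 0) = int b - int a + 1"
        "(if a < b then int (b - a) else 0) = int b - int a"
        "(if a + 1 < b then int (b - (a + 1)) else 0) = int b - int a - 1" "b \<noteq> a"
        using assms by (auto simp: of_nat_diff)
      then show ?thesis by (simp only: if_False) (simp add: left_diff_distrib distrib_right)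
    qed (use assms in auto)
  qed
  also have "\<dots> = int (M a)" using assms by simp
  finally show ?thesis .
qed

text \<open>Unit rows live on level 1, so \<open>obj1_add\<close> on that level describes their
  effect. The raise by \<open>M a\<close> is charged once per row, and \<open>y a\<close> counts the
  rows because each has length at least 1.\<close>

lemma tau_val_add_vac:
  fixes kappa :: "nat list" and N n :: nat and s M :: "nat \<Rightarrow> nat"
  assumes n: "1 \<le> n" and ge1: "\<And>a x. a \<in> {1..n} \<Longrightarrow> x \<in># nu a \<Longrightarrow> 1 \<le> fst x"
  defines "y \<equiv> \<lambda>a. parr n kappa nu a 1"
  defines "S \<equiv> \<lambda>a. if a = 0 then int N else if a \<le> n then int (s a) else 0"
  shows "tau_val n (replicate N 1 @ kappa) (add_vac n M s nu) d = tau_val n kappa nu d + obj1 n (-1) d S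
    + (\<Sum>a=1..n. S a * (y (a - 1) + y (a + 1) - 2 * y a)) + S 0 * y 1 - (\<Sum>a=1..n. int (M a) * y a)"
proof -
  define x where "x = parr n kappa nu"
  have y: "y a = x a 1" for a by (simp add: y_def x_def)
  obtain H where H: "1 \<le> H" "rows_le n H nu" using ex_rows_le by blast
  have H': "rows_le n H (add_vac n M s nu)"
    unfolding rows_le_def
  proof (intro ballI)
    fix a x assume "a \<in> {1..n}" "x \<in># add_vac n M s nu a"
    then have "(\<exists>x'\<in>#nu a. fst x = fst x') \<or> fst x = 1"
      by (force simp: add_vac_def split: if_splits)
    then show "fst x \<le> H" using H \<open>a \<in> {1..n}\<close> unfolding rows_le_def by metis
  qed
  define w where "w a i = (if i = 1 then S a else 0)" for a i :: nat
  have lens: "lens_of (add_vac n M s nu) a = lens_of nu a + replicate_mset (s a) 1" if "a \<in> {1..n}" for a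
    using that by (simp add: lens_of_def add_vac_def multiset.map_comp comp_def case_prod_beta)
  have col_rep: "col (replicate_mset q 1) i = (if i = 1 then int q else 0)" if "1 \<le> i" for q i
    using that by (induction q) auto
  have "parr n (replicate N 1 @ kappa) (add_vac n M s nu) a i = x a i + w a i"
    if "1 \<le> i" for a i
    using that lens[of a] by (auto simp: x_def arr_def w_def S_def col_rep[unfolded One_nat_def])
  then have "Obj n H (-1) d (parr n (replicate N 1 @ kappa) (add_vac n M s nu)) =
     Obj n H (-1) d (\<lambda>a i. x a i + w a i)"
    by (intro Obj_cong) simp
  also have "\<dots> = Obj n H (-1) d (x) + Obj n H (-1) d w
    + (\<Sum>a=1..n. \<Sum>i=1..H. w a i * (x (a - 1) i + x (a + 1) i - 2 * x a i))
    + (\<Sum>i=1..H. w 0 i * x 1 i)"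
    by (rule Obj_add) (use n in \<open>auto simp: x_def arr_def\<close>)
  also have "Obj n H (-1) d w = obj1 n (-1) d S"
  proof -
    have "obj1 n (-1) d (\<lambda>a. w a i) = (if i = 1 then obj1 n (-1) d S else 0)" for i
    proof (cases "i = 1")
      case False
      then have "(\<lambda>a. w a i) = (\<lambda>_. 0)" by (simp add: w_def)
      then show ?thesis using False by (simp add: obj1_def)
    qed (simp add: w_def)
    then show ?thesis using H by (simp add: Obj_def)
  qed
  also have "(\<Sum>a=1..n. \<Sum>i=1..H. w a i * (x (a - 1) i + x (a + 1) i - 2 * x a i))
    = (\<Sum>a=1..n. S a * (y (a - 1) + y (a + 1) - 2 * y a))"
  proof (intro sum.cong refl)
    fix a
    have "(\<Sum>i=1..H. w a i * f i) = S a * f 1" for f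
    proof -
      have "(\<Sum>i=1..H. w a i * f i) = (\<Sum>i=1..H. if i = 1 then S a * f i else 0)"
        by (intro sum.cong) (auto simp: w_def)
      then show ?thesis using H by simp
    qed
    then show "(\<Sum>i=1..H. w a i * (x (a - 1) i + x (a + 1) i - 2 * x a i))
      = S a * (y (a - 1) + y (a + 1) - 2 * y a)"
      by (simp add: y)
  qed
  also have "(\<Sum>i=1..H. w 0 i * x 1 i) = S 0 * y 1"
  proof -
    have "(\<Sum>i=1..H. w 0 i * x 1 i) = (\<Sum>i=1..H. if i = 1 then S 0 * y 1 else 0)"
      by (intro sum.cong) (auto simp: w_def y)
    then show ?thesis using H by simp
  qed
  finally have O: "Obj n H (-1) d (parr n (replicate N 1 @ kappa) (add_vac n M s nu)) =
    Obj n H (-1) d (x) + obj1 n (-1) d S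
    + (\<Sum>a=1..n. S a * (y (a - 1) + y (a + 1) - 2 * y a)) + S 0 * y 1" .
  have c: "cost n (\<lambda>_. snd) (add_vac n M s nu) = cost n (\<lambda>_. snd) nu + (\<Sum>a=1..n. int (M a) * y a)"
    unfolding cost_def sum.distrib[symmetric]
  proof (intro sum.cong refl)
    fix a assume a: "a \<in> {1..n}"
    have "(\<Sum>x\<in>#A. snd x + int (M a)) = (\<Sum>x\<in>#A. snd x) + int (M a) * int (size A)" for A :: "(nat \<times> int) multiset"
      by (induction A) (auto simp: algebra_simps)
    moreover have "y a = int (size (nu a))"
    proof -
      have "filter_mset (\<lambda>x. 1 \<le> x) (lens_of nu a) = lens_of nu a"
        using ge1[OF a] by (intro filter_mset_eq_conv[THEN iffD2]) (auto simp: lens_of_def)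
      then show ?thesis using a by (simp add: y_def arr_def col_def) (simp add: lens_of_def)
    qed
    ultimately show "(\<Sum>x\<in>#add_vac n M s nu a. snd x) = (\<Sum>x\<in>#nu a. snd x) + int (M a) * y a"
      using a by (simp add: add_vac_def multiset.map_comp comp_def case_prod_beta)
  qed
  show ?thesis
    unfolding tau_val_Obj[OF n H(2)] tau_val_Obj[OF n H'] O c x_def by simp
qed

lemma subconf_add_vac:
  assumes w: "subconf n w (add_vac n M s rc)"
  obtains nu s' where "subconf n nu rc" and "\<And>a. s' a \<le> s a" and "w = add_vac n M s' nu"
proof -
  let ?f = "\<lambda>a (m, r). (m :: nat, r + int (M a))"
  have ex: "\<exists>A q. A \<subseteq># rc a \<and> q \<le> s a \<and> w a = image_mset (?f a) A + replicate_mset q (1, 0)"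
    if a: "a \<in> {1..n}" for a
  proof -
    have "w a \<subseteq># image_mset (?f a) (rc a) + replicate_mset (s a) (1, 0)"
      using w a unfolding subconf_def add_vac_def by (auto dest: bspec[of _ _ a])
    then obtain P Q where PQ: "w a = P + Q" "P \<subseteq># image_mset (?f a) (rc a)" "Q \<subseteq># replicate_mset (s a) (1, 0)"
      by (rule subset_union_split)
    obtain A where "A \<subseteq># rc a" "P = image_mset (?f a) A"
      by (rule subset_image_inv[OF PQ(2), where g = "\<lambda>(m, r). (m, r - int (M a))"]) auto
    moreover obtain q where "q \<le> s a" "Q = replicate_mset q (1, 0)"
      using PQ(3) by (rule msubseteq_replicate_msetE)
    ultimately show ?thesis using PQ(1) by blast
  qed
  then obtain A q where Aq: "\<And>a. a \<in> {1..n} \<Longrightarrow> A a \<subseteq># rc a \<and> q a \<le> s a \<and>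
     w a = image_mset (?f a) (A a) + replicate_mset (q a) (1, 0)"
    by metis
  show thesis
  proof (rule that[of "\<lambda>a. if a \<in> {1..n} then A a else {#}" "\<lambda>a. if a \<in> {1..n} then q a else 0"])
    show "subconf n (\<lambda>a. if a \<in> {1..n} then A a else {#}) rc" using Aq by (auto simp: subconf_def)
    show "(if a \<in> {1..n} then q a else 0) \<le> s a" for a using Aq[of a] by auto
    show "w = add_vac n M (\<lambda>a. if a \<in> {1..n} then q a else 0) (\<lambda>a. if a \<in> {1..n} then A a else {#})"
    proof
      fix a
      show "w a = add_vac n M (\<lambda>a. if a \<in> {1..n} then q a else 0) (\<lambda>a. if a \<in> {1..n} then A a else {#}) a"
        using Aq[of a] w by (cases "a \<in> {1..n}") (auto simp: add_vac_def subconf_def)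
    qed
  qed
qed

lemma add_vac_subconf:
  assumes "subconf n nu rc"
  shows "subconf n (add_vac n M s nu) (add_vac n M s rc)"
  using assms unfolding subconf_def add_vac_def
  by (auto intro: image_mset_subseteq_mono)

text \<open>When all unit rows are used, summation by parts turns their cross terms into the charge
  for the raised riggings, and the two cancel. Leaving out \<open>t a\<close> of them loses
  \<open>t a * M a\<close> and regains at most \<open>2 * t a * y a\<close>, so the bound on
  \<open>M\<close> makes using all of them optimal.\<close>

lemma tau_pos_add_vac:
  fixes kappa :: "nat list"
  assumes n: "1 \<le> n" and ge1: "\<And>a x. a \<in> {1..n} \<Longrightarrow> x \<in># rc a \<Longrightarrow> 1 \<le> fst x"
    and M: "\<And>a. a \<in> {1..n} \<Longrightarrow> 2 * size (rc a) \<le> M a"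
  shows "\<exists>b. \<forall>d\<in>{1..n+1}. tau_pos n (add_vac n M (Lsz n M) rc) (replicate (Lsz n M 0) 1 @ kappa) d =
     tau_pos n rc kappa d - int (Lsz n M d) + b"
proof -
  define L where "L a = int (Lsz n M a)" for a
  define y where "y nu a = parr n kappa nu a 1" for nu a
  define b where "b = obj1 n 0 0 L + col (mset kappa) 1 * L 1"
  let ?k = "replicate (Lsz n M 0) 1 @ kappa"
  have Ltop: "L a = 0" if "n \<le> a" for a using that by (simp add: L_def Lsz_top)
  have dd: "L (a - 1) + L (a + 1) - 2 * L a = int (M a)" if "a \<in> {1..n}" for a
    using Lsz_second_difference[of a n M] that by (simp add: L_def)
  have ytop: "y nu (n + 1) = 0" for nu by (simp add: y_def arr_def)
  have ynn: "0 \<le> y nu a" for nu a by (simp add: y_def arr_def)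
  have parts: "(\<Sum>a=1..n. L a * (y nu (a - 1) + y nu (a + 1) - 2 * y nu a)) + L 0 * y nu 1
     = (\<Sum>a=1..n. int (M a) * y nu a) + col (mset kappa) 1 * L 1" for nu
  proof -
    \<comment> \<open>Expanding the same quadratic form in both orders moves the second difference
      from \<open>y nu\<close> to \<open>L\<close>.\<close>
    have "obj1 n 0 0 (\<lambda>a. y nu a + L a) = obj1 n 0 0 (\<lambda>a. L a + y nu a)" by (simp add: add.commute)
    then have "(\<Sum>a=1..n. L a * (y nu (a - 1) + y nu (a + 1) - 2 * y nu a)) + L 0 * y nu 1
      = (\<Sum>a=1..n. y nu a * (L (a - 1) + L (a + 1) - 2 * L a)) + y nu 0 * L 1"
      using obj1_add[of n "y nu" 0 0 L] obj1_add[of n L 0 0 "y nu"] n ytop Ltop by simp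
    also have "(\<Sum>a=1..n. y nu a * (L (a - 1) + L (a + 1) - 2 * L a)) = (\<Sum>a=1..n. int (M a) * y nu a)"
      by (intro sum.cong refl) (simp only: dd, simp)
    finally show ?thesis by (simp add: y_def arr_def)
  qed
  have objL: "obj1 n (-1) d L = obj1 n 0 0 L - L d" if "d \<in> {1..n+1}" for d
  proof -
    have "obj1 n (-1) d L = (\<Sum>a=1..n. L (a - 1) * L a - L a * L a) - (\<Sum>a=1..n. if a = d then L a else 0)"
      unfolding obj1_def sum_subtractf[symmetric] by (intro sum.cong) auto
    also have "(\<Sum>a=1..n. if a = d then L a else 0) = L d" using that Ltop[of d] by auto
    finally show ?thesis by (simp add: obj1_def)
  qed
  have fullS: "(if a = 0 then int (Lsz n M 0) else if a \<le> n then int (Lsz n M a) else 0) = L a" for a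
    by (simp add: L_def Lsz_top)
  have full: "tau_val n ?k (add_vac n M (Lsz n M) nu) d = tau_val n kappa nu d - L d + b"
    if nu: "subconf n nu rc" and d: "d \<in> {1..n+1}" for nu d
  proof -
    have "1 \<le> fst x" if "a \<in> {1..n}" "x \<in># nu a" for a x
      using ge1 subconf_mem[OF nu] that by blast
    from tau_val_add_vac[OF n this, where N = "Lsz n M 0" and kappa = kappa and M = M and s = "Lsz n M" and d = d]
    show ?thesis
      unfolding fullS y_def[symmetric] using parts[of nu] objL[OF d] by (simp add: b_def)
  qed
  have bound: "tau_val n ?k (add_vac n M s nu) d \<le> tau_val n kappa nu d - L d + b"
    if nu: "subconf n nu rc" and d: "d \<in> {1..n+1}" and s: "\<And>a. s a \<le> Lsz n M a" for nu d s
  proof -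
    define S where "S a = (if a = 0 then int (Lsz n M 0) else if a \<le> n then int (s a) else 0)" for a
    define t where "t a = L a - S a" for a
    have tnn: "0 \<le> t a" for a using s[of a] by (auto simp: t_def S_def L_def)
    have t0: "t 0 = 0" by (simp add: t_def S_def L_def)
    have ttop: "t (n + 1) = 0" by (simp add: t_def S_def Ltop)
    have S: "S = (\<lambda>a. L a + - t a)" by (simp add: t_def)
    have g: "1 \<le> fst x" if "a \<in> {1..n}" "x \<in># nu a" for a x
      using ge1 subconf_mem[OF nu] that by blast
    have "obj1 n (-1) d S = obj1 n (-1) d L + obj1 n (-1) d (\<lambda>a. - t a)
      + (\<Sum>a=1..n. - t a * (L (a - 1) + L (a + 1) - 2 * L a)) + - t 0 * L 1"
      unfolding S by (rule obj1_add) (use n Ltop in auto)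
    also have "(\<Sum>a=1..n. - t a * (L (a - 1) + L (a + 1) - 2 * L a)) = - (\<Sum>a=1..n. t a * int (M a))"
      unfolding sum_negf[symmetric] by (intro sum.cong refl) (simp only: dd mult_minus_left)
    also have "obj1 n (-1) d (\<lambda>a. - t a) = obj1 n 1 d t"
      unfolding obj1_def by (intro sum.cong) auto
    finally have o: "obj1 n (-1) d S \<le> obj1 n (-1) d L - (\<Sum>a=1..n. t a * int (M a))"
      using obj1_le_0[of t n 1 d] t0 ttop by simp
    have "(\<Sum>a=1..n. S a * (y nu (a - 1) + y nu (a + 1) - 2 * y nu a)) =
      (\<Sum>a=1..n. L a * (y nu (a - 1) + y nu (a + 1) - 2 * y nu a))
       - (\<Sum>a=1..n. t a * (y nu (a - 1) + y nu (a + 1) - 2 * y nu a))"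
      unfolding sum_subtractf[symmetric] by (intro sum.cong refl) (simp add: S algebra_simps)
    moreover have "(\<Sum>a=1..n. - (t a * int (M a))) \<le> (\<Sum>a=1..n. t a * (y nu (a - 1) + y nu (a + 1) - 2 * y nu a))"
    proof (rule sum_mono)
      fix a assume a: "a \<in> {1..n}"
      have "y nu a \<le> int (size (rc a))"
      proof -
        have "y nu a \<le> int (size (nu a))"
          using a by (simp add: y_def arr_def col_def lens_of_def) (metis size_filter_mset_lesseq size_image_mset)
        moreover have "size (nu a) \<le> size (rc a)" using nu a unfolding subconf_def by (auto intro: size_mset_mono)
        ultimately show ?thesis by linarith
      qed
      moreover have "2 * int (size (rc a)) \<le> int (M a)" using M[OF a] by linarith
      ultimately have "- int (M a) \<le> y nu (a - 1) + y nu (a + 1) - 2 * y nu a"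
        using ynn[of nu "a - 1"] ynn[of nu "a + 1"] by linarith
      from mult_left_mono[OF this tnn[of a]]
      show "- (t a * int (M a)) \<le> t a * (y nu (a - 1) + y nu (a + 1) - 2 * y nu a)" by simp
    qed
    moreover have "S 0 = L 0" by (simp add: S_def L_def)
    moreover note tau_val_add_vac[OF n g, where N = "Lsz n M 0" and kappa = kappa and M = M and s = s and d = d, folded y_def S_def]
    ultimately show ?thesis
      using o parts[of nu] objL[OF d] by (simp add: b_def sum_negf)
  qed
  have "tau_pos n (add_vac n M (Lsz n M) rc) ?k d = tau_pos n rc kappa d - L d + b" if d: "d \<in> {1..n+1}" for d
  proof (rule antisym)
    obtain w where w: "subconf n w (add_vac n M (Lsz n M) rc)" "tau_val n ?k w d = tau_pos n (add_vac n M (Lsz n M) rc) ?k d"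
      using tau_pos_attained by blast
    obtain nu s where "subconf n nu rc" "\<And>a. s a \<le> Lsz n M a" "w = add_vac n M s nu"
      using subconf_add_vac[OF w(1)] by blast
    with bound[OF this(1) d this(2)] w(2) tau_pos_ge[OF this(1), of kappa d]
    show "tau_pos n (add_vac n M (Lsz n M) rc) ?k d \<le> tau_pos n rc kappa d - L d + b" by simp
  next
    obtain nu where nu: "subconf n nu rc" "tau_val n kappa nu d = tau_pos n rc kappa d"
      using tau_pos_attained by blast
    show "tau_pos n rc kappa d - L d + b \<le> tau_pos n (add_vac n M (Lsz n M) rc) ?k d"
      using full[OF nu(1) d] nu(2) tau_pos_ge[OF add_vac_subconf[OF nu(1), where M = M and s = "Lsz n M"], where kappa = ?k and d = d] by simp
  qed
  then show ?thesis unfolding L_def by blast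
qed

section \<open>Letters of the vacuum path\<close>

lemma above_letter:
  assumes "a \<in> {1..n+1}"
  shows "above d (letter n a) = (if d < a then 1 else 0)"
proof -
  have "n + 1 = (a - 1) + Suc (n + 1 - a)" using assms by auto
  then have "replicate (n + 1) (0 :: nat) = replicate (a - 1) 0 @ 0 # replicate (n + 1 - a) 0"
    by (metis replicate_add replicate_Suc)
  then have "letter n a = replicate (a - 1) 0 @ 1 # replicate (n + 1 - a) 0"
    unfolding letter_def by (metis length_replicate list_update_length)
  then show ?thesis
    using assms by (cases "d < a") (auto simp: above_def not_less sum_list_replicate Suc_diff_le)
qed

text \<open>A block of letters from 1 to b has b - d letters above d (none if b is smaller). The
  total matches the term subtracted in \<open>tau_pos_add_vac\<close>, so the vacuum drops out in
  \<open>urc_tau\<close>.\<close>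

lemma above_pvac: "(\<Sum>x\<leftarrow>pvac n M. above d x) = int (Lsz n M d)"
proof -
  have tau_elt: "(\<Sum>x\<leftarrow>concat (replicate q xs). f x) = int q * (\<Sum>x\<leftarrow>xs. f x)" for q xs and f :: "nat list \<Rightarrow> int"
    by (induction q) (auto simp: algebra_simps)
  have block: "(\<Sum>x\<leftarrow>map (letter n) [1..<b+1]. above d x) = int (b - d)" if "b \<le> n" for b
    using that
  proof (induction b)
    case (Suc b)
    then show ?case using above_letter[of "Suc b" n d] by (auto simp: of_nat_diff)
  qed simp
  have "(\<Sum>x\<leftarrow>pvac n M. above d x) = (\<Sum>b\<leftarrow>rev [1..<n+1]. int (M b) * (\<Sum>x\<leftarrow>map (letter n) [1..<b+1]. above d x))"
  proof -
    have "(\<Sum>x\<leftarrow>concat (map g bs). f x) = (\<Sum>b\<leftarrow>bs. \<Sum>x\<leftarrow>g b. f x)"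
      for g :: "nat \<Rightarrow> nat list list" and f :: "nat list \<Rightarrow> int" and bs
      by (induction bs) auto
    then show ?thesis unfolding pvac_def by (simp only: tau_elt)
  qed
  also have "\<dots> = (\<Sum>b\<leftarrow>rev [1..<n+1]. int (M b) * int (b - d))"
    by (intro arg_cong[where f = sum_list] map_cong refl) (simp only: set_rev set_upt, subst block, auto)
  also have "\<dots> = (\<Sum>b\<in>{1..n}. int (M b) * int (b - d))"
    by (simp add: rev_map[symmetric] interv_sum_list_conv_sum_set_nat atLeastLessThanSuc_atLeastAtMost del: upt_Suc)
  also have "\<dots> = (\<Sum>b\<in>{d+1..n}. int (M b) * int (b - d))"
    by (intro sum.mono_neutral_right) auto
  finally show ?thesis by (simp add: Lsz_def mult.commute)
qed

theorem urc_tau: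
  assumes n: "1 \<le> n" and urc: "urc n p rc"
  shows "a \<in> {1..n} \<Longrightarrow> x \<in># rc a \<Longrightarrow> 1 \<le> fst x"
    and "k \<le> length p \<Longrightarrow> \<exists>K. \<forall>d\<in>{1..n+1}. tau_pos n rc (take k (map sum_list p)) d = K - (\<Sum>x\<leftarrow>take k p. above d x)"
proof -
  obtain B where B: "\<And>M. (\<forall>a\<in>{1..n}. B \<le> M a) \<Longrightarrow>
     is_rc n (replicate (Lsz n M 0) 1 @ map sum_list p) (add_vac n M (Lsz n M) rc) \<and>
     kkr n (replicate (Lsz n M 0) 1 @ map sum_list p) (add_vac n M (Lsz n M) rc) = pvac n M @ p"
    using urc unfolding urc_def Let_def add_vac_def by blast
  \<comment> \<open>\<open>B\<close> makes the defining property of \<open>urc\<close> available;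
    the second summand meets the bound of \<open>tau_pos_add_vac\<close>.\<close>
  define M where "M = (\<lambda>a. B + 2 * size (rc a))"
  let ?big = "add_vac n M (Lsz n M) rc"
  let ?mu = "replicate (Lsz n M 0) 1 @ map sum_list p"
  have isrc: "is_rc n ?mu ?big" and kkr: "kkr n ?mu ?big = pvac n M @ p"
    using B[of M] by (auto simp: M_def)
  \<comment> \<open>The output has one factor per row, so the unit rows account exactly for the
    vacuum path.\<close>
  have "length (pvac n M @ p) = length ?mu"
    using kkr_tau(1)[OF n isrc] kkr by simp
  then have len: "length (pvac n M) = Lsz n M 0" by simp
  show ge1: "1 \<le> fst x" if "a \<in> {1..n}" "x \<in># rc a" for a x
  proof -
    have "(fst x, snd x + int (M a)) \<in># ?big a" using that by (auto simp: add_vac_def intro!: image_eqI[of _ _ x] split: prod.splits)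
    then show ?thesis using isrc that(1) unfolding is_rc_def by fastforce
  qed
  assume k: "k \<le> length p"
  obtain K where K: "\<forall>d\<in>{1..n+1}. tau_pos n ?big (take (Lsz n M 0 + k) ?mu) d =
      K - (\<Sum>x\<leftarrow>take (Lsz n M 0 + k) (kkr n ?mu ?big). above d x)"
    using kkr_tau(2)[OF n isrc, of "Lsz n M 0 + k"] k by auto
  have "\<exists>b. \<forall>d\<in>{1..n+1}. tau_pos n ?big (replicate (Lsz n M 0) 1 @ take k (map sum_list p)) d =
     tau_pos n rc (take k (map sum_list p)) d - int (Lsz n M d) + b"
    by (rule tau_pos_add_vac[OF n]) (use ge1 in \<open>auto simp: M_def\<close>)
  then obtain b where b: "\<forall>d\<in>{1..n+1}. tau_pos n ?big (replicate (Lsz n M 0) 1 @ take k (map sum_list p)) d =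
     tau_pos n rc (take k (map sum_list p)) d - int (Lsz n M d) + b" ..
  have "\<forall>d\<in>{1..n+1}. tau_pos n rc (take k (map sum_list p)) d = (K - b) - (\<Sum>x\<leftarrow>take k p. above d x)"
  proof
    fix d assume d: "d \<in> {1..n+1}"
    show "tau_pos n rc (take k (map sum_list p)) d = (K - b) - (\<Sum>x\<leftarrow>take k p. above d x)"
      using bspec[OF K[unfolded kkr] d] bspec[OF b d] len above_pvac[where n = n and M = M and d = d] by simp
  qed
  then show "\<exists>K. \<forall>d\<in>{1..n+1}. tau_pos n rc (take k (map sum_list p)) d = K - (\<Sum>x\<leftarrow>take k p. above d x)" by blast
qed

section \<open>The ultradiscrete Hirota equation\<close>

definition between0 :: "int \<Rightarrow> int \<Rightarrow> bool" where
  "between0 p q \<longleftrightarrow> (0 \<le> p \<and> p \<le> q) \<or> (q \<le> p \<and> p \<le> 0)"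

section \<open>Moving rows between two sub-configurations\<close>

lemma ex_submset_size:
  assumes "q \<le> size D"
  shows "\<exists>Z. Z \<subseteq># D \<and> size Z = q"
proof -
  obtain xs where xs: "mset xs = D" using ex_mset by blast
  have "mset (take q xs) \<subseteq># D"
    unfolding xs[symmetric] by (metis append_take_drop_id mset_append mset_subset_eq_add_left)
  moreover have "size (mset (take q xs)) = q" using assms by (simp add: xs[symmetric])
  ultimately show ?thesis by blast
qed

text \<open>The elements to be moved are taken from \<open>A1 - A2\<close>; adding those to
  \<open>A2\<close> cannot exceed the multiplicities in \<open>A1\<close>, hence not those in
  \<open>M\<close>.\<close>

lemma mset_transfer_aux:
  assumes A1: "A1 \<subseteq># M" and A2: "A2 \<subseteq># M" and q: "int q \<le> int (size A1) - int (size A2)"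
  shows "\<exists>A1' A2'. A1' \<subseteq># M \<and> A2' \<subseteq># M \<and> int (size A1') = int (size A1) - int q
     \<and> int (size A2') = int (size A2) + int q \<and> A1' + A2' = A1 + A2"
proof -
  have "size A1 \<le> size (A1 - A2) + size A2"
    by (metis size_union size_mset_mono subset_eq_diff_conv subset_mset.order_refl)
  then have "q \<le> size (A1 - A2)" using q by linarith
  then obtain Z where Z: "Z \<subseteq># A1 - A2" "size Z = q" using ex_submset_size by blast
  have ZA: "Z \<subseteq># A1" using Z(1) by (meson diff_subset_eq_self subset_mset.order_trans)
  have "A2 + Z \<subseteq># M"
  proof (rule mset_subset_eqI)
    fix x
    have "count Z x \<le> count A1 x - count A2 x" using Z(1) by (metis count_diff subseteq_mset_def)
    moreover have "count A1 x \<le> count M x" "count A2 x \<le> count M x"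
      using A1 A2 by (auto simp: subseteq_mset_def)
    ultimately show "count (A2 + Z) x \<le> count M x" by simp
  qed
  moreover have "A1 - Z \<subseteq># M" using A1 by (meson diff_subset_eq_self subset_mset.order_trans)
  moreover have "size (A1 - Z) = size A1 - q" "q \<le> size A1"
    using ZA Z(2) by (auto simp: size_Diff_submset size_mset_mono)
  moreover have "A1 - Z + (A2 + Z) = A1 + A2" using ZA by (simp add: subset_mset.diff_add_assoc2 add.commute add.left_commute)
  ultimately show ?thesis using Z(2) by (intro exI[of _ "A1 - Z"] exI[of _ "A2 + Z"]) auto
qed

lemma mset_transfer:
  assumes "A1 \<subseteq># M" and "A2 \<subseteq># M" and "between0 q (int (size A1) - int (size A2))"
  shows "\<exists>A1' A2'. A1' \<subseteq># M \<and> A2' \<subseteq># M \<and> int (size A1') = int (size A1) - q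
     \<and> int (size A2') = int (size A2) + q \<and> A1' + A2' = A1 + A2"
proof (cases "0 \<le> q \<and> q \<le> int (size A1) - int (size A2)")
  case True
  then show ?thesis
    using mset_transfer_aux[OF assms(1,2), of "nat q"] by auto
next
  case nonpos: False
  then have False: "q \<le> 0" "int (nat (- q)) \<le> int (size A2) - int (size A1)"
    using assms(3) by (auto simp: between0_def)
  from mset_transfer_aux[OF assms(2,1) False(2)] obtain A2' A1' where
    "A2' \<subseteq># M" "A1' \<subseteq># M" "int (size A2') = int (size A2) - int (nat (- q))"
    "int (size A1') = int (size A1) + int (nat (- q))" "A2' + A1' = A2 + A1" by blast
  then show ?thesis using False(1) by (intro exI[of _ A1'] exI[of _ A2']) (auto simp: add.commute)
qed

lemma col_sum: "finite I \<Longrightarrow> col (image_mset fst (\<Sum>k\<in>I. A k)) i = (\<Sum>k\<in>I. col (image_mset fst (A k)) i)"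
  by (induction I rule: finite_induct) auto

lemma sum_subseteq: "finite I \<Longrightarrow> (\<And>k. k \<in> I \<Longrightarrow> A k \<subseteq># B k) \<Longrightarrow> (\<Sum>k\<in>I. A k) \<subseteq># (\<Sum>k\<in>I. (B k :: 'a multiset))"
  by (induction I rule: finite_induct) (auto intro: subset_mset.add_mono)

lemma partition_length:
  fixes N :: "(nat \<times> 'b) multiset"
  assumes "\<And>x. x \<in># N \<Longrightarrow> 1 \<le> fst x \<and> fst x \<le> H"
  shows "N = (\<Sum>k=1..H. filter_mset (\<lambda>x. fst x = k) N)"
  using assms
proof (induction N)
  case (add x N)
  have "(\<Sum>k=1..H. filter_mset (\<lambda>y. fst y = k) (add_mset x N)) =
     (\<Sum>k=1..H. filter_mset (\<lambda>y. fst y = k) N + (if k = fst x then {#x#} else {#}))"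
    by (intro sum.cong) auto
  also have "\<dots> = N + (\<Sum>k=1..H. if k = fst x then {#x#} else {#})"
    using add by (simp add: sum.distrib)
  also have "(\<Sum>k=1..H. if k = fst x then {#x#} else {#}) = {#x#}"
    using add.prems[of x] by simp
  finally show ?case by simp
qed simp

lemma size_filter_length:
  "int (size (filter_mset (\<lambda>x. fst x = k) N)) = col (image_mset fst N) k - col (image_mset fst N) (k + 1)"
  by (induction N) auto

text \<open>Rows of each length are moved separately: \<open>s k - s (k + 1)\<close> rows of length
  k, which the hypothesis bounds by the surplus of such rows. The columns follow by telescoping from
  the top, and since rows keep their riggings, the total rigging is unchanged.\<close>

lemma rows_exchange:
  assumes N: "N1 \<subseteq># R" "N2 \<subseteq># R" and R: "\<And>x. x \<in># R \<Longrightarrow> 1 \<le> fst x \<and> fst x \<le> (H::nat)"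
    and q: "\<And>i. i \<in> {1..H} \<Longrightarrow> between0 (s i - s (i + 1))
      (col (image_mset fst N1) i - col (image_mset fst N2) i - (col (image_mset fst N1) (i + 1) - col (image_mset fst N2) (i + 1)))"
  shows "\<exists>N1' N2'. N1' \<subseteq># R \<and> N2' \<subseteq># R \<and>
     (\<forall>i\<in>{1..H}. col (image_mset fst N1') i = col (image_mset fst N1) i - (s i - s (H + 1))
       \<and> col (image_mset fst N2') i = col (image_mset fst N2) i + (s i - s (H + 1))) \<and>
     (\<Sum>x\<in>#N1'. snd x) + (\<Sum>x\<in>#N2'. snd x) = (\<Sum>x\<in>#N1. snd x) + (\<Sum>x\<in>#N2. (snd x :: int))"
proof -
  let ?f = "\<lambda>k. filter_mset (\<lambda>x. fst x = k)"
  have "\<exists>A1 A2. A1 \<subseteq># ?f k R \<and> A2 \<subseteq># ?f k R \<and> int (size A1) = int (size (?f k N1)) - (s k - s (k + 1))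
     \<and> int (size A2) = int (size (?f k N2)) + (s k - s (k + 1)) \<and> A1 + A2 = ?f k N1 + ?f k N2"
    if "k \<in> {1..H}" for k
  proof (rule mset_transfer)
    show "?f k N1 \<subseteq># ?f k R" "?f k N2 \<subseteq># ?f k R" using N by (auto intro: multiset_filter_mono)
    show "between0 (s k - s (k + 1)) (int (size (?f k N1)) - int (size (?f k N2)))"
      unfolding size_filter_length using q[OF that] by (simp add: algebra_simps)
  qed
  then obtain A1 A2 where A: "\<And>k. k \<in> {1..H} \<Longrightarrow> A1 k \<subseteq># ?f k R \<and> A2 k \<subseteq># ?f k R \<and>
     int (size (A1 k)) = int (size (?f k N1)) - (s k - s (k + 1))
     \<and> int (size (A2 k)) = int (size (?f k N2)) + (s k - s (k + 1)) \<and> A1 k + A2 k = ?f k N1 + ?f k N2"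
    by metis
  have colA: "col (image_mset fst A) i = (if i \<le> k then int (size A) else 0)" if "A \<subseteq># ?f k R" for A i k
    using that
  proof (induction A)
    case (add x A)
    have "x \<in># ?f k R" using add.prems by (meson mset_subset_eq_insertD)
    moreover have "A \<subseteq># ?f k R" using add.prems by (meson mset_subset_eq_insertD subset_mset.less_imp_le)
    ultimately show ?case using add.IH by auto
  qed simp
  have tele: "(\<Sum>k=1..H. if i \<le> k then g k - g (k + 1) else 0) = g i - (g (H + 1) :: int)" if "i \<in> {1..H}" for g i
  proof -
    have "(\<Sum>k=1..H. if i \<le> k then g k - g (k + 1) else 0) = (\<Sum>k=i..H. g k - g (k + 1))"
    proof -
      have "{k\<in>{1..H}. i \<le> k} = {i..H}" using that by auto
      then show ?thesis using sum.inter_filter[of "{1..H}" "\<lambda>k. g k - g (k + 1)" "\<lambda>k. i \<le> k"] by simp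
    qed
    also have "\<dots> = g i - g (H + 1)"
    proof -
      have "(\<Sum>k=i..<i+q. g k - g (k + 1)) = g i - g (i + q)" for q by (induction q) auto
      from this[of "H + 1 - i"] show ?thesis using that by (simp add: atLeastLessThanSuc_atLeastAtMost)
    qed
    finally show ?thesis .
  qed
  have top: "col (image_mset fst N) (H + 1) = 0" if "N \<subseteq># R" for N
    using R mset_subset_eqD[OF that] by (intro col_eq_0) fastforce
  have N1: "N1 = (\<Sum>k=1..H. ?f k N1)" and N2: "N2 = (\<Sum>k=1..H. ?f k N2)"
    by (rule partition_length; use R N in \<open>blast dest: mset_subset_eqD\<close>)+
  have R_eq: "(\<Sum>k=1..H. ?f k R) = R" by (rule partition_length[symmetric]) (use R in blast)
  define N1' where "N1' = (\<Sum>k=1..H. A1 k)"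
  define N2' where "N2' = (\<Sum>k=1..H. A2 k)"
  have "N1' \<subseteq># (\<Sum>k=1..H. ?f k R)" "N2' \<subseteq># (\<Sum>k=1..H. ?f k R)"
    unfolding N1'_def N2'_def by (rule sum_subseteq; use A in auto)+
  then have sub: "N1' \<subseteq># R" "N2' \<subseteq># R" by (simp_all only: R_eq)
  have c: "col (image_mset fst (\<Sum>k=1..H. A k)) i = col (image_mset fst N) i + t * (s i - s (H + 1))"
    if i: "i \<in> {1..H}" and A: "\<And>k. k \<in> {1..H} \<Longrightarrow> A k \<subseteq># ?f k R \<and> int (size (A k)) = int (size (?f k N)) + t * (s k - s (k + 1))"
      and N: "N \<subseteq># R" for A N t i
  proof -
    let ?g = "\<lambda>k. col (image_mset fst N) k + t * s k"
    have "col (image_mset fst (\<Sum>k=1..H. A k)) i = (\<Sum>k=1..H. if i \<le> k then int (size (A k)) else 0)"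
      unfolding col_sum[OF finite_atLeastAtMost] by (intro sum.cong refl colA) (use A in blast)
    also have "\<dots> = (\<Sum>k=1..H. if i \<le> k then ?g k - ?g (k + 1) else 0)"
      using A by (intro sum.cong) (auto simp: size_filter_length algebra_simps)
    also have "\<dots> = ?g i - ?g (H + 1)" by (rule tele[OF i])
    finally show ?thesis using top[OF N] by (simp add: algebra_simps)
  qed
  have c1: "col (image_mset fst N1') i = col (image_mset fst N1) i - (s i - s (H + 1))"
    and c2: "col (image_mset fst N2') i = col (image_mset fst N2) i + (s i - s (H + 1))" if "i \<in> {1..H}" for i
    unfolding N1'_def N2'_def using c[OF that, of A1 N1 "-1"] c[OF that, of A2 N2 1] A N by auto
  have "N1' + N2' = N1 + N2"
  proof -
    have "N1' + N2' = (\<Sum>k=1..H. A1 k + A2 k)" by (simp add: N1'_def N2'_def sum.distrib)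
    also have "\<dots> = (\<Sum>k=1..H. ?f k N1 + ?f k N2)" using A by (intro sum.cong) auto
    also have "\<dots> = N1 + N2" unfolding sum.distrib N1[symmetric] N2[symmetric] ..
    finally show ?thesis .
  qed
  then have "(\<Sum>x\<in>#N1'. snd x) + (\<Sum>x\<in>#N2'. snd x) = (\<Sum>x\<in>#N1. snd x) + (\<Sum>x\<in>#N2. snd x)"
    by (metis image_mset_union sum_mset.union)
  then show ?thesis using sub c1 c2 by blast
qed

section \<open>The energy as a sum of squares, and exchange of two optima\<close>

abbreviation colsq :: "nat list \<Rightarrow> nat \<Rightarrow> int" where
  "colsq k i \<equiv> col (mset k) i * col (mset k) i"

definition sub_val :: "nat \<Rightarrow> nat list \<Rightarrow> rcfg \<Rightarrow> nat \<Rightarrow> int" where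
  "sub_val n kappa nu d = (if d = 0 then tau_val n kappa nu (n + 1) - int (sum_list kappa) else tau_val n kappa nu d)"

lemma tau_ge: "subconf n nu rc \<Longrightarrow> sub_val n kappa nu d \<le> tau n rc kappa d"
  using tau_pos_ge by (simp add: sub_val_def tau_def)

lemma tau_attained: "\<exists>nu. subconf n nu rc \<and> sub_val n kappa nu d = tau n rc kappa d"
  using tau_pos_attained[of n rc kappa "if d = 0 then n + 1 else d"] by (auto simp: sub_val_def tau_def)

text \<open>
  Subtracting \<open>a - d\<close> (truncated) turns the term \<open>\<bar>\<nu>\<^sup>(\<^sup>d\<^sup>)\<bar>\<close> of \<open>\<tau>\<^sub>d\<close> into a change of the
  boundary values at \<open>a = n + 1\<close> and \<open>i = H + 1\<close>, so that all \<open>d\<close> share the same energy.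
\<close>

definition height :: "nat \<Rightarrow> nat \<Rightarrow> nat list \<Rightarrow> rcfg \<Rightarrow> nat \<Rightarrow> nat \<Rightarrow> int" where
  "height n d kappa nu a i = parr n kappa nu a i - int (a - d)"

text \<open>Every difference with \<open>d \<le> a\<close> grows by one, and the resulting cross
  terms telescope to \<open>2 * v d\<close>.\<close>

lemma sum_shifted_squares:
  fixes v :: "nat \<Rightarrow> int"
  assumes "v (n + 1) = 0" and d: "d \<le> n + 1"
  defines "w \<equiv> \<lambda>a. v a - int (a - d)"
  shows "(\<Sum>a\<le>n. (w a - w (a + 1)) * (w a - w (a + 1))) =
    (\<Sum>a\<le>n. (v a - v (a + 1)) * (v a - v (a + 1))) + 2 * v d + int (n + 1 - d)"
proof -
  have "(\<Sum>a\<le>n. (w a - w (a + 1)) * (w a - w (a + 1))) =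
    (\<Sum>a\<le>n. (v a - v (a + 1)) * (v a - v (a + 1)) + (if d \<le> a then 2 * (v a - v (a + 1)) + 1 else 0))"
  proof (intro sum.cong refl)
    fix a
    have e: "w a - w (a + 1) = v a - v (a + 1) + (if d \<le> a then 1 else 0)"
      by (auto simp: w_def of_nat_diff)
    then show "(w a - w (a + 1)) * (w a - w (a + 1)) =
      (v a - v (a + 1)) * (v a - v (a + 1)) + (if d \<le> a then 2 * (v a - v (a + 1)) + 1 else 0)"
      unfolding e by (simp add: algebra_simps)
  qed
  also have "\<dots> = (\<Sum>a\<le>n. (v a - v (a + 1)) * (v a - v (a + 1))) + (\<Sum>a=d..<n+1. 2 * (v a - v (a + 1)) + 1)"
  proof -
    have "{a\<in>{..n}. d \<le> a} = {d..<n+1}" by auto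
    then show ?thesis
      using sum.inter_filter[of "{..n}" "\<lambda>a. 2 * (v a - v (a + 1)) + 1" "\<lambda>a. d \<le> a"] by (simp add: sum.distrib)
  qed
  also have "(\<Sum>a=d..<n+1. 2 * (v a - v (a + 1)) + 1) = 2 * v d + int (n + 1 - d)"
  proof -
    have "(\<Sum>a=d..<d+k. 2 * (v a - v (a + 1)) + 1) = 2 * (v d - v (d + k)) + int k" for k
      by (induction k) (auto simp: algebra_simps)
    from this[of "n + 1 - d"] show ?thesis using d assms(1) by simp
  qed
  finally show ?thesis by simp
qed

lemma sub_val_squares:
  assumes n: "1 \<le> n" and d: "d \<le> n + 1" and H: "rows_le n H nu" "\<forall>x\<in>set kappa. x \<le> H"
  shows "2 * sub_val n kappa nu d = (\<Sum>i=1..H. colsq kappa i + int (n + 1 - d)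
     - (\<Sum>a\<le>n. (height n d kappa nu a i - height n d kappa nu (a + 1) i) * (height n d kappa nu a i - height n d kappa nu (a + 1) i)))
     - 2 * cost n (\<lambda>_. snd) nu"
proof -
  define v where "v i a = parr n kappa nu a i" for i a
  have vtop: "v i (n + 1) = 0" for i by (simp add: v_def arr_def)
  have v0: "v i 0 = col (mset kappa) i" for i by (simp add: v_def arr_def)
  define Q where "Q i = (\<Sum>a=1..n. v i (a - 1) * v i a - v i a * v i a)" for i
  have obj: "obj1 n (-1) d' (v i) = Q i - v i d'" if "1 \<le> d'" "d' \<le> n + 1" for d' i
  proof -
    have "obj1 n (-1) d' (v i) = Q i - (\<Sum>a=1..n. if a = d' then v i a else 0)"
      unfolding obj1_def Q_def sum_subtractf[symmetric] by (intro sum.cong) auto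
    also have "(\<Sum>a=1..n. if a = d' then v i a else 0) = v i d'"
    proof (cases "d' \<le> n")
      case False
      then have "d' = n + 1" using that by simp
      then show ?thesis using vtop[of i] by auto
    qed (use that in auto)
    finally show ?thesis .
  qed
  have "sub_val n kappa nu d = (\<Sum>i=1..H. Q i - v i d) - cost n (\<lambda>_. snd) nu"
  proof (cases "d = 0")
    case True
    have "int (sum_list kappa) = (\<Sum>i=1..H. v i 0)"
      unfolding v0 using sum_col[of "mset kappa" H] H(2) by (simp flip: sum_mset_sum_list)
    moreover have "tau_val n kappa nu (n + 1) = (\<Sum>i=1..H. Q i) - cost n (\<lambda>_. snd) nu"
      unfolding tau_val_Obj[OF n H(1)] Obj_def v_def[symmetric] using obj[of "n + 1"] vtop by simp
    ultimately show ?thesis using True by (simp add: sub_val_def sum_subtractf)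
  next
    case False
    then show ?thesis
      unfolding sub_val_def tau_val_Obj[OF n H(1)] Obj_def v_def[symmetric] using obj[of d] d by simp
  qed
  moreover have "2 * (Q i - v i d) = colsq kappa i + int (n + 1 - d)
     - (\<Sum>a\<le>n. (height n d kappa nu a i - height n d kappa nu (a + 1) i) * (height n d kappa nu a i - height n d kappa nu (a + 1) i))" for i
    using two_obj1[of "v i", OF vtop] sum_shifted_squares[of "v i" n d, OF vtop d]
    unfolding height_def v_def[symmetric] Q_def v0 by (simp add: algebra_simps)
  ultimately show ?thesis
    by (simp only: right_diff_distrib[of 2] sum_distrib_left)
qed

lemma between0_squares:
  assumes "between0 p (x - y)"
  shows "(x - p) * (x - p) + (y + p) * (y + p) \<le> x * x + y * (y :: int)"
proof -
  have "p * (p - (x - y)) \<le> 0" using assms by (auto simp: between0_def mult_le_0_iff)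
  then show ?thesis by (simp add: algebra_simps)
qed

text \<open>The surplus \<open>s\<close> is passed from the first height function to the second. In
  the colour direction the condition on \<open>s\<close> lowers the energy by convexity of the
  square, in the level direction it makes the exchange of rows possible. The boundary equations
  identify the lists and indices of the new pair.\<close>

lemma tau_exchange:
  assumes n: "1 \<le> n" and rc: "\<And>a x. a \<in> {1..n} \<Longrightarrow> x \<in># rc a \<Longrightarrow> 1 \<le> fst x \<and> fst x \<le> H"
    and nu: "subconf n nu1 rc" "subconf n nu2 rc"
    and d: "d1 \<le> n + 1" "d2 \<le> n + 1" "d1' \<le> n + 1" "d2' \<le> n + 1"
    and k: "\<forall>x\<in>set k1. x \<le> H" "\<forall>x\<in>set k2. x \<le> H" "\<forall>x\<in>set k1'. x \<le> H" "\<forall>x\<in>set k2'. x \<le> H"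
    and vert: "\<And>a i. a \<le> n \<Longrightarrow> i \<in> {1..H} \<Longrightarrow> between0 (s a i - s (a + 1) i)
       (height n d1 k1 nu1 a i - height n d2 k2 nu2 a i - (height n d1 k1 nu1 (a + 1) i - height n d2 k2 nu2 (a + 1) i))"
    and hor: "\<And>a i. a \<in> {1..n} \<Longrightarrow> i \<in> {1..H} \<Longrightarrow> between0 (s a i - s a (i + 1))
       (height n d1 k1 nu1 a i - height n d2 k2 nu2 a i - (height n d1 k1 nu1 a (i + 1) - height n d2 k2 nu2 a (i + 1)))"
    and left: "\<And>i. i \<in> {1..H} \<Longrightarrow> col (mset k1') i = col (mset k1) i - s 0 i \<and> col (mset k2') i = col (mset k2) i + s 0 i"
    and right: "\<And>i. i \<in> {1..H} \<Longrightarrow> int (n + 1 - d1') = int (n + 1 - d1) + s (n + 1) i \<and> int (n + 1 - d2') = int (n + 1 - d2) - s (n + 1) i"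
    and top: "\<And>a. a \<in> {1..n} \<Longrightarrow> int (a - d1') = int (a - d1) + s a (H + 1) \<and> int (a - d2') = int (a - d2) - s a (H + 1)"
  shows "2 * sub_val n k1 nu1 d1 + 2 * sub_val n k2 nu2 d2 + (\<Sum>i=1..H. colsq k1' i + colsq k2' i
      - colsq k1 i - colsq k2 i)
     \<le> 2 * tau n rc k1' d1' + 2 * tau n rc k2' d2'"
proof -
  define h1 where "h1 = height n d1 k1 nu1"
  define h2 where "h2 = height n d2 k2 nu2"
  note h_def = h1_def h2_def
  let ?l = "image_mset fst"
  have "\<exists>N1' N2'. N1' \<subseteq># rc a \<and> N2' \<subseteq># rc a \<and>
     (\<forall>i\<in>{1..H}. col (?l N1') i = col (?l (nu1 a)) i - (s a i - s a (H + 1))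
       \<and> col (?l N2') i = col (?l (nu2 a)) i + (s a i - s a (H + 1))) \<and>
     (\<Sum>x\<in>#N1'. snd x) + (\<Sum>x\<in>#N2'. snd x) = (\<Sum>x\<in>#nu1 a. snd x) + (\<Sum>x\<in>#nu2 a. snd x)"
    if a: "a \<in> {1..n}" for a
  proof (rule rows_exchange)
    show "nu1 a \<subseteq># rc a" "nu2 a \<subseteq># rc a" using nu a unfolding subconf_def by blast+
    show "1 \<le> fst x \<and> fst x \<le> H" if "x \<in># rc a" for x using rc[OF a that] .
    fix i assume i: "i \<in> {1..H}"
    show "between0 (s a i - s a (i + 1)) (col (?l (nu1 a)) i - col (?l (nu2 a)) i - (col (?l (nu1 a)) (i + 1) - col (?l (nu2 a)) (i + 1)))"
      using hor[OF a i] a by (simp add: height_def arr_def lens_of_def algebra_simps)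
  qed
  then obtain N1 N2 where N: "\<And>a. a \<in> {1..n} \<Longrightarrow> N1 a \<subseteq># rc a \<and> N2 a \<subseteq># rc a \<and>
     (\<forall>i\<in>{1..H}. col (?l (N1 a)) i = col (?l (nu1 a)) i - (s a i - s a (H + 1))
       \<and> col (?l (N2 a)) i = col (?l (nu2 a)) i + (s a i - s a (H + 1))) \<and>
     (\<Sum>x\<in>#N1 a. snd x) + (\<Sum>x\<in>#N2 a. snd x) = (\<Sum>x\<in>#nu1 a. snd x) + (\<Sum>x\<in>#nu2 a. snd x)"
    by metis
  define nu1' where "nu1' a = (if a \<in> {1..n} then N1 a else {#})" for a
  define nu2' where "nu2' a = (if a \<in> {1..n} then N2 a else {#})" for a
  define h1' where "h1' = height n d1' k1' nu1'"
  define h2' where "h2' = height n d2' k2' nu2'"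
  note h'_def = h_def h1'_def h2'_def
  have sub: "subconf n nu1' rc" "subconf n nu2' rc" using N by (auto simp: subconf_def nu1'_def nu2'_def)
  have rows: "rows_le n H rc" using rc unfolding rows_le_def by blast
  have h: "h1' a i = h1 a i - s a i" "h2' a i = h2 a i + s a i"
    if a: "a \<le> n + 1" and i: "i \<in> {1..H}" for a i
  proof -
    consider "a = 0" | "a \<in> {1..n}" | "a = n + 1" using a by fastforce
    then have "h1' a i = h1 a i - s a i \<and> h2' a i = h2 a i + s a i"
    proof cases
      case 1
      then show ?thesis using left[OF i] by (simp add: h'_def height_def arr_def)
    next
      case 2
      then show ?thesis using N[OF 2] top[OF 2] i by (simp add: h'_def height_def arr_def lens_of_def nu1'_def nu2'_def)
    next
      case 3
      then show ?thesis using right[OF i] by (simp add: h'_def height_def arr_def)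
    qed
    then show "h1' a i = h1 a i - s a i" "h2' a i = h2 a i + s a i" by auto
  qed
  have c: "cost n (\<lambda>_. snd) nu1' + cost n (\<lambda>_. snd) nu2' = cost n (\<lambda>_. snd) nu1 + cost n (\<lambda>_. snd) nu2"
    unfolding cost_def sum.distrib[symmetric] by (intro sum.cong) (use N in \<open>auto simp: nu1'_def nu2'_def\<close>)
  define sq where "sq f i = (\<Sum>a\<le>n. (f a i - f (a + 1) i) * (f a i - f (a + 1) i))" for f :: "nat \<Rightarrow> nat \<Rightarrow> int" and i
  have G: "sq h1' i + sq h2' i \<le> sq h1 i + sq h2 i" if i: "i \<in> {1..H}" for i
    unfolding sq_def sum.distrib[symmetric]
  proof (rule sum_mono)
    fix a assume "a \<in> {..n}"
    then have a: "a \<le> n" "a \<le> n + 1" "a + 1 \<le> n + 1" by auto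
    have 1: "h1' a i - h1' (a + 1) i = (h1 a i - h1 (a + 1) i) - (s a i - s (a + 1) i)"
      unfolding h(1)[OF a(2) i] h(1)[OF a(3) i] by simp
    have 2: "h2' a i - h2' (a + 1) i = (h2 a i - h2 (a + 1) i) + (s a i - s (a + 1) i)"
      unfolding h(2)[OF a(2) i] h(2)[OF a(3) i] by simp
    show "(h1' a i - h1' (a + 1) i) * (h1' a i - h1' (a + 1) i) + (h2' a i - h2' (a + 1) i) * (h2' a i - h2' (a + 1) i)
      \<le> (h1 a i - h1 (a + 1) i) * (h1 a i - h1 (a + 1) i) + (h2 a i - h2 (a + 1) i) * (h2 a i - h2 (a + 1) i)"
      unfolding 1 2 by (rule between0_squares) (use vert[OF a(1) i] in \<open>simp add: h_def algebra_simps\<close>)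
  qed
  have dd: "int (n + 1 - d1') + int (n + 1 - d2') = int (n + 1 - d1) + int (n + 1 - d2)" if "i \<in> {1..H}" for i
    using right[OF that] by simp
  have "2 * sub_val n k1 nu1 d1 + 2 * sub_val n k2 nu2 d2 + (\<Sum>i=1..H. colsq k1' i + colsq k2' i
      - colsq k1 i - colsq k2 i)
     = 2 * sub_val n k1' nu1' d1' + 2 * sub_val n k2' nu2' d2'
       - (\<Sum>i=1..H. sq h1 i + sq h2 i - sq h1' i - sq h2' i)"
  proof -
    define c2 where "c2 k i = colsq k i" for k i
    have t: "2 * sub_val n k1 nu1 d1 = (\<Sum>i=1..H. c2 k1 i + int (n + 1 - d1) - sq h1 i) - 2 * cost n (\<lambda>_. snd) nu1"
      "2 * sub_val n k2 nu2 d2 = (\<Sum>i=1..H. c2 k2 i + int (n + 1 - d2) - sq h2 i) - 2 * cost n (\<lambda>_. snd) nu2"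
      "2 * sub_val n k1' nu1' d1' = (\<Sum>i=1..H. c2 k1' i + int (n + 1 - d1') - sq h1' i) - 2 * cost n (\<lambda>_. snd) nu1'"
      "2 * sub_val n k2' nu2' d2' = (\<Sum>i=1..H. c2 k2' i + int (n + 1 - d2') - sq h2' i) - 2 * cost n (\<lambda>_. snd) nu2'"
      unfolding sq_def c2_def h'_def
      by (rule sub_val_squares[OF n d(1) rows_le_subconf[OF nu(1) rows] k(1)]
          sub_val_squares[OF n d(2) rows_le_subconf[OF nu(2) rows] k(2)]
          sub_val_squares[OF n d(3) rows_le_subconf[OF sub(1) rows] k(3)]
          sub_val_squares[OF n d(4) rows_le_subconf[OF sub(2) rows] k(4)])+
    have "(\<Sum>i=1..H. c2 k1 i + int (n + 1 - d1) - sq h1 i) + (\<Sum>i=1..H. c2 k2 i + int (n + 1 - d2) - sq h2 i)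
       + (\<Sum>i=1..H. c2 k1' i + c2 k2' i - c2 k1 i - c2 k2 i) =
      (\<Sum>i=1..H. c2 k1' i + int (n + 1 - d1') - sq h1' i) + (\<Sum>i=1..H. c2 k2' i + int (n + 1 - d2') - sq h2' i)
       - (\<Sum>i=1..H. sq h1 i + sq h2 i - sq h1' i - sq h2' i)"
      unfolding sum.distrib[symmetric] sum_subtractf[symmetric] by (intro sum.cong refl) (use dd in simp)
    then show ?thesis unfolding t c2_def[symmetric] using c by simp
  qed
  also have "\<dots> \<le> 2 * sub_val n k1' nu1' d1' + 2 * sub_val n k2' nu2' d2'"
  proof -
    have "0 \<le> (\<Sum>i=1..H. sq h1 i + sq h2 i - sq h1' i - sq h2' i)"
    proof (rule sum_nonneg)
      fix i assume "i \<in> {1..H}"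
      from G[OF this] show "0 \<le> sq h1 i + sq h2 i - sq h1' i - sq h2' i" by simp
    qed
    then show ?thesis by simp
  qed
  also have "\<dots> \<le> 2 * tau n rc k1' d1' + 2 * tau n rc k2' d2'"
    using tau_ge[OF sub(1), of k1' d1'] tau_ge[OF sub(2), of k2' d2'] by simp
  finally show ?thesis .
qed

text \<open>Inductive so that, when the component reaches the far corner, the parity function can be
  built along a path by rule induction.\<close>

inductive reach :: "(nat \<Rightarrow> nat \<Rightarrow> int) \<Rightarrow> nat \<Rightarrow> nat \<Rightarrow> nat \<Rightarrow> nat \<Rightarrow> nat \<Rightarrow> nat \<Rightarrow> bool"
  for U :: "nat \<Rightarrow> nat \<Rightarrow> int" and n H a b :: nat where
  start: "b < i \<Longrightarrow> i \<le> a \<Longrightarrow> reach U n H a b 0 i"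
| right: "reach U n H a b p i \<Longrightarrow> p + 1 \<le> n + 1 \<Longrightarrow> 1 \<le> U (p + 1) i \<Longrightarrow> reach U n H a b (p + 1) i"
| left: "reach U n H a b (p + 1) i \<Longrightarrow> 1 \<le> U p i \<Longrightarrow> reach U n H a b p i"
| up: "reach U n H a b p i \<Longrightarrow> i + 1 \<le> H + 1 \<Longrightarrow> 1 \<le> U p (i + 1) \<Longrightarrow> reach U n H a b p (i + 1)"
| down: "reach U n H a b p (i + 1) \<Longrightarrow> 1 \<le> i \<Longrightarrow> 1 \<le> U p i \<Longrightarrow> reach U n H a b p i"

text \<open>
  If the component of \<open>U \<ge> 1\<close> of the left segment \<open>b < i \<le> a\<close> misses the other boundary part where
  \<open>U = 1\<close>, its indicator is the required \<open>s\<close>. Otherwise a path separates the boundary part \<open>i \<le> b\<close>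
  from the rest of \<open>U \<le> 0\<close>. The invariant \<open>w p i\<close> below is the parity of the number of path steps
  between the columns \<open>p\<close> and \<open>p + 1\<close> above level \<open>i\<close>; it is constant on components of \<open>U \<le> 0\<close>.
\<close>

lemma planar_cut:
  fixes U :: "nat \<Rightarrow> nat \<Rightarrow> int"
  assumes ab: "b < a" "a \<le> H" and c: "c \<le> n"
    and left: "\<And>i. i \<in> {1..H+1} \<Longrightarrow> U 0 i = (if b < i \<and> i \<le> a then 1 else 0)"
    and right: "\<And>i. i \<in> {1..H+1} \<Longrightarrow> U (n + 1) i = 1"
    and top: "\<And>p. p \<le> n + 1 \<Longrightarrow> U p (H + 1) = (if c < p then 1 else 0)"
  obtains s where "\<And>p i. p \<le> n \<Longrightarrow> i \<in> {1..H} \<Longrightarrow> between0 (s p i - s (p + 1) i) (U p i - U (p + 1) i)"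
    and "\<And>p i. p \<in> {1..n} \<Longrightarrow> i \<in> {1..H} \<Longrightarrow> between0 (s p i - s p (i + 1)) (U p i - U p (i + 1))"
    and "\<And>i. i \<in> {1..H} \<Longrightarrow> s (n + 1) i = 0" and "\<And>p. p \<in> {1..n} \<Longrightarrow> s p (H + 1) = (0 :: int)"
    and "(\<forall>i\<in>{1..H}. s 0 i = (if b < i \<and> i \<le> a then 1 else 0)) \<or> (\<forall>i\<in>{1..H}. s 0 i = (if i \<le> b then - 1 else 0))"
proof -
  let ?R = "reach U n H a b"
  have R: "1 \<le> U p i \<and> p \<le> n + 1 \<and> 1 \<le> i \<and> i \<le> H + 1" if "?R p i" for p i
    using that by (induction) (use ab left in auto)
  show thesis
  proof (cases "?R (n + 1) (H + 1)")
    case False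
    have noright: "\<not> ?R (n + 1) i" if "i \<in> {1..H+1}" for i
    proof
      assume "?R (n + 1) i"
      then have "?R (n + 1) (i + k)" if "i + k \<le> H + 1" for k
        using that
      proof (induction k)
        case (Suc k)
        then show ?case using reach.up[of U n H a b "n + 1" "i + k"] right[of "i + Suc k"] by simp
      qed simp
      from this[of "H + 1 - i"] show False using False that by simp
    qed
    have notop: "\<not> ?R p (H + 1)" if "p \<le> n + 1" for p
    proof
      assume r: "?R p (H + 1)"
      then have "c < p" using R[OF r] top[OF that] by (auto split: if_splits)
      have "?R (p + k) (H + 1)" if "p + k \<le> n + 1" for k
        using that
      proof (induction k)
        case (Suc k)
        then show ?case using reach.right[of U n H a b "p + k" "H + 1"] top[of "p + Suc k"] \<open>c < p\<close> by simp
      qed (use r in simp)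
      from this[of "n + 1 - p"] show False using False that by simp
    qed
    define s where "s p i = (if ?R p i then 1 else 0 :: int)"  for p i
    \<comment> \<open>An edge leaving the component ends where \<open>U \<le> 0\<close>, while
      inside \<open>U\<close> is at least 1; so the jump of the indicator is covered by the jump of
      \<open>U\<close>.\<close>
    have step: "between0 (s p i - s r k) (U p i - U r k)"
      if st: "?R p i \<Longrightarrow> 1 \<le> U r k \<Longrightarrow> ?R r k" "?R r k \<Longrightarrow> 1 \<le> U p i \<Longrightarrow> ?R p i" for p i r k
    proof -
      consider "?R p i = ?R r k" | "?R p i" "\<not> 1 \<le> U r k" "\<not> ?R r k" | "?R r k" "\<not> 1 \<le> U p i" "\<not> ?R p i"
        using st by blast
      then show ?thesis
        using R[of p i] R[of r k] by cases (auto simp: s_def between0_def)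
    qed
    show thesis
    proof (rule that[of s])
      fix p i assume "p \<le> n" "i \<in> {1..H}"
      then show "between0 (s p i - s (p + 1) i) (U p i - U (p + 1) i)"
        using step[OF reach.right[of U n H a b p i] reach.left[of U n H a b p i]] by simp
    next
      fix p i assume "p \<in> {1..n}" "i \<in> {1..H}"
      then show "between0 (s p i - s p (i + 1)) (U p i - U p (i + 1))"
        using step[OF reach.up[of U n H a b p i] reach.down[of U n H a b p i]] by simp
    next
      show "s (n + 1) i = 0" if "i \<in> {1..H}" for i using noright[of i] that by (simp add: s_def)
      show "s p (H + 1) = 0" if "p \<in> {1..n}" for p using notop[of p] that by (simp add: s_def)
      have "s 0 i = (if b < i \<and> i \<le> a then 1 else 0)" if "i \<in> {1..H}" for i
        using that R[of 0 i] left[of i] reach.start[of b i a U n H] by (auto simp: s_def split: if_splits)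
      then show "(\<forall>i\<in>{1..H}. s 0 i = (if b < i \<and> i \<le> a then 1 else 0)) \<or> (\<forall>i\<in>{1..H}. s 0 i = (if i \<le> b then - 1 else 0))"
        by blast
    qed
  next
    case True
    \<comment> \<open>\<open>r\<close> and \<open>k\<close> are column and level of the current end
      of the path. Parities of neighbouring columns differ exactly across the ray below that end.
      The value \<open>r \<noteq> 0\<close> below \<open>b\<close> arises because steps between the
      columns 0 and 1 happen only above level \<open>b\<close>.\<close>
    define inv where "inv r k w \<longleftrightarrow>
       (\<forall>p i. p \<le> n \<longrightarrow> i \<in> {1..H+1} \<longrightarrow> U p i \<le> 0 \<longrightarrow> U (p + 1) i \<le> 0 \<longrightarrow> (w p i \<noteq> w (p + 1) i) = (r = p + 1 \<and> i < k)) \<and>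
       (\<forall>p i. p \<le> n + 1 \<longrightarrow> i \<in> {1..H} \<longrightarrow> U p i \<le> 0 \<longrightarrow> U p (i + 1) \<le> 0 \<longrightarrow> w p i = w p (i + 1)) \<and>
       (\<forall>i. a \<le> i \<longrightarrow> \<not> w 0 i) \<and> (\<forall>i. 1 \<le> i \<longrightarrow> i \<le> b \<longrightarrow> w 0 i = (r \<noteq> 0)) \<and> (\<forall>p. \<not> w p (H + 1))"
      for r k :: nat and w :: "nat \<Rightarrow> nat \<Rightarrow> bool"
    \<comment> \<open>A step between the columns \<open>r\<close> and \<open>r + 1\<close> at level
      \<open>k\<close> flips the parity of column \<open>r\<close> below \<open>k\<close>. The
      variables \<open>v\<close> and \<open>v'\<close> are its start and end, so both directions are
      covered.\<close>
    have hstep: "inv v' k (\<lambda>p i. w p i \<noteq> (p = r \<and> i < k))"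
      if inv: "inv v k w" and v: "v = r \<and> v' = r + 1 \<or> v = r + 1 \<and> v' = r"
        and U: "1 \<le> U r k" "1 \<le> U (r + 1) k" and k: "1 \<le> k" "k \<le> H + 1" for r k w v v'
    proof -
      have zero: "b < k \<and> k \<le> a" if "r = 0" using U(1) left[of k] that k by (auto split: if_splits)
      show ?thesis
        unfolding inv_def
      proof (intro conjI allI impI)
        fix p i assume *: "p \<le> n" "i \<in> {1..H+1}" "U p i \<le> 0" "U (p + 1) i \<le> 0"
        have "(w p i \<noteq> w (p + 1) i) = (v = p + 1 \<and> i < k)" using inv * unfolding inv_def by blast
        then show "((w p i \<noteq> (p = r \<and> i < k)) \<noteq> (w (p + 1) i \<noteq> (p + 1 = r \<and> i < k))) = (v' = p + 1 \<and> i < k)"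
          using v by auto
      next
        fix p i assume *: "p \<le> n + 1" "i \<in> {1..H}" "U p i \<le> 0" "U p (i + 1) \<le> 0"
        have "w p i = w p (i + 1)" using inv * unfolding inv_def by blast
        moreover have "p = r \<Longrightarrow> i + 1 \<noteq> k" using U(1) *(4) by auto
        ultimately show "(w p i \<noteq> (p = r \<and> i < k)) = (w p (i + 1) \<noteq> (p = r \<and> i + 1 < k))" by auto
      next
        fix i assume "a \<le> i"
        moreover from this have "\<not> w 0 i" using inv unfolding inv_def by blast
        ultimately show "\<not> (w 0 i \<noteq> (0 = r \<and> i < k))" using zero by auto
      next
        fix i assume i: "1 \<le> i" "i \<le> b"
        then have "w 0 i = (v \<noteq> 0)" using inv unfolding inv_def by blast
        then show "(w 0 i \<noteq> (0 = r \<and> i < k)) = (v' \<noteq> 0)" using zero v i by (cases "r = 0") auto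
      next
        fix p
        have "\<not> w p (H + 1)" using inv unfolding inv_def by blast
        then show "\<not> (w p (H + 1) \<noteq> (p = r \<and> H + 1 < k))" using k by simp
      qed
    qed
    have vstep: "inv r k' w" if inv: "inv r k w" and k: "k' = k + 1 \<or> k = k' + 1"
      and U: "1 \<le> U r k" "1 \<le> U r k'" for r k k' w
      unfolding inv_def
    proof (intro conjI)
      show "\<forall>p i. p \<le> n \<longrightarrow> i \<in> {1..H+1} \<longrightarrow> U p i \<le> 0 \<longrightarrow> U (p + 1) i \<le> 0 \<longrightarrow>
        (w p i \<noteq> w (p + 1) i) = (r = p + 1 \<and> i < k')"
      proof (intro allI impI)
        fix p i assume *: "p \<le> n" "i \<in> {1..H+1}" "U p i \<le> 0" "U (p + 1) i \<le> 0"
        have "(w p i \<noteq> w (p + 1) i) = (r = p + 1 \<and> i < k)" using inv * unfolding inv_def by blast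
        moreover have "r = p + 1 \<Longrightarrow> i \<noteq> k \<and> i \<noteq> k'" using U *(4) by auto
        ultimately show "(w p i \<noteq> w (p + 1) i) = (r = p + 1 \<and> i < k')" using k by auto
      qed
    qed (use inv in \<open>unfold inv_def, blast\<close>)+
    have "\<exists>w. inv r k w" if "?R r k" for r k
      using that
    proof induction
      case (start i)
      then show ?case by (intro exI[of _ "\<lambda>_ _. False"]) (auto simp: inv_def)
    next
      case (right r k)
      then obtain w where w: "inv r k w" by blast
      show ?case using hstep[OF w, of r "r + 1"] R[OF right.hyps(1)] right.hyps by blast
    next
      case (left r k)
      then obtain w where w: "inv (r + 1) k w" by blast
      show ?case using hstep[OF w, of r r] R[OF left.hyps(1)] left.hyps by blast
    next
      case (up r k)
      then obtain w where w: "inv r k w" by blast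
      show ?case using vstep[OF w, of "k + 1"] R[OF up.hyps(1)] up.hyps by blast
    next
      case (down r k)
      then obtain w where w: "inv r (k + 1) w" by blast
      show ?case using vstep[OF w, of k] R[OF down.hyps(1)] down.hyps by blast
    qed
    then obtain w where w: "inv (n + 1) (H + 1) w" using True by blast
    define s where "s p i = (if U p i \<le> 0 \<and> w p i then - 1 else 0 :: int)" for p i
    show thesis
    proof (rule that[of s])
      fix p i assume *: "p \<le> n" "i \<in> {1..H}"
      \<comment> \<open>The path now ends in column \<open>n + 1\<close>, so the exceptional ray
        lies where \<open>U\<close> is 1 and excludes no edge with \<open>U \<le> 0\<close> at both
        ends.\<close>
      then have "w p i = w (p + 1) i" if "U p i \<le> 0" "U (p + 1) i \<le> 0"
        using that w right[of i] unfolding inv_def by (cases "p = n") auto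
      then show "between0 (s p i - s (p + 1) i) (U p i - U (p + 1) i)"
        by (cases "U p i \<le> 0"; cases "U (p + 1) i \<le> 0") (auto simp: s_def between0_def)
    next
      fix p i assume *: "p \<in> {1..n}" "i \<in> {1..H}"
      then have "w p i = w p (i + 1)" if "U p i \<le> 0" "U p (i + 1) \<le> 0"
        using that w unfolding inv_def by auto
      then show "between0 (s p i - s p (i + 1)) (U p i - U p (i + 1))"
        by (cases "U p i \<le> 0"; cases "U p (i + 1) \<le> 0") (auto simp: s_def between0_def)
    next
      show "s (n + 1) i = 0" if "i \<in> {1..H}" for i using right[of i] that by (simp add: s_def)
      show "s p (H + 1) = 0" if "p \<in> {1..n}" for p using w by (simp add: s_def inv_def)
      have "s 0 i = (if i \<le> b then - 1 else 0)" if "i \<in> {1..H}" for i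
        using that w left[of i] by (auto simp: s_def inv_def)
      then show "(\<forall>i\<in>{1..H}. s 0 i = (if b < i \<and> i \<le> a then 1 else 0)) \<or> (\<forall>i\<in>{1..H}. s 0 i = (if i \<le> b then - 1 else 0))"
        by blast
    qed
  qed
qed

section \<open>Inequalities between tau functions\<close>

lemma height_left: "height n d k nu 0 i = col (mset k) i"
  by (simp add: height_def arr_def)

lemma height_right: "height n d k nu (n + 1) i = - int (n + 1 - d)"
  by (simp add: height_def arr_def)

lemma height_top:
  assumes "rows_le n H nu" and "\<forall>x\<in>set k. x \<le> H"
  shows "height n d k nu a (H + 1) = - int (a - d)"
proof -
  have "col (lens_of nu a) (H + 1) = 0" if "a \<in> {1..n}"
    using rows_le_lens[OF assms(1) that] by (intro col_eq_0) auto
  moreover have "col (mset k) (H + 1) = 0" using assms(2) by (intro col_eq_0) auto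
  ultimately show ?thesis by (simp add: height_def arr_def)
qed

context
  fixes n H c a b :: nat and rc :: rcfg and k :: "nat list"
  assumes n: "1 \<le> n" and rc: "\<And>a x. a \<in> {1..n} \<Longrightarrow> x \<in># rc a \<Longrightarrow> 1 \<le> fst x \<and> fst x \<le> H"
    and c: "c \<le> n" and k: "\<forall>x\<in>set k. x \<le> H" and a: "a \<le> H" and b: "b \<le> H"
begin

lemma rows_le_sub: "subconf n nu rc \<Longrightarrow> rows_le n H nu"
  using rc subconf_mem unfolding rows_le_def by blast

text \<open>The origin of the summand \<open>b\<close> in the Hirota equation: on each level up to
  \<open>b\<close> the squares combine to 2(x+1)^2 - x^2 - (x+2)^2 = -2.\<close>

lemma sum_min_square:
  assumes "b \<le> a"
  shows "(\<Sum>i=1..H. colsq (k @ [a]) i + colsq (k @ [b]) i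
      - colsq k i - colsq (k @ [a, b]) i) = - 2 * int b"
proof -
  have "(\<Sum>i=1..H. colsq (k @ [a]) i + colsq (k @ [b]) i
      - colsq k i - colsq (k @ [a, b]) i)
    = (\<Sum>i=1..H. if i \<le> b then - 2 else 0)"
    using assms by (intro sum.cong) (auto simp: algebra_simps)
  also have "\<dots> = - 2 * int b" unfolding sum_iverson using b by (simp add: min_absorb2)
  finally show ?thesis .
qed

text \<open>A monotone function that does not expand distances, applied to the difference of the
  heights, satisfies all edge conditions at once. Only its effect on the boundary values remains to
  be matched.\<close>

lemma tau_clip:
  assumes f: "\<And>x y. between0 (f x - f y) (x - y)" and d: "d1 \<le> n + 1" "d2 \<le> n + 1" "d1' \<le> n + 1" "d2' \<le> n + 1"
    and k: "\<forall>x\<in>set k1. x \<le> H" "\<forall>x\<in>set k2. x \<le> H" "\<forall>x\<in>set k1'. x \<le> H" "\<forall>x\<in>set k2'. x \<le> H"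
    and left: "\<And>i. col (mset k1') i = col (mset k1) i - f (col (mset k1) i - col (mset k2) i) \<and>
      col (mset k2') i = col (mset k2) i + f (col (mset k1) i - col (mset k2) i)"
    and right: "\<And>p. int (p - d1') = int (p - d1) + f (int (p - d2) - int (p - d1)) \<and>
      int (p - d2') = int (p - d2) - f (int (p - d2) - int (p - d1))"
  shows "2 * tau n rc k1 d1 + 2 * tau n rc k2 d2 + (\<Sum>i=1..H. colsq k1' i
      + colsq k2' i - colsq k1 i - colsq k2 i)
    \<le> 2 * tau n rc k1' d1' + 2 * tau n rc k2' d2'"
proof -
  obtain nu1 where nu1: "subconf n nu1 rc" "sub_val n k1 nu1 d1 = tau n rc k1 d1" using tau_attained by blast
  obtain nu2 where nu2: "subconf n nu2 rc" "sub_val n k2 nu2 d2 = tau n rc k2 d2" using tau_attained by blast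
  define U where "U p i = height n d1 k1 nu1 p i - height n d2 k2 nu2 p i" for p i
  have top: "U p (H + 1) = int (p - d2) - int (p - d1)" for p
    unfolding U_def using height_top[OF rows_le_sub[OF nu1(1)]] height_top[OF rows_le_sub[OF nu2(1)]] k(1,2) by simp
  have bound: "U 0 i = col (mset k1) i - col (mset k2) i" "U (n + 1) i = int (n + 1 - d2) - int (n + 1 - d1)" for i
    unfolding U_def height_left height_right by simp_all
  show ?thesis
    unfolding nu1(2)[symmetric] nu2(2)[symmetric]
    by (rule tau_exchange[OF n rc nu1(1) nu2(1) d k, where s = "\<lambda>p i. f (U p i)"])
      (use left right f in \<open>simp_all only: top bound U_def[symmetric]\<close>)
qed

text \<open>On the left the difference takes the values 0, -1, -2. Clipping at -1 passes the row
  \<open>a\<close>, and with it the index \<open>c + 1\<close>, from the second pair to the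
  first.\<close>

lemma hirota_le_1:
  assumes "b \<le> a"
  shows "tau n rc k c + tau n rc (k @ [a, b]) (c + 1) - int b \<le> tau n rc (k @ [a]) (c + 1) + tau n rc (k @ [b]) c"
proof -
  have "2 * tau n rc k c + 2 * tau n rc (k @ [a, b]) (c + 1)
    + (\<Sum>i=1..H. colsq (k @ [a]) i + colsq (k @ [b]) i
      - colsq k i - colsq (k @ [a, b]) i)
    \<le> 2 * tau n rc (k @ [a]) (c + 1) + 2 * tau n rc (k @ [b]) c"
    by (rule tau_clip[where f = "\<lambda>x. max x (- 1)"]) (use assms c k a b in \<open>auto simp: between0_def\<close>)
  then show ?thesis unfolding sum_min_square[OF assms] by simp
qed

text \<open>The difference is at most 0 on the left and at least 0 on the right and top, so its
  negative part exchanges the rows and keeps the indices.\<close>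

lemma hirota_le_2:
  assumes "b \<le> a"
  shows "tau n rc (k @ [b]) (c + 1) + tau n rc (k @ [a]) c \<le> tau n rc (k @ [a]) (c + 1) + tau n rc (k @ [b]) c"
proof -
  have "2 * tau n rc (k @ [b]) (c + 1) + 2 * tau n rc (k @ [a]) c
    + (\<Sum>i=1..H. colsq (k @ [a]) i + colsq (k @ [b]) i
      - colsq (k @ [b]) i - colsq (k @ [a]) i)
    \<le> 2 * tau n rc (k @ [a]) (c + 1) + 2 * tau n rc (k @ [b]) c"
    by (rule tau_clip[where f = "\<lambda>x. min x 0"]) (use assms c k a b in \<open>auto simp: between0_def\<close>)
  then show ?thesis by simp
qed

text \<open>With the signs of the boundary reversed, the negative part keeps the rows and exchanges
  the indices. This gives the nonnegativity of the coordinates \<open>x_d\<close>.\<close>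

lemma tau_supermodular:
  "tau n rc (k @ [b]) c + tau n rc k (c + 1) \<le> tau n rc (k @ [b]) (c + 1) + tau n rc k c"
proof -
  have "2 * tau n rc (k @ [b]) c + 2 * tau n rc k (c + 1)
    + (\<Sum>i=1..H. colsq (k @ [b]) i + colsq k i
      - colsq (k @ [b]) i - colsq k i)
    \<le> 2 * tau n rc (k @ [b]) (c + 1) + 2 * tau n rc k c"
    by (rule tau_clip[where f = "\<lambda>x. min x 0"]) (use c k b in \<open>auto simp: between0_def\<close>)
  then show ?thesis by simp
qed

text \<open>Here the difference is 1 both on the left segment and on the right, so truncation cannot
  tell them apart. \<open>planar_cut\<close> either detaches the left segment, which swaps the rows
  \<open>a\<close> and \<open>b\<close>, or cuts off the part below \<open>b\<close>, which moves
  \<open>b\<close> to the list with \<open>a\<close>.\<close>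

lemma hirota_ge:
  assumes "b < a"
  shows "tau n rc (k @ [a]) (c + 1) + tau n rc (k @ [b]) c \<le> tau n rc (k @ [b]) (c + 1) + tau n rc (k @ [a]) c \<or>
    tau n rc (k @ [a]) (c + 1) + tau n rc (k @ [b]) c \<le> tau n rc k c + tau n rc (k @ [a, b]) (c + 1) - int b"
proof -
  obtain nu1 where nu1: "subconf n nu1 rc" "sub_val n (k @ [a]) nu1 (c + 1) = tau n rc (k @ [a]) (c + 1)"
    using tau_attained by blast
  obtain nu2 where nu2: "subconf n nu2 rc" "sub_val n (k @ [b]) nu2 c = tau n rc (k @ [b]) c"
    using tau_attained by blast
  define U where "U p i = height n (c + 1) (k @ [a]) nu1 p i - height n c (k @ [b]) nu2 p i" for p i
  have left: "U 0 i = (if b < i \<and> i \<le> a then 1 else 0)" for i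
    using assms unfolding U_def height_left by auto
  have right: "U (n + 1) i = 1" for i
    using c unfolding U_def height_right by (auto simp: of_nat_diff)
  have top: "U p (H + 1) = (if c < p then 1 else 0)" for p
    unfolding U_def using height_top[OF rows_le_sub[OF nu1(1)], of "k @ [a]"] height_top[OF rows_le_sub[OF nu2(1)], of "k @ [b]"] k a b
    by auto
  obtain s where s: "\<And>p i. p \<le> n \<Longrightarrow> i \<in> {1..H} \<Longrightarrow> between0 (s p i - s (p + 1) i) (U p i - U (p + 1) i)"
    "\<And>p i. p \<in> {1..n} \<Longrightarrow> i \<in> {1..H} \<Longrightarrow> between0 (s p i - s p (i + 1)) (U p i - U p (i + 1))"
    "\<And>i. i \<in> {1..H} \<Longrightarrow> s (n + 1) i = 0" "\<And>p. p \<in> {1..n} \<Longrightarrow> s p (H + 1) = (0 :: int)"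
    "(\<forall>i\<in>{1..H}. s 0 i = (if b < i \<and> i \<le> a then 1 else 0)) \<or> (\<forall>i\<in>{1..H}. s 0 i = (if i \<le> b then - 1 else 0))"
    using planar_cut[where U = U and n = n, OF assms a c left right top] by blast
  note sU = s(1,2)[unfolded U_def]
  show ?thesis
  proof (cases "\<forall>i\<in>{1..H}. s 0 i = (if b < i \<and> i \<le> a then 1 else 0)")
    case True
    have "2 * sub_val n (k @ [a]) nu1 (c + 1) + 2 * sub_val n (k @ [b]) nu2 c
      + (\<Sum>i=1..H. colsq (k @ [b]) i + colsq (k @ [a]) i
        - colsq (k @ [a]) i - colsq (k @ [b]) i)
      \<le> 2 * tau n rc (k @ [b]) (c + 1) + 2 * tau n rc (k @ [a]) c"
      by (rule tau_exchange[OF n rc nu1(1) nu2(1), where s = s])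
        (use sU s(3,4) True c k a b assms in auto)
    then show ?thesis unfolding nu1(2) nu2(2) by simp
  next
    case False
    then have s0: "\<forall>i\<in>{1..H}. s 0 i = (if i \<le> b then - 1 else 0)" using s(5) by blast
    have "2 * sub_val n (k @ [a]) nu1 (c + 1) + 2 * sub_val n (k @ [b]) nu2 c
      + (\<Sum>i=1..H. colsq (k @ [a, b]) i + colsq k i
        - colsq (k @ [a]) i - colsq (k @ [b]) i)
      \<le> 2 * tau n rc (k @ [a, b]) (c + 1) + 2 * tau n rc k c"
      by (rule tau_exchange[OF n rc nu1(1) nu2(1), where s = s])
        (use sU s(3,4) s0 c k a b assms in auto)
    moreover have "(\<Sum>i=1..H. colsq (k @ [a, b]) i + colsq k i
        - colsq (k @ [a]) i - colsq (k @ [b]) i)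
      = - (- 2 * int b)"
      unfolding sum_min_square[OF less_imp_le[OF assms], symmetric] sum_negf[symmetric] by (intro sum.cong) auto
    ultimately show ?thesis unfolding nu1(2) nu2(2) by simp
  qed
qed

lemma hirota:
  assumes "b < a"
  shows "tau n rc (k @ [b]) c + tau n rc (k @ [a]) (c + 1) =
    max (tau n rc k c + tau n rc (k @ [a, b]) (c + 1) - int b) (tau n rc (k @ [b]) (c + 1) + tau n rc (k @ [a]) c)"
  using hirota_ge[OF assms] hirota_le_1[OF less_imp_le[OF assms]] hirota_le_2[OF less_imp_le[OF assms]] by auto

end

section \<open>Combinatorial R and time evolution\<close>

definition rows_pos :: "nat \<Rightarrow> rcfg \<Rightarrow> bool" where
  "rows_pos n rc \<longleftrightarrow> (\<forall>a\<in>{1..n}. \<forall>x\<in>#rc a. 1 \<le> fst x)"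

lemma ex_length_bound:
  assumes "rows_pos n rc"
  shows "\<exists>H. (\<forall>a x. a \<in> {1..n} \<longrightarrow> x \<in># rc a \<longrightarrow> 1 \<le> fst x \<and> fst x \<le> H) \<and> (\<forall>x\<in>set k. x \<le> H)"
proof -
  obtain H where H: "sum_list k \<le> H" "rows_le n H rc" using ex_rows_le by blast
  moreover have "x \<le> sum_list k" if "x \<in> set k" for x using that by (intro member_le_sum_list) auto
  ultimately show ?thesis using assms unfolding rows_le_def rows_pos_def by (metis order_trans)
qed

lemma tau_hirota:
  assumes "1 \<le> n" and "rows_pos n rc" and "c \<le> n" and "b < a"
  shows "tau n rc (k @ [b]) c + tau n rc (k @ [a]) (c + 1) =
    max (tau n rc k c + tau n rc (k @ [a, b]) (c + 1) - int b) (tau n rc (k @ [b]) (c + 1) + tau n rc (k @ [a]) c)"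
proof -
  obtain H where H: "\<And>a x. a \<in> {1..n} \<Longrightarrow> x \<in># rc a \<Longrightarrow> 1 \<le> fst x \<and> fst x \<le> H" "\<forall>x\<in>set (k @ [a, b]). x \<le> H"
    using ex_length_bound[OF assms(2)] by blast
  show ?thesis
    by (rule hirota[where H = H]) (use assms H in auto)
qed

lemma tau_increment_nonneg:
  assumes "1 \<le> n" and "rows_pos n rc" and "d \<in> {1..n+1}"
  shows "0 \<le> tau n rc (k @ [b]) d - tau n rc k d - tau n rc (k @ [b]) (d - 1) + tau n rc k (d - 1)"
proof -
  obtain H where H: "\<And>a x. a \<in> {1..n} \<Longrightarrow> x \<in># rc a \<Longrightarrow> 1 \<le> fst x \<and> fst x \<le> H" "\<forall>x\<in>set (k @ [b]). x \<le> H"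
    using ex_length_bound[OF assms(2)] by blast
  have "tau n rc (k @ [b]) (d - 1) + tau n rc k (d - 1 + 1) \<le> tau n rc (k @ [b]) (d - 1 + 1) + tau n rc k (d - 1)"
    by (rule tau_supermodular[where H = H and a = b]) (use assms H in auto)
  then show ?thesis using assms(3) by simp
qed

lemma tau_mset_cong:
  assumes "mset k = mset k'"
  shows "tau n rc k d = tau n rc k' d"
proof -
  have "tau_val n k = tau_val n k'" by (simp add: tau_val_def fun_eq_iff assms)
  moreover have "sum_list k = sum_list k'" by (metis assms sum_mset_sum_list)
  ultimately show ?thesis by (simp add: tau_def tau_pos_def)
qed

definition tau_elt :: "nat \<Rightarrow> rcfg \<Rightarrow> nat list \<Rightarrow> nat \<Rightarrow> nat list \<Rightarrow> bool" where
  "tau_elt n rc k l x \<longleftrightarrow> length x = n + 1 \<and> (\<forall>d\<in>{1..n+1}. int (x ! (d - 1)) =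
     tau n rc (k @ [l]) d - tau n rc k d - tau n rc (k @ [l]) (d - 1) + tau n rc k (d - 1))"

lemma tau_elt_mset_cong:
  assumes "mset k = mset k'"
  shows "tau_elt n rc k l x = tau_elt n rc k' l x"
proof -
  have "tau n rc k = tau n rc k'" using tau_mset_cong[OF assms] by blast
  moreover have "tau n rc (k @ [l]) = tau n rc (k' @ [l])"
    using tau_mset_cong[of "k @ [l]" "k' @ [l]"] assms by fastforce
  ultimately show ?thesis by (simp add: tau_elt_def)
qed

text \<open>The extension of \<open>\<tau>\<close> to integer indices is quasi-periodic because \<open>\<tau>\<^sub>0(\<kappa>) = \<tau>\<^sub>n\<^sub>+\<^sub>1(\<kappa>) - \<bar>\<kappa>\<bar>\<close>.\<close>

definition tau_ext :: "nat \<Rightarrow> rcfg \<Rightarrow> nat list \<Rightarrow> int \<Rightarrow> int" where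
  "tau_ext n rc k z = tau n rc k (nat (z mod int (n + 1))) + int (sum_list k) * (z div int (n + 1))"

lemma tau_ext_period: "tau_ext n rc k (z + int (n + 1)) = tau_ext n rc k z + int (sum_list k)"
proof -
  have "(z + int (n + 1)) div int (n + 1) = z div int (n + 1) + 1" by (rule div_add_self2) simp
  moreover have "(z + int (n + 1)) mod int (n + 1) = z mod int (n + 1)" by (rule mod_add_self2)
  ultimately show ?thesis unfolding tau_ext_def by (simp add: distrib_left)
qed

lemma tau_ext_Suc:
  defines "c \<equiv> \<lambda>z n. nat (z mod int (n + 1))"
  shows "tau_ext n rc k (z + 1) = tau n rc k (c z n + 1) + int (sum_list k) * (z div int (n + 1))"
    and "tau_ext n rc k z = tau n rc k (c z n) + int (sum_list k) * (z div int (n + 1))"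
    and "c z n \<le> n"
proof -
  define N where "N = int (n + 1)"
  define r where "r = z mod N"
  define q where "q = z div N"
  have N: "0 < N" by (simp add: N_def)
  have r: "0 \<le> r" "r < N" using N by (auto simp: r_def)
  have z: "z = q * N + r" by (simp add: q_def r_def)
  have "nat r \<le> n" using r by (simp add: N_def)
  then show cn: "c z n \<le> n" by (simp only: c_def r_def N_def)
  show "tau_ext n rc k z = tau n rc k (c z n) + int (sum_list k) * (z div int (n + 1))"
    by (simp add: tau_ext_def c_def)
  show "tau_ext n rc k (z + 1) = tau n rc k (c z n + 1) + int (sum_list k) * (z div int (n + 1))"
  proof (cases "r + 1 < N")
    case True
    have "(z + 1) div N = q" "(z + 1) mod N = r + 1"
      using True r by (auto simp: z add.assoc div_pos_pos_trivial mod_pos_pos_trivial)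
    then show ?thesis
      using r unfolding tau_ext_def c_def N_def[symmetric] by (simp add: q_def[symmetric] r_def[symmetric] nat_add_distrib)
  next
    case False
    then have rn: "r = N - 1" using r by simp
    have "z + 1 = (q + 1) * N" by (simp add: z rn algebra_simps)
    then have "(z + 1) div N = q + 1" "(z + 1) mod N = 0" using N by auto
    moreover have "c z n = nat r" by (simp only: c_def r_def N_def)
    moreover have "nat r = n" by (simp add: rn N_def)
    ultimately show ?thesis
      unfolding tau_ext_def N_def[symmetric] by (simp add: q_def[symmetric] tau_def algebra_simps)
  qed
qed

lemma tau_elt_coord:
  assumes "tau_elt n rc k l x"
  shows "coord n x i = (tau_ext n rc (k @ [l]) i - tau_ext n rc k i) - (tau_ext n rc (k @ [l]) (i - 1) - tau_ext n rc k (i - 1))"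
proof -
  let ?c = "nat ((i - 1) mod int (n + 1))"
  have "coord n x i = int (x ! ?c)" by (simp add: coord_def)
  also have "\<dots> = tau n rc (k @ [l]) (?c + 1) - tau n rc k (?c + 1) - tau n rc (k @ [l]) ?c + tau n rc k ?c"
    using assms tau_ext_Suc(3)[of "i - 1" n] unfolding tau_elt_def by (auto dest: bspec[of _ _ "?c + 1"])
  finally show ?thesis
    using tau_ext_Suc(1,2)[of n rc "k @ [l]" "i - 1"] tau_ext_Suc(1,2)[of n rc k "i - 1"] by (simp add: algebra_simps)
qed

lemma tau_ext_hirota:
  assumes "1 \<le> n" and "rows_pos n rc" and "b < a"
  shows "tau_ext n rc (k @ [b]) z + tau_ext n rc (k @ [a]) (z + 1) =
    max (tau_ext n rc k z + tau_ext n rc (k @ [a, b]) (z + 1) - int b) (tau_ext n rc (k @ [b]) (z + 1) + tau_ext n rc (k @ [a]) z)"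
  unfolding tau_ext_Suc(1)[where z = z] tau_ext_Suc(2)[where z = z]
  using tau_hirota[OF assms(1,2) tau_ext_Suc(3)[of z n] assms(3), of k]
  by (simp add: algebra_simps max_def split: if_splits)

section \<open>The minimum in Q as a running minimum\<close>

lemma window_min:
  fixes D Z :: "int \<Rightarrow> int"
  assumes "\<And>z. D z = min (Z (z + 1) + t) (D (z + 1))"
  shows "(\<forall>j\<in>{1..m}. D z \<le> Z (z + int j) + t) \<and> D z \<le> D (z + int m)
    \<and> (D z = D (z + int m) \<or> (\<exists>j\<in>{1..m}. D z = Z (z + int j) + t))"
proof (induction m)
  case (Suc m)
  have *: "D (z + int m) = min (Z (z + int (Suc m)) + t) (D (z + int (Suc m)))"
    using assms[of "z + int m"] by (simp add: ac_simps)
  show ?case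
    using Suc * by (auto simp: atLeastAtMostSuc_conv min_def split: if_splits)
qed simp

text \<open>Unrolling the recursion over \<open>m\<close> steps leaves \<open>D (z + int m)\<close>
  as the only competitor from outside the window, and it is too large.\<close>

lemma Min_window:
  fixes D Z :: "int \<Rightarrow> int"
  assumes "\<And>z. D z = min (Z (z + 1) + t) (D (z + 1))" and "D (z + int m) > D z" and "1 \<le> m"
  shows "Min ((\<lambda>j. Z (z + j)) ` {1..int m}) = D z - t"
proof (rule Min_eqI)
  note w = window_min[where D = D and Z = Z and t = t and m = m and z = z, OF assms(1)]
  fix y assume "y \<in> (\<lambda>j. Z (z + j)) ` {1..int m}"
  then obtain j where j: "1 \<le> j" "j \<le> int m" "y = Z (z + j)" by auto
  then have "nat j \<in> {1..m}" "int (nat j) = j" by auto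
  then show "D z - t \<le> y" using w j(3) by fastforce
next
  note w = window_min[where D = D and Z = Z and t = t and m = m and z = z, OF assms(1)]
  from w assms(2) obtain j where "j \<in> {1..m}" "D z = Z (z + int j) + t" by auto
  then show "D z - t \<in> (\<lambda>j. Z (z + j)) ` {1..int m}" by (auto intro!: image_eqI[of _ _ "int j"])
qed simp

text \<open>With \<open>X\<close> and \<open>Y\<close> as partial sums, both sums in each candidate
  telescope, and the part depending on the candidate separates from the rest.\<close>

lemma Qf_window:
  assumes x: "\<And>i. coord n x i = X i - X (i - 1)" and y: "\<And>i. coord n y i = Y i - Y (i - 1)"
  shows "Qf n x y i = Min ((\<lambda>j. X (i + j - 1) - Y (i + j)) ` {1..int n + 1}) - X i + Y (i + (int n + 1))"
proof -
  have tele: "(\<Sum>j\<in>{p+1..q}. f (i + j) - f (i + j - 1)) = f (i + q) - f (i + p)" if "p \<le> q"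
    for p q :: int and f :: "int \<Rightarrow> int"
    using that
  proof (induction q rule: int_ge_induct)
    case (step q)
    have "{p+1..q+1} = insert (q+1) {p+1..q}" using step by auto
    then show ?case using step by (simp add: algebra_simps)
  qed simp
  have "(\<Sum>j\<in>{1..k-1}. coord n x (i+j)) + (\<Sum>j\<in>{k+1..int n+1}. coord n y (i+j))
     = (X (i + k - 1) - Y (i + k)) + (Y (i + (int n + 1)) - X i)" if "k \<in> {1..int n + 1}" for k
    using tele[of 0 "k - 1" X] tele[of k "int n + 1" Y] that by (simp add: x y algebra_simps)
  then have "Qf n x y i = Min ((\<lambda>k. (X (i + k - 1) - Y (i + k)) + (Y (i + (int n + 1)) - X i)) ` {1..int n + 1})"
    unfolding Qf_def by (intro arg_cong[where f = Min] image_cong) auto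
  also have "\<dots> = Min ((\<lambda>j. X (i + j - 1) - Y (i + j)) ` {1..int n + 1}) + (Y (i + (int n + 1)) - X i)"
    by (rule Min_add_commute) auto
  finally show ?thesis by simp
qed

text \<open>For different lengths the Hirota equation makes \<open>D\<close> a running minimum of
  \<open>Z\<close>, which identifies the minimum in Q: \<open>Qf\<close> and \<open>G\<close> differ
  by a constant, and this cancels in the difference.\<close>

lemma Qf_tau:
  assumes n: "1 \<le> n" and rc: "rows_pos n rc" and x: "tau_elt n rc k a x" and y: "tau_elt n rc (k @ [a]) b y"
  defines "G \<equiv> \<lambda>i. tau_ext n rc (k @ [a, b]) i + tau_ext n rc k i - tau_ext n rc (k @ [a]) i - tau_ext n rc (k @ [b]) i"
  shows "Qf n x y i - Qf n x y (i - 1) = G i - G (i - 1)"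
proof -
  define N where "N = int n + 1"
  define F where "F = tau_ext n rc k"
  define Fa where "Fa = tau_ext n rc (k @ [a])"
  define Fb where "Fb = tau_ext n rc (k @ [b])"
  define Fab where "Fab = tau_ext n rc (k @ [a, b])"
  define X where "X i = Fa i - F i" for i
  define Y where "Y i = Fab i - Fa i" for i
  define D where "D i = Fa i - Fb i" for i
  define Z where "Z i = X (i - 1) - Y i" for i
  have per: "F (z + N) = F z + int (sum_list k)" "Fa (z + N) = Fa z + int (sum_list k) + int a"
    "Fb (z + N) = Fb z + int (sum_list k) + int b" "Fab (z + N) = Fab z + int (sum_list k) + int a + int b" for z
    unfolding F_def Fa_def Fb_def Fab_def N_def using tau_ext_period[of n rc _ z] by (simp_all add: ac_simps)
  have Q: "Qf n x y z = Min ((\<lambda>j. Z (z + j)) ` {1..int (n + 1)}) - X z + Y z + int b" for z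
  proof -
    have "Qf n x y z = Min ((\<lambda>j. X (z + j - 1) - Y (z + j)) ` {1..int n + 1}) - X z + Y (z + (int n + 1))"
      by (rule Qf_window) (use tau_elt_coord[OF x] tau_elt_coord[OF y] in \<open>simp_all add: X_def Y_def F_def Fa_def Fab_def\<close>)
    then show ?thesis using per[of z] by (simp add: Z_def Y_def N_def[symmetric] add.commute[of 1])
  qed
  have G: "G z = D z - X z + Y z" for z
    by (simp add: G_def D_def X_def Y_def F_def Fa_def Fb_def Fab_def)
  have DN: "D (z + int (n + 1)) = D z + int a - int b" for z
    using per[of z] by (simp add: D_def N_def add.commute[of 1])
  consider "b < a" | "a < b" | "a = b" by linarith
  then show ?thesis
  proof cases
    case 1
    have "D z = min (Z (z + 1) + int b) (D (z + 1))" for z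
      using tau_ext_hirota[OF n rc 1, of k z]
      by (simp add: D_def Z_def X_def Y_def F_def Fa_def Fb_def Fab_def max_def min_def split: if_splits)
    from Min_window[where D = D and Z = Z and t = "int b" and m = "n + 1", OF this] DN 1
    have "Min ((\<lambda>j. Z (z + j)) ` {1..int (n + 1)}) = D z - int b" for z by simp
    then show ?thesis unfolding Q G by simp
  next
    case 2
    have ba: "tau_ext n rc (k @ [b, a]) = Fab"
      using tau_mset_cong[of "k @ [b, a]" "k @ [a, b]"] by (auto simp: tau_ext_def fun_eq_iff Fab_def)
    \<comment> \<open>With the longer row last, the Hirota equation applies with \<open>a\<close>
      and \<open>b\<close> exchanged and the recursion runs backwards; reflecting \<open>z\<close>
      restores the form that \<open>Min_window\<close> expects.\<close>
    have "D (z + 1) = min (Z (z + 1) + int a) (D z)" for z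
      using tau_ext_hirota[OF n rc 2, of k z] unfolding ba
      by (simp add: D_def Z_def X_def Y_def F_def Fa_def Fb_def max_def min_def split: if_splits)
    from this[of "- z - 1" for z] have rec: "D (- z) = min (Z (1 - (z + 1)) + int a) (D (- (z + 1)))" for z by simp
    have "Min ((\<lambda>j. Z (z + j)) ` {1..int (n + 1)}) = D z - int b" for z
    proof -
      let ?w = "- (z + int (n + 1))"
      have w: "- (?w + int (n + 1)) = z" "- ?w = z + int (n + 1)" by simp_all
      have "D (- ?w) < D (- (?w + int (n + 1)))" unfolding w using DN[of z] 2 by simp
      then have "Min ((\<lambda>j. Z (1 - (?w + j))) ` {1..int (n + 1)}) = D (- ?w) - int a"
        by (intro Min_window[where D = "\<lambda>z. D (- z)" and Z = "\<lambda>z. Z (1 - z)" and m = "n + 1", OF rec]) auto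
      moreover have "(\<lambda>j. Z (1 - (?w + j))) ` {1..int (n + 1)} = (\<lambda>j. Z (z + j)) ` {1..int (n + 1)}"
      proof -
        have "(\<lambda>j. Z (1 - (?w + j))) ` {1..int (n + 1)} = (\<lambda>j. Z (z + j)) ` (\<lambda>j. int (n + 1) + 1 - j) ` {1..int (n + 1)}"
          unfolding image_image by (intro image_cong) (auto simp: algebra_simps)
        also have "(\<lambda>j. int (n + 1) + 1 - j) ` {1..int (n + 1)} = {1..int (n + 1)}"
          unfolding image_diff_atLeastAtMost by simp
        finally show ?thesis .
      qed
      ultimately show ?thesis unfolding w using DN[of z] by simp
    qed
    then show ?thesis unfolding Q G by simp
  next
    case 3
    then have "D z = 0" for z by (simp add: D_def Fa_def Fb_def)
    \<comment> \<open>For equal lengths \<open>Z\<close> is periodic, so shifting the window by one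
      replaces an entry by an equal one.\<close>
    moreover have "Min ((\<lambda>j. Z (i + j)) ` {1..int (n + 1)}) = Min ((\<lambda>j. Z (i - 1 + j)) ` {1..int (n + 1)})"
    proof -
      have Zper: "Z (z + int (n + 1)) = Z z" for z
        using per[of z] per[of "z - 1"] 3 by (simp add: Z_def X_def Y_def N_def algebra_simps)
      have win: "(\<lambda>j. Z (u + j)) ` {1..int (n + 1)} = Z ` {u + 1..u + int (n + 1)}" for u
      proof -
        have "(\<lambda>j. Z (u + j)) ` {1..int (n + 1)} = Z ` ((+) u ` {1..int (n + 1)})"
          by (simp only: image_image)
        then show ?thesis by (simp only: image_add_atLeastAtMost add.commute[of u])
      qed
      have "{i+1..i + int (n + 1)} = insert (i + int (n + 1)) {i+1..i - 1 + int (n + 1)}"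
        "{i-1+1..i - 1 + int (n + 1)} = insert i {i+1..i - 1 + int (n + 1)}" by auto
      then show ?thesis unfolding win[of i] win[of "i - 1"] using Zper[of i] by (simp only: image_insert)
    qed
    ultimately show ?thesis unfolding Q G by simp
  qed
qed

text \<open>Both sides are increments along a chain of lists from \<open>k\<close> to
  \<open>k @ [a, b]\<close>. The combinatorial R replaces the middle list \<open>k @ [a]\<close> by
  \<open>k @ [b]\<close>, and \<open>G\<close> is the resulting correction. The truncation by
  \<open>nat\<close> in \<open>combR\<close> is harmless by
  \<open>tau_increment_nonneg\<close>.\<close>

lemma combR_tau:
  assumes n: "1 \<le> n" and rc: "rows_pos n rc" and x: "tau_elt n rc k a x" and y: "tau_elt n rc (k @ [a]) b y"
  shows "\<exists>y' x'. combR n x y = (y', x') \<and> tau_elt n rc k b y' \<and> tau_elt n rc (k @ [b]) a x'"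
proof -
  note Q = Qf_tau[OF assms]
  have ba: "tau_ext n rc (k @ [b, a]) = tau_ext n rc (k @ [a, b])" "tau n rc (k @ [b, a]) = tau n rc (k @ [a, b])"
    using tau_mset_cong[of "k @ [b, a]" "k @ [a, b]"] by (auto simp: tau_ext_def fun_eq_iff)
  have tau: "tau_ext n rc k' (int d) - tau_ext n rc k' (int d - 1) = tau n rc k' d - tau n rc k' (d - 1)" if "d \<in> {1..n+1}" for k' d
  proof -
    have "nat ((int d - 1) mod int (n + 1)) = d - 1" using that by (simp add: nat_diff_distrib mod_pos_pos_trivial)
    then show ?thesis using tau_ext_Suc(1,2)[of n rc k' "int d - 1"] that by simp
  qed
  have nth: "map f [1..int n + 1] ! (d - 1) = f (int d)" if "d \<in> {1..n+1}" for f :: "int \<Rightarrow> nat" and d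
    using that by (subst nth_map) (auto simp: nth_upto of_nat_diff nat_add_distrib)
  define y' where "y' = map (\<lambda>i. nat (coord n y i + Qf n x y (i-1) - Qf n x y i)) [1..int n+1]"
  define x' where "x' = map (\<lambda>i. nat (coord n x i + Qf n x y i - Qf n x y (i-1))) [1..int n+1]"
  have "tau_elt n rc k b y'"
    unfolding tau_elt_def
  proof (intro conjI ballI)
    show "length y' = n + 1" by (simp add: y'_def nat_add_distrib)
    fix d assume d: "d \<in> {1..n+1}"
    have "coord n y (int d) + Qf n x y (int d-1) - Qf n x y (int d) =
      tau n rc (k @ [b]) d - tau n rc k d - tau n rc (k @ [b]) (d - 1) + tau n rc k (d - 1)"
      using tau_elt_coord[OF y, of "int d"] Q[of "int d"] tau[OF d, of k] tau[OF d, of "k @ [b]"] by simp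
    then show "int (y' ! (d - 1)) = tau n rc (k @ [b]) d - tau n rc k d - tau n rc (k @ [b]) (d - 1) + tau n rc k (d - 1)"
      using tau_increment_nonneg[OF n rc d, of k b] unfolding y'_def nth[OF d] by simp
  qed
  moreover have "tau_elt n rc (k @ [b]) a x'"
    unfolding tau_elt_def
  proof (intro conjI ballI)
    show "length x' = n + 1" by (simp add: x'_def nat_add_distrib)
    fix d assume d: "d \<in> {1..n+1}"
    have "coord n x (int d) + Qf n x y (int d) - Qf n x y (int d-1) =
      tau n rc ((k @ [b]) @ [a]) d - tau n rc (k @ [b]) d - tau n rc ((k @ [b]) @ [a]) (d - 1) + tau n rc (k @ [b]) (d - 1)"
      using tau_elt_coord[OF x, of "int d"] Q[of "int d"] tau[OF d, of "k @ [b]"] tau[OF d, of "k @ [a, b]"] ba by simp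
    then show "int (x' ! (d - 1)) = tau n rc ((k @ [b]) @ [a]) d - tau n rc (k @ [b]) d - tau n rc ((k @ [b]) @ [a]) (d - 1) + tau n rc (k @ [b]) (d - 1)"
      using tau_increment_nonneg[OF n rc d, of "k @ [b]" a] unfolding x'_def nth[OF d] by simp
  qed
  ultimately show ?thesis unfolding combR_def y'_def x'_def by blast
qed

section \<open>Paths described by tau, and the carrier\<close>

fun tau_path :: "nat \<Rightarrow> rcfg \<Rightarrow> nat list \<Rightarrow> nat list list \<Rightarrow> nat list \<Rightarrow> bool" where
  "tau_path n rc k [] ls \<longleftrightarrow> ls = []"
| "tau_path n rc k (p # ps) [] \<longleftrightarrow> False"
| "tau_path n rc k (p # ps) (l # ls) \<longleftrightarrow> tau_elt n rc k l p \<and> tau_path n rc (k @ [l]) ps ls"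

lemma tau_path_mset_cong: "mset k = mset k' \<Longrightarrow> tau_path n rc k ps ls = tau_path n rc k' ps ls"
proof (induction ps arbitrary: k k' ls)
  case (Cons p ps)
  show ?case
    using tau_elt_mset_cong[OF Cons.prems] Cons.IH[of "k @ [hd ls]" "k' @ [hd ls]"] Cons.prems
    by (cases ls) auto
qed simp

lemma tau_path_nth:
  "tau_path n rc k ps ls \<longleftrightarrow> length ps = length ls \<and> (\<forall>j<length ls. tau_elt n rc (k @ take j ls) (ls ! j) (ps ! j))"
proof (induction ps arbitrary: k ls)
  case (Cons p ps)
  show ?case
  proof (cases ls)
    case (Cons l ls')
    have "(\<forall>j<length ls. tau_elt n rc (k @ take j ls) (ls ! j) ((p # ps) ! j)) \<longleftrightarrow>
      tau_elt n rc k l p \<and> (\<forall>j<length ls'. tau_elt n rc ((k @ [l]) @ take j ls') (ls' ! j) (ps ! j))"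
      by (simp add: Cons All_less_Suc2)
    then show ?thesis using Cons.IH[of "k @ [l]" ls'] Cons by auto
  qed simp
qed auto

text \<open>The carrier row \<open>l\<close> stands directly before the rows still to be passed.
  After one combinatorial R it stands behind one more row, and since tau depends only on the
  multiset of rows, the remaining path is still described by the same data.\<close>

lemma tau_path_evol:
  assumes n: "1 \<le> n" and rc: "rows_pos n rc"
  shows "tau_elt n rc k l v \<Longrightarrow> tau_path n rc (k @ [l]) ps ls \<Longrightarrow> tau_path n rc k (evol n v ps) ls"
proof (induction ps arbitrary: k v ls)
  case (Cons p ps)
  then obtain b bs where ls: "ls = b # bs" by (cases ls) auto
  with Cons.prems(2) have p: "tau_elt n rc (k @ [l]) b p" and ps: "tau_path n rc ((k @ [l]) @ [b]) ps bs" by auto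
  obtain p' v' where c: "combR n v p = (p', v')" and p': "tau_elt n rc k b p'" and v': "tau_elt n rc (k @ [b]) l v'"
    using combR_tau[OF n rc Cons.prems(1) p] by blast
  have "tau_path n rc ((k @ [b]) @ [l]) ps bs"
    using ps by (subst tau_path_mset_cong[of _ "(k @ [l]) @ [b]"]) auto
  from Cons.IH[OF v' this] show ?case using c p' by (simp add: ls)
qed simp

section \<open>Raising the riggings of colour 1\<close>

lemma tau_pos_modify:
  assumes n: "1 \<le> n"
  shows "tau_pos n (modify_rc [l] rc) (l # k) d = tau_pos n rc k d"
proof -
  have val: "tau_val n (l # k) (modify_rc [l] nu) d = tau_val n k nu d" for nu
  proof -
    have lens: "lens_of (modify_rc [l] nu) = lens_of nu"
      by (auto simp: lens_of_def modify_rc_def fun_eq_iff multiset.map_comp comp_def case_prod_beta)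
    have "(\<Sum>x\<in>#A. snd x + int (min l (fst x))) = (\<Sum>x\<in>#A. snd x) + int (\<Sum>x\<in>#image_mset fst A. min l x)" for A :: "(nat \<times> int) multiset"
      by (induction A) auto
    then have one: "(\<Sum>x\<in>#modify_rc [l] nu 1. snd x) = (\<Sum>x\<in>#nu 1. snd x) + int (\<Sum>x\<in>#lens_of nu 1. min l x)"
      by (simp add: modify_rc_def multiset.map_comp comp_def case_prod_beta lens_of_def)
    have "(\<Sum>a\<in>{1..n}. \<Sum>x\<in>#modify_rc [l] nu a. snd x) = (\<Sum>a\<in>{1..n}. (\<Sum>x\<in>#nu a. snd x)
      + (if a = 1 then int (\<Sum>x\<in>#lens_of nu 1. min l x) else 0))"
      using one by (intro sum.cong) (auto simp: modify_rc_def)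
    then have two: "(\<Sum>a\<in>{1..n}. \<Sum>x\<in>#modify_rc [l] nu a. snd x) = (\<Sum>a\<in>{1..n}. \<Sum>x\<in>#nu a. snd x)
      + int (\<Sum>x\<in>#lens_of nu 1. min l x)"
      using n by (simp add: sum.distrib)
    have three: "mmin (mset (l # k)) (lens_of nu 1) = mmin (mset k) (lens_of nu 1) + int (\<Sum>x\<in>#lens_of nu 1. min l x)"
      by (simp add: mmin_def)
    have four: "(\<Sum>x\<in>#modify_rc [l] nu d. fst x) = (\<Sum>x\<in>#nu d. fst x)"
      using lens by (simp add: lens_of_def fun_eq_iff)
    show ?thesis
      unfolding tau_val_def lens two three four by simp
  qed
  show ?thesis
  proof (rule antisym)
    obtain nu where nu: "subconf n nu (modify_rc [l] rc)"
      "tau_val n (l # k) nu d = tau_pos n (modify_rc [l] rc) (l # k) d"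
      using tau_pos_attained by blast
    let ?f = "\<lambda>(m, r). (m :: nat, r + int (\<Sum>l\<leftarrow>[l]. min l m))"
    have "nu 1 \<subseteq># modify_rc [l] rc 1" using nu(1) n unfolding subconf_def by auto
    then have "nu 1 \<subseteq># image_mset ?f (rc 1)" by (simp add: modify_rc_def)
    then obtain B where B: "B \<subseteq># rc 1" "nu 1 = image_mset ?f B"
      by (rule subset_image_inv[where g = "\<lambda>(m, r). (m, r - int (min l m))"]) auto
    have "nu = modify_rc [l] (nu(1 := B))" using B(2) by (auto simp: modify_rc_def fun_eq_iff)
    moreover have "subconf n (nu(1 := B)) rc" using nu(1) B(1) n by (auto simp: subconf_def modify_rc_def)
    ultimately show "tau_pos n (modify_rc [l] rc) (l # k) d \<le> tau_pos n rc k d"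
      using nu(2) val[of "nu(1 := B)"] tau_pos_ge[of n "nu(1 := B)" rc k d] by simp
  next
    obtain nu where nu: "subconf n nu rc" "tau_val n k nu d = tau_pos n rc k d"
      using tau_pos_attained by blast
    have "subconf n (modify_rc [l] nu) (modify_rc [l] rc)"
      using nu(1) n by (auto simp: subconf_def modify_rc_def intro: image_mset_subseteq_mono)
    from tau_pos_ge[OF this, of "l # k" d] show "tau_pos n rc k d \<le> tau_pos n (modify_rc [l] rc) (l # k) d"
      using nu(2) val[of nu] by simp
  qed
qed

text \<open>The correction at \<open>d = 0\<close> does not depend on \<open>k\<close>, so it drops
  out of the differences in \<open>tau_elt\<close>.\<close>

lemma tau_modify:
  assumes n: "1 \<le> n"
  shows "tau n (modify_rc [l] rc) (l # k) d = tau n rc k d - (if d = 0 then int l else 0)"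
  by (simp add: tau_def tau_pos_modify[OF n])

lemma tau_elt_modify:
  assumes n: "1 \<le> n"
  shows "tau_elt n (modify_rc [l] rc) (l # k) b x \<longleftrightarrow> tau_elt n rc k b x"
  unfolding tau_elt_def append_Cons tau_modify[OF n] by auto

lemma tau_path_modify:
  assumes n: "1 \<le> n"
  shows "tau_path n (modify_rc [l] rc) (l # k) ps ls \<longleftrightarrow> tau_path n rc k ps ls"
proof (induction ps arbitrary: k ls)
  case (Cons p ps)
  then show ?case using tau_elt_modify[OF n] by (cases ls) auto
qed simp

lemma rows_pos_modify: "rows_pos n rc \<Longrightarrow> rows_pos n (modify_rc ls rc)"
  unfolding rows_pos_def
proof (intro ballI)
  fix a x assume *: "\<forall>a\<in>{1..n}. \<forall>x\<in>#rc a. 1 \<le> fst x" "a \<in> {1..n}" "x \<in># modify_rc ls rc a"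
  have "\<exists>y. y \<in># rc a \<and> fst y = fst x"
  proof (cases "a = 1")
    case True
    then show ?thesis using *(3) by (force simp: modify_rc_def)
  next
    case False
    then show ?thesis using *(3) by (intro exI[of _ x]) (simp add: modify_rc_def)
  qed
  then show "1 \<le> fst x" using * by metis
qed

lemma tau_pos_le_top: "tau_pos n rc k d \<le> tau_pos n rc k (n + 1)"
proof -
  obtain nu where nu: "subconf n nu rc" "tau_val n k nu d = tau_pos n rc k d"
    using tau_pos_attained by blast
  have "tau_val n k nu d \<le> tau_val n k nu (n + 1)"
    unfolding tau_val_boxes[where d = d] by (simp add: boxes_def del: of_nat_sum_mset)
  then show ?thesis using nu(2) tau_pos_ge[OF nu(1), of k "n + 1"] by simp
qed

text \<open>The condition under which the inserted row is the carrier \<open>u_elt n l\<close>; it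
  survives each modification, so evolutions can be iterated.\<close>

definition tau_nil_const :: "nat \<Rightarrow> rcfg \<Rightarrow> bool" where
  "tau_nil_const n rc \<longleftrightarrow> (\<forall>d\<in>{1..n+1}. tau n rc [] d = tau n rc [] (n + 1))"

text \<open>At the list \<open>[l]\<close> the modified tau takes the old values at the empty list,
  constant for \<open>1 \<le> d\<close>. By supermodularity \<open>g\<close> then decreases weakly
  from index 1 on, and \<open>tau_pos_le_top\<close> closes the chain with
  \<open>g 1 \<le> g (n + 1)\<close>.\<close>

lemma tau_nil_const_modify:
  assumes n: "1 \<le> n" and rc: "rows_pos n rc" and v: "tau_nil_const n rc"
  shows "tau_nil_const n (modify_rc [l] rc)" and "tau_elt n (modify_rc [l] rc) [] l (u_elt n l)"
proof -
  let ?rc = "modify_rc [l] rc"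
  define g where "g = tau n ?rc []"
  have l: "tau n ?rc [l] d = tau n rc [] (n + 1) - (if d = 0 then int l else 0)" if "d \<le> n + 1" for d
  proof (cases "d = 0")
    case True
    then show ?thesis using tau_modify[OF n, of l rc "[]" d] by (simp add: tau_def)
  next
    case False
    then have "tau n rc [] d = tau n rc [] (n + 1)"
      using that by (intro bspec[OF v[unfolded tau_nil_const_def], of d]) auto
    then show ?thesis using tau_modify[OF n, of l rc "[]" d] False by simp
  qed
  have dec: "g d \<le> g (d - 1)" if "2 \<le> d" "d \<le> n + 1" for d
    using tau_increment_nonneg[OF n rows_pos_modify[OF rc, of "[l]"], where d = d and k = "[]" and b = l] that l[of d] l[of "d - 1"]
    by (simp add: g_def)
  have le1: "g 1 \<le> g (n + 1)" using tau_pos_le_top[of n ?rc "[]" 1] by (simp add: g_def tau_def)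
  have down: "g d \<le> g 1" if "1 \<le> d" "d \<le> n + 1" for d
    using that
  proof (induction d rule: dec_induct)
    case (step d)
    then show ?case using dec[of "Suc d"] by simp
  qed simp
  have up: "g (n + 1) \<le> g (n + 1 - j)" if "j \<le> n" for j
    using that
  proof (induction j)
    case (Suc j)
    have e: "n + 1 - Suc j = n + 1 - j - 1" by simp
    have "g (n + 1 - j) \<le> g (n + 1 - j - 1)" by (rule dec) (use Suc.prems in arith)+
    then show ?case unfolding e using Suc.IH Suc.prems by simp
  qed simp
  have const: "g d = g (n + 1)" if "d \<in> {1..n+1}" for d
  proof -
    have "n + 1 - d \<le> n" "n + 1 - (n + 1 - d) = d" using that by auto
    then have "g (n + 1) \<le> g d" using up[of "n + 1 - d"] by simp
    then show ?thesis using down[of d] le1 that by simp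
  qed
  show "tau_nil_const n ?rc" using const unfolding tau_nil_const_def g_def by blast
  have g0: "g 0 = g (n + 1)" by (simp add: g_def tau_def)
  show "tau_elt n ?rc [] l (u_elt n l)"
    unfolding tau_elt_def
  proof (intro conjI ballI)
    show "length (u_elt n l) = n + 1" by (simp add: u_elt_def)
    fix d assume d: "d \<in> {1..n+1}"
    have "int (u_elt n l ! (d - 1)) = (if d = 1 then int l else 0)"
      using d by (auto simp: u_elt_def nth_Cons')
    moreover have "g d = g (d - 1)"
    proof (cases "d = 1")
      case True
      then show ?thesis using const[OF d] g0 by simp
    next
      case False
      then have "d - 1 \<in> {1..n+1}" using d by auto
      then show ?thesis using const[OF d] const[of "d - 1"] by simp
    qed
    ultimately show "int (u_elt n l ! (d - 1)) =
      tau n ?rc ([] @ [l]) d - tau n ?rc [] d - tau n ?rc ([] @ [l]) (d - 1) + tau n ?rc [] (d - 1)"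
      using l[of d] l[of "d - 1"] d by (auto simp: g_def)
  qed
qed

lemma modify_Cons: "modify_rc (l # ls) rc = modify_rc [l] (modify_rc ls rc)"
  by (auto simp: modify_rc_def fun_eq_iff multiset.map_comp comp_def case_prod_beta intro!: image_mset_cong)

text \<open>In each step a row \<open>l\<close> is put in front of \<open>lam\<close> as the
  carrier. The evolution takes it past all of \<open>lam\<close>, so it no longer occurs in any
  prefix and the invariant has the same form for the next step.\<close>

lemma evolution_linear:
  assumes n: "1 \<le> n" and rc: "rows_pos n rc" and v: "tau_nil_const n rc" and p: "tau_path n rc [] p lam"
  shows "tau_path n (modify_rc ls rc) [] (foldr (T_evol n) ls p) lam \<and> tau_nil_const n (modify_rc ls rc)"
proof (induction ls)
  case Nil
  have "modify_rc [] rc = rc" by (simp add: modify_rc_def case_prod_beta)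
  then show ?case using p v by simp
next
  case (Cons l ls)
  have r: "rows_pos n (modify_rc ls rc)" by (rule rows_pos_modify[OF rc])
  have "tau_path n (modify_rc (l # ls) rc) ([] @ [l]) (foldr (T_evol n) ls p) lam"
    unfolding modify_Cons[of l ls] using Cons tau_path_modify[OF n, of l _ "[]"] by simp
  moreover have "tau_elt n (modify_rc (l # ls) rc) [] l (u_elt n l)"
    unfolding modify_Cons[of l ls] using tau_nil_const_modify(2)[OF n r] Cons by blast
  ultimately have "tau_path n (modify_rc (l # ls) rc) [] (evol n (u_elt n l) (foldr (T_evol n) ls p)) lam"
    using tau_path_evol[OF n rows_pos_modify[OF rc]] by blast
  moreover have "tau_nil_const n (modify_rc (l # ls) rc)"
    unfolding modify_Cons[of l ls] using tau_nil_const_modify(1)[OF n r] Cons by blast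
  ultimately show ?case by (simp add: T_evol_def[of n l])
qed

lemma above_diff:
  assumes "d < length x"
  shows "above d x - above (d + 1) x = int (x ! d)"
  unfolding above_def using Cons_nth_drop_Suc[OF assms, symmetric] by simp

lemma urc_tau_path:
  assumes n: "1 \<le> n" and urc: "urc n p rc" and len: "\<forall>x\<in>set p. length x = n + 1"
  shows "tau_path n rc [] p (map sum_list p)" and "tau_nil_const n rc" and "rows_pos n rc"
proof -
  let ?l = "map sum_list p"
  show "rows_pos n rc" using urc_tau(1)[OF n urc] by (simp add: rows_pos_def)
  show "tau_nil_const n rc" using urc_tau(2)[OF n urc, of 0] by (auto simp: tau_nil_const_def tau_def)
  show "tau_path n rc [] p ?l"
    unfolding tau_path_nth
  proof (intro conjI allI impI)
    fix j assume "j < length ?l"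
    then have j: "j < length p" by simp
    define x where "x = p ! j"
    have x: "length x = n + 1" using len j by (simp add: x_def)
    have t: "take (Suc j) ?l = take j ?l @ [sum_list x]" using j by (simp add: take_Suc_conv_app_nth x_def)
    have tp: "(\<Sum>y\<leftarrow>take (Suc j) p. above d y) = (\<Sum>y\<leftarrow>take j p. above d y) + above d x" for d
      using j by (simp add: take_Suc_conv_app_nth x_def)
    obtain K1 where K1: "\<forall>d\<in>{1..n+1}. tau_pos n rc (take j ?l) d = K1 - (\<Sum>x\<leftarrow>take j p. above d x)"
      using urc_tau(2)[OF n urc, of j] j by auto
    obtain K2 where K2: "\<forall>d\<in>{1..n+1}. tau_pos n rc (take j ?l @ [sum_list x]) d = K2 - ((\<Sum>x\<leftarrow>take j p. above d x) + above d x)"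
      using urc_tau(2)[OF n urc, of "Suc j"] j unfolding t tp by auto
    have "tau_elt n rc (take j ?l) (sum_list x) x"
      unfolding tau_elt_def
    proof (intro conjI ballI x)
      fix d assume d: "d \<in> {1..n+1}"
      have e: "above (d - 1) x - above d x = int (x ! (d - 1))" using above_diff[of "d - 1" x] d x by (cases d) auto
      show "int (x ! (d - 1)) = tau n rc (take j ?l @ [sum_list x]) d - tau n rc (take j ?l) d
          - tau n rc (take j ?l @ [sum_list x]) (d - 1) + tau n rc (take j ?l) (d - 1)"
      proof (cases "d = 1")
        case True
        \<comment> \<open>At \<open>d = 1\<close> the index 0 is reduced to \<open>n + 1\<close>,
          above which there is no letter, and the size of \<open>kappa\<close> in the definition of
          \<open>tau\<close> supplies the count for 0.\<close>
        have "above (n + 1) x = 0" using x by (simp add: above_def)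
        moreover have "above 0 x = int (sum_list x)" by (simp add: above_def)
        ultimately show ?thesis
          using True e bspec[OF K1 d] bspec[OF K2 d] bspec[OF K1, of "n + 1"] bspec[OF K2, of "n + 1"]
          by (simp add: tau_def)
      next
        case False
        then have d1: "d - 1 \<in> {1..n+1}" using d by auto
        show ?thesis
          using False d e bspec[OF K1 d] bspec[OF K2 d] bspec[OF K1 d1] bspec[OF K2 d1]
          by (simp add: tau_def)
      qed
    qed
    then show "tau_elt n rc ([] @ take j ?l) (?l ! j) (p ! j)" using j by (simp add: x_def)
  qed simp
qed

theorem theorem7p6:
  fixes n :: nat and q :: "nat list list" and ls :: "nat list" and tail :: "nat \<Rightarrow> nat"
  assumes "1 \<le> n"
    and "\<forall>x\<in>set q. length x = n + 1 \<and> 1 \<le> sum_list x"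
    and "\<forall>l\<in>set ls. 1 \<le> l"
    and "\<forall>i. 1 \<le> tail i"
  shows "\<exists>N. \<forall>m\<ge>N. \<forall>rc.
           (let p = q @ map (\<lambda>i. u_elt n (tail i)) [0..<m];
                lam = map sum_list p;
                rc' = modify_rc ls rc;
                p' = foldr (T_evol n) ls p
            in urc n p rc \<longrightarrow>
               length p' = length p \<and>
               (\<forall>k\<in>{1..length p}. \<forall>d\<in>{1..n+1}.
                  int (p' ! (k - 1) ! (d - 1)) =
                    tauk n lam rc' k d - tauk n lam rc' (k - 1) d
                    - tauk n lam rc' k (d - 1) + tauk n lam rc' (k - 1) (d - 1)))"
proof -
  have "length p' = length p \<and>
      (\<forall>k\<in>{1..length p}. \<forall>d\<in>{1..n+1}. int (p' ! (k - 1) ! (d - 1)) =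
        tauk n lam rc' k d - tauk n lam rc' (k - 1) d - tauk n lam rc' k (d - 1) + tauk n lam rc' (k - 1) (d - 1))"
    if p: "p = q @ map (\<lambda>i. u_elt n (tail i)) [0..<m]" and lam: "lam = map sum_list p"
      and rc': "rc' = modify_rc ls rc" and p': "p' = foldr (T_evol n) ls p" and urc: "urc n p rc" for m rc p lam rc' p'
  proof -
    have "\<forall>x\<in>set p. length x = n + 1" using assms(2) by (auto simp: p u_elt_def)
    note u = urc_tau_path[OF assms(1) urc this]
    have "tau_path n rc' [] p' lam"
      using evolution_linear[OF assms(1) u(3,2,1)] by (simp add: rc' p' lam)
    then have len: "length p' = length p" and r: "\<And>j. j < length p \<Longrightarrow> tau_elt n rc' (take j lam) (lam ! j) (p' ! j)"
      unfolding tau_path_nth by (auto simp: lam)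
    have "int (p' ! (k - 1) ! (d - 1)) =
        tauk n lam rc' k d - tauk n lam rc' (k - 1) d - tauk n lam rc' k (d - 1) + tauk n lam rc' (k - 1) (d - 1)"
      if k: "k \<in> {1..length p}" and d: "d \<in> {1..n+1}" for k d
    proof -
      have "take k lam = take (k - 1) lam @ [lam ! (k - 1)]"
      proof -
        have "k - 1 < length lam" "Suc (k - 1) = k" using k by (auto simp: lam)
        then show ?thesis using take_Suc_conv_app_nth[of "k - 1" lam] by simp
      qed
      moreover have "k - 1 < length p" using k by auto
      ultimately show ?thesis using r[of "k - 1"] d unfolding tau_elt_def tauk_def by simp
    qed
    with len show ?thesis by blast
  qed
  then show ?thesis unfolding Let_def by blast
qed

end
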